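(* The integral Schur algebra $S_{\mathbb{Z}}(n,d)$ is the subring of $S(n,d)$ generated by all divided powers $e_i^{(m)}, f_i^{(m)}$ ($1\le i\le n-1$, $m\in\mathbb{N}$). Moreover, each of the disjoint unions (a) $Y_+=\bigcup_{\lambda}\{e_A1_\lambda f_C \mid \chi(e_Af_C)\preceq\lambda\}$, (b) $Y_-=\bigcup_{\lambda}\{f_A1_\lambda e_C \mid \chi(f_Ae_C)\preceq\lambda\}$, where $\lambda$ varies over $\Lambda(n,d)$ and $A,C$ over $\mathbb{N}^{\Phi^+}$, is a $\mathbb{Z}$-basis of $S_{\mathbb{Z}}(n,d)$.
   Context: $n\ge 1$, $d\ge 0$ are integers, $\mathbb{N}=\{0,1,2,\dots\}$. $V_{\mathbb{Z}}=\mathbb{Z}^n$, $V=\mathbb{Q}^n$; $\Sigma_d$ permutes tensor places; $S(n,d)=\operatorname{End}_{\Sigma_d}(V^{\otimes d})$ and $S_{\mathbb{Z}}(n,d)=\operatorname{End}_{\Sigma_d}(V_{\mathbb{Z}}^{\otimes d})\subset S(n,d)$. The Lie algebra $\mathfrak{gl}_n$ acts on $V^{\otimes d}$ by derivations, which gives a surjection $U(\mathfrak{gl}_n)\to S(n,d)$; $e_i,f_i,H_i$ denote the images of the matrix units $e_{i,i+1}$, $e_{i+1,i}$, $e_{i,i}$. $\varepsilon_1,\dots,\varepsilon_n$ is the standard basis of $\mathbb{R}^n$, $\Phi=\{\varepsilon_i-\varepsilon_j\mid 1\le i\ne j\le n\}$, $\Phi^+=\{\varepsilon_i-\varepsilon_j\mid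 i<j\}$, $\alpha_i=\varepsilon_i-\varepsilon_{i+1}$. Root vectors: for $\alpha=\varepsilon_i-\varepsilon_j$, $i<j$: if $j-i=1$, $x_\alpha=e_i$, $x_{-\alpha}=f_i$; if $j-i>1$, inductively $x_\alpha=e_ix_{\alpha-\alpha_i}-x_{\alpha-\alpha_i}e_i$, $x_{-\alpha}=x_{-\alpha+\alpha_i}f_i-f_ix_{-\alpha+\alpha_i}$ (so $x_{\varepsilon_i-\varepsilon_j}$ is the image of $e_{i,j}$). Divided powers: $x^{(m)}=x^m/m!$. $\binom{H_i}{m}=H_i(H_i-1)\cdots(H_i-m+1)/m!$, $\binom{H_i}{0}=1$. $\Lambda(n,d)=\{\lambda\in\mathbb{N}^n\mid\sum_i\lambda_i=d\}$, and $1_\lambda=\prod_{i=1}^n\binom{H_i}{\lambda_i}$. For $A,C\in\mathbb{N}^{\Phi^+}$, $e_A=\prod_{\alpha\in\Phi^+}x_\alpha^{(A(\alpha))}$ and $f_C=\prod_{\alpha\in\Phi^+}x_{-\alpha}^{(C(\alpha))}$, the products being taken relative to any two fixed orders on $\Phi^+$. The content $\chi$ of a (formal) product of elements $x_\alpha^{(m)}$, $\binom{H_i}{m}$ is the element of $\mathbb{N}^n$ determined by $\chi(x_\alpha^{(m)})=m\,\varepsilon_{\max(i,j)}$ for $\alpha=\varepsilon_i-\varepsilon_j$, $\chi(\binom{H_i}{m})=0$, and $\chi(XY)=\chi(X)+\chi(Y)$. $\preceq$ is the componentwise partial order on $\mathbb{N}^n$.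
   Formalization: In (b) the content χ is taken with min(i,j) in place of max(i,j): with max, (b) is false for all n ≥ 2, d ≥ 1 (for λ = dε_2, f_1 1_λ = 0 although χ(f_1) = ε_2 ⪯ λ, so 0 lies in Y_-); for n = 1 or d = 0 the two conditions agree. *)

theory Defs
  imports "HOL-Algebra.Generated_Rings" "HOL-Algebra.Module" "HOL-Combinatorics.Permutations"
    "HOL-Library.Disjoint_Sets"
begin

section \<open>Tensor space\<close>

text \<open>The tensor power \<open>V\<^sup>\<otimes>\<^sup>d\<close> of the free module \<open>V = R\<^sup>n\<close>, for a subring \<open>R\<close> of the rationals,
  is free on the tensors \<open>v\<^sub>w = v\<^bsub>w!0\<^esub> \<otimes> \<dots> \<otimes> v\<^bsub>w!(d-1)\<^esub>\<close>, where \<open>w\<close> runs over the words of length \<open>d\<close> in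
  the letters \<open>1, \<dots>, n\<close>. A tensor is represented by its coordinate function with respect to this
  basis, extended by zero to all lists.\<close>

type_synonym tensor = "nat list \<Rightarrow> rat"

definition words :: "nat \<Rightarrow> nat \<Rightarrow> nat list set" where
  "words n d = {w. length w = d \<and> set w \<subseteq> {1..n}}"

definition tensors :: "rat set \<Rightarrow> nat \<Rightarrow> nat \<Rightarrow> tensor set" where
  "tensors R n d = {t. (\<forall>w. t w \<in> R) \<and> (\<forall>w. w \<notin> words n d \<longrightarrow> t w = 0)}"

definition pure_tensor :: "nat \<Rightarrow> (nat \<Rightarrow> rat) list \<Rightarrow> tensor" where
  "pure_tensor n vs =
     (\<lambda>w. if w \<in> words n (length vs) then \<Prod>k<length vs. (vs ! k) (w ! k) else 0)"

text \<open>The action of a permutation of the places \<open>{..<d}\<close>; see \<open>place_perm_pure_tensor\<close>.\<close>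

definition place_perm :: "(nat \<Rightarrow> nat) \<Rightarrow> tensor \<Rightarrow> tensor" where
  "place_perm \<sigma> t = (\<lambda>w. t (permute_list \<sigma> w))"

text \<open>The action by derivations of the Lie algebra of \<open>n \<times> n\<close> matrices; see \<open>gl_action_pure_tensor\<close>.\<close>

definition gl_action :: "nat \<Rightarrow> nat \<Rightarrow> (nat \<Rightarrow> nat \<Rightarrow> rat) \<Rightarrow> tensor \<Rightarrow> tensor" where
  "gl_action n d X t =
     (\<lambda>w. if w \<in> words n d then \<Sum>k<d. \<Sum>j=1..n. X (w ! k) j * t (w[k := j]) else 0)"

definition matrix_unit :: "nat \<Rightarrow> nat \<Rightarrow> nat \<Rightarrow> nat \<Rightarrow> rat" where
  "matrix_unit i j = (\<lambda>a b. if a = i \<and> b = j then 1 else 0)"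

lemma place_perm_pure_tensor:
  assumes "\<sigma> permutes {..<length vs}"
  shows "place_perm \<sigma> (pure_tensor n vs) = pure_tensor n (permute_list (Hilbert_Choice.inv \<sigma>) vs)"
proof
  fix w
  show "place_perm \<sigma> (pure_tensor n vs) w = pure_tensor n (permute_list (Hilbert_Choice.inv \<sigma>) vs) w"
  proof (cases "length w = length vs")
    case True
    have i: "Hilbert_Choice.inv \<sigma> permutes {..<length vs}" using assms by (rule permutes_inv)
    have s: "set (permute_list \<sigma> w) = set w" using assms True by simp
    have "(\<Prod>k<length vs. (vs ! k) (permute_list \<sigma> w ! k)) = (\<Prod>k<length vs. (vs ! k) (w ! \<sigma> k))"
      using assms True by (intro prod.cong) (auto simp: permute_list_nth)
    also have "\<dots> = (\<Prod>k<length vs. (vs ! Hilbert_Choice.inv \<sigma> k) (w ! \<sigma> (Hilbert_Choice.inv \<sigma> k)))"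
      using prod.permute[OF i, of "\<lambda>k. (vs ! k) (w ! \<sigma> k)"] by (simp add: o_def)
    also have "\<dots> = (\<Prod>k<length vs. (permute_list (Hilbert_Choice.inv \<sigma>) vs ! k) (w ! k))"
      using i permutes_inverses(1)[OF assms] by (intro prod.cong) (auto simp: permute_list_nth)
    finally show ?thesis
      using True s by (simp add: place_perm_def pure_tensor_def words_def)
  qed (auto simp: place_perm_def pure_tensor_def words_def)
qed

lemma gl_action_pure_tensor:
  "gl_action n (length vs) X (pure_tensor n vs) =
     (\<lambda>w. \<Sum>k<length vs. pure_tensor n (vs[k := (\<lambda>i. \<Sum>j=1..n. X i j * (vs ! k) j)]) w)"
proof
  fix w
  let ?d = "length vs"
  have "(\<Sum>j=1..n. X (w ! k) j * pure_tensor n vs (w[k := j])) =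
        pure_tensor n (vs[k := (\<lambda>i. \<Sum>j=1..n. X i j * (vs ! k) j)]) w"
    if w: "w \<in> words n ?d" and k: "k < ?d" for k
  proof -
    have l: "length w = ?d" using w by (simp add: words_def)
    have u: "w[k := j] \<in> words n ?d" if "j \<in> {1..n}" for j
      using w that set_update_subset_insert[of w k j] by (fastforce simp: words_def)
    have fk: "{..<?d} = insert k ({..<?d} - {k})" using k by auto
    have "(\<Sum>j=1..n. X (w ! k) j * pure_tensor n vs (w[k := j])) =
          (\<Sum>j=1..n. X (w ! k) j * (\<Prod>l<?d. (vs ! l) (w[k := j] ! l)))"
      using u by (intro sum.cong) (auto simp: pure_tensor_def)
    also have "\<dots> = (\<Sum>j=1..n. X (w ! k) j * ((vs ! k) j * (\<Prod>l\<in>{..<?d}-{k}. (vs ! l) (w ! l))))"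
      using k l by (subst (1) fk) (simp add: prod.insert_remove)
    also have "\<dots> = (\<Sum>j=1..n. X (w ! k) j * (vs ! k) j) * (\<Prod>l\<in>{..<?d}-{k}. (vs ! l) (w ! l))"
      by (simp add: sum_distrib_right mult.assoc)
    also have "\<dots> = (\<Prod>l<?d. (vs[k := (\<lambda>i. \<Sum>j=1..n. X i j * (vs ! k) j)] ! l) (w ! l))"
      using k by (subst (2) fk) (simp add: prod.insert_remove)
    finally show ?thesis using w by (simp add: pure_tensor_def)
  qed
  then show "gl_action n ?d X (pure_tensor n vs) w =
     (\<Sum>k<?d. pure_tensor n (vs[k := (\<lambda>i. \<Sum>j=1..n. X i j * (vs ! k) j)]) w)"
    by (cases "w \<in> words n ?d") (auto simp: gl_action_def pure_tensor_def intro!: sum.cong)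
qed

section \<open>The Schur algebra and its integral form\<close>

text \<open>\<open>End\<close> of the tensor space over \<open>R\<close>, commuting with the place permutations.\<close>

definition tensor_endos :: "rat set \<Rightarrow> nat \<Rightarrow> nat \<Rightarrow> (tensor \<Rightarrow> tensor) set" where
  "tensor_endos R n d = {f \<in> tensors R n d \<rightarrow>\<^sub>E tensors R n d.
     (\<forall>s\<in>tensors R n d. \<forall>t\<in>tensors R n d. f (\<lambda>w. s w + t w) = (\<lambda>w. f s w + f t w)) \<and>
     (\<forall>q\<in>R. \<forall>t\<in>tensors R n d. f (\<lambda>w. q * t w) = (\<lambda>w. q * f t w)) \<and>
     (\<forall>\<sigma>. \<sigma> permutes {..<d} \<longrightarrow>
        (\<forall>t\<in>tensors R n d. f (place_perm \<sigma> t) = place_perm \<sigma> (f t)))}"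

definition schur_algebra :: "nat \<Rightarrow> nat \<Rightarrow> (rat, tensor \<Rightarrow> tensor) module" where
  "schur_algebra n d =
     \<lparr>carrier = tensor_endos UNIV n d,
      monoid.mult = (\<lambda>f g. compose (tensors UNIV n d) f g),
      one = (\<lambda>t\<in>tensors UNIV n d. t),
      zero = (\<lambda>t\<in>tensors UNIV n d. \<lambda>w. 0),
      add = (\<lambda>f g. \<lambda>t\<in>tensors UNIV n d. \<lambda>w. f t w + g t w),
      smult = (\<lambda>q f. \<lambda>t\<in>tensors UNIV n d. \<lambda>w. q * f t w)\<rparr>"

text \<open>An endomorphism of the lattice extends uniquely to the rational tensor space; under this
  identification the integral form consists of the elements of the Schur algebra that restrict to
  an endomorphism of the lattice.\<close>

definition integral_schur_algebra :: "nat \<Rightarrow> nat \<Rightarrow> (tensor \<Rightarrow> tensor) set" where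
  "integral_schur_algebra n d =
     {f \<in> carrier (schur_algebra n d). restrict f (tensors \<int> n d) \<in> tensor_endos \<int> n d}"

definition gl_op :: "nat \<Rightarrow> nat \<Rightarrow> (nat \<Rightarrow> nat \<Rightarrow> rat) \<Rightarrow> tensor \<Rightarrow> tensor" where
  "gl_op n d X = (\<lambda>t\<in>tensors UNIV n d. gl_action n d X t)"

definition e_op :: "nat \<Rightarrow> nat \<Rightarrow> nat \<Rightarrow> tensor \<Rightarrow> tensor" where
  "e_op n d i = gl_op n d (matrix_unit i (i + 1))"

definition f_op :: "nat \<Rightarrow> nat \<Rightarrow> nat \<Rightarrow> tensor \<Rightarrow> tensor" where
  "f_op n d i = gl_op n d (matrix_unit (i + 1) i)"

definition H_op :: "nat \<Rightarrow> nat \<Rightarrow> nat \<Rightarrow> tensor \<Rightarrow> tensor" where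
  "H_op n d i = gl_op n d (matrix_unit i i)"

lemma words_permute_list:
  assumes "\<sigma> permutes {..<d}" "length w = d"
  shows "permute_list \<sigma> w \<in> words n d \<longleftrightarrow> w \<in> words n d"
  using assms by (simp add: words_def)

lemma place_perm_tensors:
  assumes "\<sigma> permutes {..<d}" "t \<in> tensors R n d"
  shows "place_perm \<sigma> t \<in> tensors R n d"
proof -
  have "t (permute_list \<sigma> w) = 0" if "w \<notin> words n d" for w
  proof (cases "length w = d")
    case True
    then show ?thesis using that assms words_permute_list[of \<sigma> d w n] by (simp add: tensors_def)
  next
    case False
    then show ?thesis using assms by (simp add: tensors_def words_def)
  qed
  then show ?thesis using assms by (simp add: place_perm_def tensors_def)
qed

lemma gl_op_closed: "gl_op n d X \<in> carrier (schur_algebra n d)"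
proof -
  have T: "gl_action n d X t \<in> tensors UNIV n d" for t
    by (simp add: tensors_def gl_action_def)
  have perm: "gl_action n d X (place_perm \<sigma> t) = place_perm \<sigma> (gl_action n d X t)"
    if \<sigma>: "\<sigma> permutes {..<d}" for \<sigma> t
  proof
    fix w
    show "gl_action n d X (place_perm \<sigma> t) w = place_perm \<sigma> (gl_action n d X t) w"
    proof (cases "w \<in> words n d")
      case True
      then have l: "length w = d" by (simp add: words_def)
      have p: "permute_list \<sigma> (w[\<sigma> k := j]) = (permute_list \<sigma> w)[k := j]" if "k < d" for k j
      proof (rule nth_equalityI)
        fix i assume "i < length (permute_list \<sigma> (w[\<sigma> k := j]))"
        then have i: "i < d" using l by simp
        have "\<sigma> i < d" using \<sigma> i permutes_in_image by fastforce
        moreover have "\<sigma> k = \<sigma> i \<longleftrightarrow> k = i" using permutes_inj[OF \<sigma>] by (auto dest: injD)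
        ultimately show "permute_list \<sigma> (w[\<sigma> k := j]) ! i = (permute_list \<sigma> w)[k := j] ! i"
          using \<sigma> l i that by (simp add: permute_list_nth nth_list_update)
      qed simp
      have "(\<Sum>k<d. \<Sum>j=1..n. X (w ! k) j * t (permute_list \<sigma> (w[k := j]))) =
            (\<Sum>k<d. \<Sum>j=1..n. X (w ! \<sigma> k) j * t (permute_list \<sigma> (w[\<sigma> k := j])))"
        using sum.permute[OF \<sigma>, of "\<lambda>k. \<Sum>j=1..n. X (w ! k) j * t (permute_list \<sigma> (w[k := j]))"]
        by (simp add: o_def)
      also have "\<dots> = (\<Sum>k<d. \<Sum>j=1..n. X (permute_list \<sigma> w ! k) j * t ((permute_list \<sigma> w)[k := j]))"
        using \<sigma> l p by (intro sum.cong) (auto simp: permute_list_nth)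
      finally show ?thesis
        using True \<sigma> l words_permute_list[OF \<sigma> l, of n] by (simp add: gl_action_def place_perm_def)
    next
      case False
      then have "permute_list \<sigma> w \<notin> words n d"
        using words_permute_list[OF \<sigma>, of w n] by (cases "length w = d") (auto simp: words_def)
      then show ?thesis using False by (simp add: gl_action_def place_perm_def)
    qed
  qed
  have [simp]: "s \<in> tensors UNIV n d \<Longrightarrow> t \<in> tensors UNIV n d \<Longrightarrow> (\<lambda>w. s w + t w) \<in> tensors UNIV n d"
    "t \<in> tensors UNIV n d \<Longrightarrow> (\<lambda>w. q * t w) \<in> tensors UNIV n d" for s t q
    by (simp_all add: tensors_def)
  have add: "gl_action n d X (\<lambda>w. s w + t w) = (\<lambda>w. gl_action n d X s w + gl_action n d X t w)" for s t
    by (auto simp: gl_action_def fun_eq_iff distrib_left sum.distrib)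
  have scale: "gl_action n d X (\<lambda>w. q * t w) = (\<lambda>w. q * gl_action n d X t w)" for q t
    by (auto simp: gl_action_def fun_eq_iff sum_distrib_left mult.left_commute)
  show ?thesis
    by (auto simp: schur_algebra_def tensor_endos_def gl_op_def place_perm_tensors T perm add scale)
qed

lemma ring_schur_algebra: "ring (schur_algebra n d)"
proof -
  let ?T = "tensors UNIV n d"
  let ?S = "schur_algebra n d"
  have cl: "(\<lambda>w. s w + t w) \<in> ?T" "(\<lambda>w. q * t w) \<in> ?T" "(\<lambda>w. - t w) \<in> ?T" "(\<lambda>w. 0) \<in> ?T"
    if "s \<in> ?T" "t \<in> ?T" for s t q
    using that by (simp_all add: tensors_def)
  have z: "(\<lambda>w. 0) \<in> ?T" by (simp add: tensors_def)
  have fT: "f t \<in> ?T" if "f \<in> tensor_endos UNIV n d" "t \<in> ?T" for f t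
    using that by (auto simp: tensor_endos_def)
  have ext: "f = g" if "f \<in> extensional ?T" "g \<in> extensional ?T" "\<And>t. t \<in> ?T \<Longrightarrow> f t = g t" for f g
    using that by (rule extensionalityI)
  have fe: "f \<in> extensional ?T" if "f \<in> tensor_endos UNIV n d" for f
    using that by (auto simp: tensor_endos_def PiE_def)
  have addc: "(\<lambda>t\<in>?T. \<lambda>w. f t w + g t w) \<in> tensor_endos UNIV n d"
    if "f \<in> tensor_endos UNIV n d" "g \<in> tensor_endos UNIV n d" for f g
    using that fT[OF that(1)] fT[OF that(2)]
    by (auto simp: tensor_endos_def cl place_perm_tensors algebra_simps)
       (auto simp: place_perm_def)
  have negc: "(\<lambda>t\<in>?T. \<lambda>w. - f t w) \<in> tensor_endos UNIV n d"
    if "f \<in> tensor_endos UNIV n d" for f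
    using that fT[OF that]
    by (auto simp: tensor_endos_def cl place_perm_tensors algebra_simps)
       (auto simp: place_perm_def)
  have multc: "compose ?T f g \<in> tensor_endos UNIV n d"
    if "f \<in> tensor_endos UNIV n d" "g \<in> tensor_endos UNIV n d" for f g
    using that fT[OF that(1)] fT[OF that(2)]
    by (auto simp: tensor_endos_def cl place_perm_tensors compose_def)
  have zc: "(\<lambda>t\<in>?T. \<lambda>w. 0) \<in> tensor_endos UNIV n d"
    using z by (auto simp: tensor_endos_def cl place_perm_tensors place_perm_def)
      (auto simp: place_perm_def dest: place_perm_tensors)
  have onec: "(\<lambda>t\<in>?T. t) \<in> tensor_endos UNIV n d"
    by (auto simp: tensor_endos_def cl place_perm_tensors)
  have fadd: "f (\<lambda>w. s w + t w) = (\<lambda>w. f s w + f t w)"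
    if "f \<in> tensor_endos UNIV n d" "s \<in> ?T" "t \<in> ?T" for f s t
    using that by (auto simp: tensor_endos_def)
  note D = schur_algebra_def
  show ?thesis
  proof (rule ringI)
    show "abelian_group ?S"
    proof (rule abelian_groupI)
      fix x assume "x \<in> carrier ?S"
      then have x: "x \<in> tensor_endos UNIV n d" by (simp add: D)
      show "\<exists>y\<in>carrier ?S. y \<oplus>\<^bsub>?S\<^esub> x = \<zero>\<^bsub>?S\<^esub>"
        by (rule bexI[of _ "\<lambda>t\<in>?T. \<lambda>w. - x t w"]) (use negc[OF x] in \<open>auto simp: D intro: ext\<close>)
      show "\<zero>\<^bsub>?S\<^esub> \<oplus>\<^bsub>?S\<^esub> x = x"
        using fe[OF x] by (auto simp: D intro!: ext)
    qed (auto simp: D addc zc algebra_simps intro!: ext)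
    show "monoid ?S"
    proof (rule monoidI)
      fix x y w
      assume "x \<in> carrier ?S" "y \<in> carrier ?S" "w \<in> carrier ?S"
      then show "x \<otimes>\<^bsub>?S\<^esub> y \<otimes>\<^bsub>?S\<^esub> w = x \<otimes>\<^bsub>?S\<^esub> (y \<otimes>\<^bsub>?S\<^esub> w)"
        using fT by (auto simp: D compose_def intro!: ext)
    next
      fix x assume "x \<in> carrier ?S"
      then show "\<one>\<^bsub>?S\<^esub> \<otimes>\<^bsub>?S\<^esub> x = x" "x \<otimes>\<^bsub>?S\<^esub> \<one>\<^bsub>?S\<^esub> = x"
        using fT fe by (auto simp: D compose_def intro!: ext)
    qed (auto simp: D multc onec)
  next
    fix x y u
    assume a: "x \<in> carrier ?S" "y \<in> carrier ?S" "u \<in> carrier ?S"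
    then show "(x \<oplus>\<^bsub>?S\<^esub> y) \<otimes>\<^bsub>?S\<^esub> u = x \<otimes>\<^bsub>?S\<^esub> u \<oplus>\<^bsub>?S\<^esub> y \<otimes>\<^bsub>?S\<^esub> u"
      using fT by (auto simp: D compose_def intro!: ext)
    show "u \<otimes>\<^bsub>?S\<^esub> (x \<oplus>\<^bsub>?S\<^esub> y) = u \<otimes>\<^bsub>?S\<^esub> x \<oplus>\<^bsub>?S\<^esub> u \<otimes>\<^bsub>?S\<^esub> y"
      using a fT fadd by (auto simp: D compose_def intro!: ext)
  qed
qed

section \<open>Root vectors, divided powers and formal products\<close>

text \<open>The root \<open>\<epsilon>\<^sub>i - \<epsilon>\<^sub>j\<close> is encoded by the pair \<open>(i, j)\<close>.\<close>

definition pos_roots :: "nat \<Rightarrow> (nat \<times> nat) set" where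
  "pos_roots n = {(i, j). 1 \<le> i \<and> i < j \<and> j \<le> n}"

text \<open>For \<open>i < j\<close>, the following are the root vectors for \<open>\<epsilon>\<^sub>i - \<epsilon>\<^sub>j\<close> and for \<open>\<epsilon>\<^sub>j - \<epsilon>\<^sub>i\<close>, respectively.\<close>

function pos_root_vector :: "nat \<Rightarrow> nat \<Rightarrow> nat \<Rightarrow> nat \<Rightarrow> tensor \<Rightarrow> tensor" where
  "pos_root_vector n d i j =
     (if j - i > 1
      then e_op n d i \<otimes>\<^bsub>schur_algebra n d\<^esub> pos_root_vector n d (i + 1) j
           \<ominus>\<^bsub>schur_algebra n d\<^esub> pos_root_vector n d (i + 1) j \<otimes>\<^bsub>schur_algebra n d\<^esub> e_op n d i
      else e_op n d i)"
  by auto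
termination by (relation "measure (\<lambda>(n, d, i, j). j - i)") auto

function neg_root_vector :: "nat \<Rightarrow> nat \<Rightarrow> nat \<Rightarrow> nat \<Rightarrow> tensor \<Rightarrow> tensor" where
  "neg_root_vector n d i j =
     (if j - i > 1
      then neg_root_vector n d (i + 1) j \<otimes>\<^bsub>schur_algebra n d\<^esub> f_op n d i
           \<ominus>\<^bsub>schur_algebra n d\<^esub> f_op n d i \<otimes>\<^bsub>schur_algebra n d\<^esub> neg_root_vector n d (i + 1) j
      else f_op n d i)"
  by auto
termination by (relation "measure (\<lambda>(n, d, i, j). j - i)") auto

declare pos_root_vector.simps [simp del] neg_root_vector.simps [simp del]

definition root_vector :: "nat \<Rightarrow> nat \<Rightarrow> nat \<times> nat \<Rightarrow> tensor \<Rightarrow> tensor" where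
  "root_vector n d = (\<lambda>(i, j). if i < j then pos_root_vector n d i j else neg_root_vector n d j i)"

definition divided_power :: "nat \<Rightarrow> nat \<Rightarrow> (tensor \<Rightarrow> tensor) \<Rightarrow> nat \<Rightarrow> tensor \<Rightarrow> tensor" where
  "divided_power n d x m =
     (1 / fact m) \<odot>\<^bsub>schur_algebra n d\<^esub> (x [^]\<^bsub>schur_algebra n d\<^esub> m)"

definition schur_prod :: "nat \<Rightarrow> nat \<Rightarrow> (tensor \<Rightarrow> tensor) list \<Rightarrow> tensor \<Rightarrow> tensor" where
  "schur_prod n d xs = foldr (\<lambda>x y. x \<otimes>\<^bsub>schur_algebra n d\<^esub> y) xs \<one>\<^bsub>schur_algebra n d\<^esub>"

definition H_binom :: "nat \<Rightarrow> nat \<Rightarrow> nat \<Rightarrow> nat \<Rightarrow> tensor \<Rightarrow> tensor" where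
  "H_binom n d i m = (1 / fact m) \<odot>\<^bsub>schur_algebra n d\<^esub>
     schur_prod n d (map (\<lambda>k. H_op n d i \<ominus>\<^bsub>schur_algebra n d\<^esub>
       (of_nat k \<odot>\<^bsub>schur_algebra n d\<^esub> \<one>\<^bsub>schur_algebra n d\<^esub>)) [0..<m])"

text \<open>The content depends on the formal product and not only on its value, so formal products are
  lists of the following factors.\<close>

datatype factor = Div_Pow "nat \<times> nat" nat | H_Binom nat nat

fun factor_val :: "nat \<Rightarrow> nat \<Rightarrow> factor \<Rightarrow> tensor \<Rightarrow> tensor" where
  "factor_val n d (Div_Pow \<alpha> m) = divided_power n d (root_vector n d \<alpha>) m"
| "factor_val n d (H_Binom i m) = H_binom n d i m"

definition val :: "nat \<Rightarrow> nat \<Rightarrow> factor list \<Rightarrow> tensor \<Rightarrow> tensor" where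
  "val n d xs = schur_prod n d (map (factor_val n d) xs)"

text \<open>The content \<open>\<chi>\<close> is \<open>content max\<close>; the variant \<open>content min\<close>, which counts \<open>x\<^sub>\<alpha>\<^sup>(\<^sup>m\<^sup>)\<close> with
  \<open>m \<epsilon>\<^bsub>min i j\<^esub>\<close> for \<open>\<alpha> = \<epsilon>\<^sub>i - \<epsilon>\<^sub>j\<close>, is needed for \<open>Y\<^sub>-\<close> (see below).\<close>

fun factor_content :: "(nat \<Rightarrow> nat \<Rightarrow> nat) \<Rightarrow> factor \<Rightarrow> nat \<Rightarrow> nat" where
  "factor_content ix (Div_Pow (i, j) m) = (\<lambda>k. if k = ix i j then m else 0)"
| "factor_content ix (H_Binom i m) = (\<lambda>k. 0)"

definition content :: "(nat \<Rightarrow> nat \<Rightarrow> nat) \<Rightarrow> factor list \<Rightarrow> nat \<Rightarrow> nat" where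
  "content ix xs = (\<lambda>k. \<Sum>x\<leftarrow>xs. factor_content ix x k)"

section \<open>The sets \<open>Y\<^sub>+\<close> and \<open>Y\<^sub>-\<close>\<close>

definition weights :: "nat \<Rightarrow> nat \<Rightarrow> (nat \<Rightarrow> nat) set" where
  "weights n d = {\<mu> \<in> {1..n} \<rightarrow>\<^sub>E UNIV. (\<Sum>i=1..n. \<mu> i) = d}"

definition root_exponents :: "nat \<Rightarrow> (nat \<times> nat \<Rightarrow> nat) set" where
  "root_exponents n = pos_roots n \<rightarrow>\<^sub>E UNIV"

text \<open>An order on the positive roots is given by a list enumerating them.\<close>

definition root_order :: "nat \<Rightarrow> (nat \<times> nat) list \<Rightarrow> bool" where
  "root_order n rs \<longleftrightarrow> distinct rs \<and> set rs = pos_roots n"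

definition e_word :: "(nat \<times> nat) list \<Rightarrow> (nat \<times> nat \<Rightarrow> nat) \<Rightarrow> factor list" where
  "e_word rs A = map (\<lambda>(i, j). Div_Pow (i, j) (A (i, j))) rs"

definition f_word :: "(nat \<times> nat) list \<Rightarrow> (nat \<times> nat \<Rightarrow> nat) \<Rightarrow> factor list" where
  "f_word rs C = map (\<lambda>(i, j). Div_Pow (j, i) (C (i, j))) rs"

definition idem_word :: "nat \<Rightarrow> (nat \<Rightarrow> nat) \<Rightarrow> factor list" where
  "idem_word n \<mu> = map (\<lambda>i. H_Binom i (\<mu> i)) [1..<n + 1]"

definition Y_plus_part ::
    "nat \<Rightarrow> nat \<Rightarrow> (nat \<times> nat) list \<Rightarrow> (nat \<times> nat) list \<Rightarrow> (nat \<Rightarrow> nat) \<Rightarrow> (tensor \<Rightarrow> tensor) set" where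
  "Y_plus_part n d rs ss \<mu> =
     {val n d (e_word rs A @ idem_word n \<mu> @ f_word ss C) | A C.
        A \<in> root_exponents n \<and> C \<in> root_exponents n \<and>
        (\<forall>k\<in>{1..n}. content max (e_word rs A @ f_word ss C) k \<le> \<mu> k)}"

text \<open>The content used for \<open>Y\<^sub>-\<close> is a parameter. With \<open>ix = max\<close>, the same content as for \<open>Y\<^sub>+\<close>, the set
  contains \<open>0\<close> and is not a basis already for \<open>n = 2\<close> and \<open>d = 1\<close>; see \<open>Y_minus_max_not_basis\<close>. The
  correct condition is the one with \<open>ix = min\<close>: the permutation \<open>i \<mapsto> n + 1 - i\<close> of the standard basis of
  \<open>V\<close> interchanges the \<open>e\<close>'s with the \<open>f\<close>'s and \<open>max\<close> with \<open>min\<close>, and thus, up to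
  reindexing, \<open>Y\<^sub>+\<close> with \<open>Y\<^sub>-\<close>.\<close>

definition Y_minus_part ::
    "(nat \<Rightarrow> nat \<Rightarrow> nat) \<Rightarrow> nat \<Rightarrow> nat \<Rightarrow> (nat \<times> nat) list \<Rightarrow> (nat \<times> nat) list \<Rightarrow> (nat \<Rightarrow> nat) \<Rightarrow>
     (tensor \<Rightarrow> tensor) set" where
  "Y_minus_part ix n d rs ss \<mu> =
     {val n d (f_word ss A @ idem_word n \<mu> @ e_word rs C) | A C.
        A \<in> root_exponents n \<and> C \<in> root_exponents n \<and>
        (\<forall>k\<in>{1..n}. content ix (f_word ss A @ e_word rs C) k \<le> \<mu> k)}"

definition Z_basis :: "('a, 'b) ring_scheme \<Rightarrow> 'a set \<Rightarrow> 'a set \<Rightarrow> bool" where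
  "Z_basis R B M \<longleftrightarrow> B \<subseteq> M \<and>
     (\<forall>F (c :: 'a \<Rightarrow> int). finite F \<and> F \<subseteq> B \<and> (\<Oplus>\<^bsub>R\<^esub>b\<in>F. [c b] \<cdot>\<^bsub>R\<^esub> b) = \<zero>\<^bsub>R\<^esub> \<longrightarrow> (\<forall>b\<in>F. c b = 0)) \<and>
     (\<forall>x\<in>M. \<exists>F (c :: 'a \<Rightarrow> int). finite F \<and> F \<subseteq> B \<and> x = (\<Oplus>\<^bsub>R\<^esub>b\<in>F. [c b] \<cdot>\<^bsub>R\<^esub> b))"

lemma Z_basis_zero_notin:
  assumes "ring R" and "Z_basis R B M"
  shows "\<zero>\<^bsub>R\<^esub> \<notin> B"
proof
  interpret ring R by fact
  assume "\<zero>\<^bsub>R\<^esub> \<in> B"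
  moreover have "(\<Oplus>\<^bsub>R\<^esub>b\<in>{\<zero>\<^bsub>R\<^esub>}. [(1 :: int)] \<cdot>\<^bsub>R\<^esub> b) = \<zero>\<^bsub>R\<^esub>"
    by (simp add: finsum_insert add_pow_int_ge)
  ultimately have "(1 :: int) = 0"
    using assms(2) unfolding Z_basis_def
    by (elim conjE allE[of _ "{\<zero>\<^bsub>R\<^esub>}"] allE[of _ "\<lambda>_. 1 :: int"]) simp
  then show False by simp
qed

lemma Y_minus_max_not_basis:
  "root_order 2 [(1, 2)]"
  "\<not> Z_basis (schur_algebra 2 1) (\<Union>\<mu>\<in>weights 2 1. Y_minus_part max 2 1 [(1, 2)] [(1, 2)] \<mu>) M"
proof (unfold One_nat_def)
  let ?S = "schur_algebra 2 (Suc 0)"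
  interpret S: ring ?S by (rule ring_schur_algebra)
  show "root_order 2 [(Suc 0, 2)]"
    by (auto simp: root_order_def pos_roots_def)
  define \<mu> where "\<mu> = (\<lambda>i\<in>{Suc 0..2::nat}. if i = 2 then 1 else 0 :: nat)"
  define A where "A = (\<lambda>r\<in>pos_roots 2. 1 :: nat)"
  define C where "C = (\<lambda>r\<in>pos_roots 2. 0 :: nat)"
  have r: "(Suc 0, 2) \<in> pos_roots 2" by (auto simp: pos_roots_def)
  have U: "[Suc 0..<Suc 2] = [Suc 0, 2]" "[Suc 0..<3] = [Suc 0, 2]"
    by (simp_all add: upt_rec)
  have I: "{Suc 0..2::nat} = {Suc 0, 2}" by auto
  have \<mu>: "\<mu> \<in> weights 2 (Suc 0)" "\<mu> (Suc 0) = 0" "\<mu> 2 = 1"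
    by (auto simp: weights_def \<mu>_def I)
  let ?T = "tensors UNIV 2 (Suc 0)"
  have T: "gl_action 2 (Suc 0) X t \<in> ?T" for X t by (simp add: tensors_def gl_action_def)
  have m1: "f \<otimes>\<^bsub>?S\<^esub> g = compose ?T f g" for f g by (simp add: schur_algebra_def)
  have s1: "1 \<odot>\<^bsub>?S\<^esub> f = f" if "f \<in> carrier ?S" for f
    using that by (auto simp: schur_algebra_def tensor_endos_def PiE_def intro!: extensionalityI[of _ ?T])
  have s0: "0 \<odot>\<^bsub>?S\<^esub> f = \<zero>\<^bsub>?S\<^esub>" for f
    by (simp add: schur_algebra_def)
  have cl: "f_op 2 (Suc 0) i \<in> carrier ?S" "e_op 2 (Suc 0) i \<in> carrier ?S" "H_op 2 (Suc 0) i \<in> carrier ?S" for i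
    by (simp_all only: f_op_def e_op_def H_op_def gl_op_closed)
  have fac: "divided_power 2 (Suc 0) (root_vector 2 (Suc 0) (2, Suc 0)) (Suc 0) = f_op 2 (Suc 0) (Suc 0)"
    "divided_power 2 (Suc 0) (root_vector 2 (Suc 0) (Suc 0, 2)) 0 = \<one>\<^bsub>?S\<^esub>"
    "H_binom 2 (Suc 0) (Suc 0) 0 = \<one>\<^bsub>?S\<^esub>" "H_binom 2 (Suc 0) 2 (Suc 0) = H_op 2 (Suc 0) 2"
    using cl by (simp_all add: divided_power_def root_vector_def pos_root_vector.simps
        neg_root_vector.simps H_binom_def schur_prod_def s1 s0 S.minus_eq)
  have fH: "f_op 2 (Suc 0) (Suc 0) \<otimes>\<^bsub>?S\<^esub> H_op 2 (Suc 0) 2 = \<zero>\<^bsub>?S\<^esub>"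
  proof -
    have "gl_action 2 (Suc 0) (matrix_unit 2 (Suc 0)) (gl_action 2 (Suc 0) (matrix_unit 2 2) t) = (\<lambda>w. 0)" for t
      by (auto simp: gl_action_def fun_eq_iff matrix_unit_def I nth_list_update words_def)
    then show ?thesis
      unfolding m1 using T
      by (auto simp: schur_algebra_def compose_def f_op_def H_op_def gl_op_def numeral_2_eq_2
          intro!: restrict_ext)
  qed
  have "val 2 (Suc 0) (f_word [(Suc 0, 2)] A @ idem_word 2 \<mu> @ e_word [(Suc 0, 2)] C) =
      f_op 2 (Suc 0) (Suc 0) \<otimes>\<^bsub>?S\<^esub> H_op 2 (Suc 0) 2"
    using cl fac r \<mu> U by (simp add: val_def schur_prod_def f_word_def e_word_def idem_word_def A_def C_def)
  moreover have "\<forall>k\<in>{Suc 0..2}. content max (f_word [(Suc 0, 2)] A @ e_word [(Suc 0, 2)] C) k \<le> \<mu> k"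
    using r \<mu> by (auto simp: content_def f_word_def e_word_def A_def C_def I)
  moreover have "A \<in> root_exponents 2" "C \<in> root_exponents 2"
    by (auto simp: root_exponents_def A_def C_def)
  ultimately have "\<zero>\<^bsub>?S\<^esub> \<in> Y_minus_part max 2 (Suc 0) [(Suc 0, 2)] [(Suc 0, 2)] \<mu>"
    unfolding Y_minus_part_def fH[symmetric] One_nat_def mem_Collect_eq
    by (intro exI[of _ A] exI[of _ C]) metis
  then have "\<zero>\<^bsub>?S\<^esub> \<in> (\<Union>\<mu>\<in>weights 2 (Suc 0). Y_minus_part max 2 (Suc 0) [(Suc 0, 2)] [(Suc 0, 2)] \<mu>)"
    using \<mu> by blast
  then show "\<not> Z_basis ?S (\<Union>\<mu>\<in>weights 2 (Suc 0). Y_minus_part max 2 (Suc 0) [(Suc 0, 2)] [(Suc 0, 2)] \<mu>) M"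
    using Z_basis_zero_notin[OF S.ring_axioms] by blast
qed

end

theory Submission
  imports Defs "HOL-Computational_Algebra.Formal_Power_Series"
begin

text \<open>In the basis of words, an endomorphism is a matrix that is constant on the orbits of the place
  permutations on pairs of words, and it is integral iff its entries are. The divided power
  \<open>x\<^sup>(\<^sup>m\<^sup>)\<close> for the root \<open>\<epsilon>\<^sub>i - \<epsilon>\<^sub>j\<close> is the 0-1 matrix of the pairs \<open>(u, w)\<close> where \<open>w\<close> arises from \<open>u\<close>
  by changing exactly \<open>m\<close> letters \<open>i\<close> to \<open>j\<close>. Hence an entry of \<open>e\<^sub>A 1\<^sub>\<lambda> f\<^sub>C\<close> counts paths of words through a
  word of weight \<open>\<lambda>\<close>. On a path between words that differ in the maximal number \<open>|A| + |C|\<close> of places, no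
  place is changed twice, so such a path is unique, and in each place the word in the middle has
  the larger (for \<open>Y\<^sub>-\<close> the smaller) of the two letters. So the content condition makes these elements
  correspond to the orbits, and the transition matrix to the orbit sums is unitriangular with respect to the
  number of places in which two words differ.

  For the generation, the commutation formulas yield successively the divided powers of all root vectors, the
  binomials in \<open>H\<^sub>i - H\<^sub>i\<^sub>+\<^sub>1\<close>, and, as integral combinations of the latter, the idempotents \<open>1\<^sub>\<lambda>\<close>.\<close>

section \<open>Matrix entries\<close>

text \<open>The content condition makes the exponents into coordinates. The pairs of letters with
  middle letter k are the moved pairs counted by \<chi> and the single diagonal pair (k, k). If the
  middle word has weight \<lambda>, the multiplicity of (k, k) is therefore \<lambda>_k - \<chi>_k;
  this is a natural number exactly under the content condition, and a multiset of pairs is recovered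
  from \<lambda> and its moved pairs. So diagonal pairs need no exponents of their own.

  The generators only see the differences H_i - H_{i+1}, never a single H_i. The weight is still
  determined because the multiplicities of all letters add up to d. In each commutation formula one
  summand is the wanted element itself, with coefficient 1, and the others contain elements of the
  same kind with smaller exponent; so no induction produces denominators.

  The generated ring lies in the integral form because its generators have entries 0 and 1. It is
  everything because each basis element is a product of generated factors.\<close>

lemma finite_words: "finite (words n d)"
  by (rule finite_subset[OF _ finite_lists_length_eq[of "{1..n}" d]]) (auto simp: words_def)

definition unit_tensor :: "nat list \<Rightarrow> tensor" where
  "unit_tensor w = (\<lambda>v. if v = w then 1 else 0)"

lemma unit_tensor_tensors:
  "w \<in> words n d \<Longrightarrow> 0 \<in> R \<Longrightarrow> 1 \<in> R \<Longrightarrow> unit_tensor w \<in> tensors R n d"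
  by (auto simp: unit_tensor_def tensors_def)

text \<open>The row is u and the column is w: the coefficient of the basis tensor u in the image of
  the basis tensor w. With this convention a product of operators is read as a path from u to w,
  from its leftmost factor to its rightmost.\<close>

definition entry :: "(tensor \<Rightarrow> tensor) \<Rightarrow> nat list \<Rightarrow> nat list \<Rightarrow> rat" where
  "entry f u w = f (unit_tensor w) u"

lemma schur_carrier: "carrier (schur_algebra n d) = tensor_endos UNIV n d"
  by (simp add: schur_algebra_def)

lemma endo_closed:
  "f \<in> carrier (schur_algebra n d) \<Longrightarrow> t \<in> tensors UNIV n d \<Longrightarrow> f t \<in> tensors UNIV n d"
  by (auto simp: schur_carrier tensor_endos_def)

lemma endo_scale:
  "f \<in> carrier (schur_algebra n d) \<Longrightarrow> t \<in> tensors UNIV n d \<Longrightarrow>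
    f (\<lambda>w. q * t w) = (\<lambda>w. q * f t w)"
  by (simp add: schur_carrier tensor_endos_def)

lemma endo_add:
  "f \<in> carrier (schur_algebra n d) \<Longrightarrow> s \<in> tensors UNIV n d \<Longrightarrow> t \<in> tensors UNIV n d \<Longrightarrow>
    f (\<lambda>w. s w + t w) = (\<lambda>w. f s w + f t w)"
  by (simp add: schur_carrier tensor_endos_def)

lemma tensors_lincomb:
  assumes "finite A" "\<And>a. a \<in> A \<Longrightarrow> g a \<in> tensors UNIV n d"
  shows "(\<lambda>v. \<Sum>a\<in>A. c a * g a v) \<in> tensors UNIV n d"
  using assms by (auto simp: tensors_def intro!: sum.neutral)

lemma endo_lincomb:
  assumes f: "f \<in> carrier (schur_algebra n d)" and "finite A"
    and "\<And>a. a \<in> A \<Longrightarrow> g a \<in> tensors UNIV n d"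
  shows "f (\<lambda>v. \<Sum>a\<in>A. c a * g a v) = (\<lambda>v. \<Sum>a\<in>A. c a * f (g a) v)"
  using assms(2,3)
proof (induction A)
  case empty
  have "(\<lambda>v. 0) \<in> tensors UNIV n d" by (simp add: tensors_def)
  then have "f (\<lambda>w. 0 * (0::rat)) = (\<lambda>w. 0 * f (\<lambda>v. 0) w)"
    using endo_scale[OF f, of "\<lambda>v. 0" 0] by simp
  then show ?case by simp
next
  case (insert a A)
  have 1: "(\<lambda>v. \<Sum>a\<in>A. c a * g a v) \<in> tensors UNIV n d"
    using insert by (intro tensors_lincomb) auto
  have 2: "(\<lambda>v. c a * g a v) \<in> tensors UNIV n d" and 3: "g a \<in> tensors UNIV n d"
    using insert.prems[of a] by (auto simp: tensors_def)
  have "f (\<lambda>v. c a * g a v + (\<Sum>a\<in>A. c a * g a v)) =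
      (\<lambda>v. f (\<lambda>v. c a * g a v) v + f (\<lambda>v. \<Sum>a\<in>A. c a * g a v) v)"
    using endo_add[OF f 2 1] .
  moreover have "f (\<lambda>v. c a * g a v) = (\<lambda>v. c a * f (g a) v)"
    using endo_scale[OF f 3] .
  ultimately show ?case using insert by simp
qed

lemma tensor_expansion:
  assumes "t \<in> tensors UNIV n d"
  shows "t = (\<lambda>v. \<Sum>w\<in>words n d. t w * unit_tensor w v)"
proof
  fix v
  have "(\<Sum>w\<in>words n d. t w * unit_tensor w v) = (\<Sum>w\<in>words n d. if w = v then t v else 0)"
    by (intro sum.cong) (auto simp: unit_tensor_def)
  then show "t v = (\<Sum>w\<in>words n d. t w * unit_tensor w v)"
    using assms by (auto simp: finite_words tensors_def)
qed

lemma endo_expansion: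
  assumes "f \<in> carrier (schur_algebra n d)" "t \<in> tensors UNIV n d"
  shows "f t u = (\<Sum>w\<in>words n d. entry f u w * t w)"
proof -
  have "f t = f (\<lambda>v. \<Sum>w\<in>words n d. t w * unit_tensor w v)"
    using tensor_expansion[OF assms(2)] by simp
  also have "\<dots> = (\<lambda>v. \<Sum>w\<in>words n d. t w * f (unit_tensor w) v)"
    by (rule endo_lincomb[OF assms(1) finite_words]) (simp add: unit_tensor_tensors)
  finally show ?thesis by (simp add: entry_def mult.commute)
qed

text \<open>Identities in the Schur algebra are checked on entries: outside the tensor space both
  maps are extensional, and outside the words both images vanish.\<close>

lemma schur_eqI:
  assumes f: "f \<in> carrier (schur_algebra n d)" and g: "g \<in> carrier (schur_algebra n d)"
    and "\<And>u w. u \<in> words n d \<Longrightarrow> w \<in> words n d \<Longrightarrow> entry f u w = entry g u w"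
  shows "f = g"
proof (rule extensionalityI[of _ "tensors UNIV n d"])
  fix t assume t: "t \<in> tensors UNIV n d"
  show "f t = g t"
  proof
    fix u show "f t u = g t u"
    proof (cases "u \<in> words n d")
      case True
      then show ?thesis using assms t by (simp add: endo_expansion)
    next
      case False
      then show ?thesis using endo_closed[OF f t] endo_closed[OF g t] by (simp add: tensors_def)
    qed
  qed
qed (use f g in \<open>auto simp: schur_carrier tensor_endos_def PiE_def\<close>)

lemma entry_mult:
  assumes "f \<in> carrier (schur_algebra n d)" "g \<in> carrier (schur_algebra n d)" "w \<in> words n d"
  shows "entry (f \<otimes>\<^bsub>schur_algebra n d\<^esub> g) u w = (\<Sum>v\<in>words n d. entry f u v * entry g v w)"
proof -
  have "entry (f \<otimes>\<^bsub>schur_algebra n d\<^esub> g) u w = f (g (unit_tensor w)) u"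
    using assms by (simp add: entry_def schur_algebra_def compose_def unit_tensor_tensors)
  then show ?thesis
    using assms endo_expansion[OF assms(1) endo_closed[OF assms(2) unit_tensor_tensors[OF assms(3)]]]
    by (simp add: entry_def)
qed

lemma entry_one: "w \<in> words n d \<Longrightarrow> entry \<one>\<^bsub>schur_algebra n d\<^esub> u w = of_bool (u = w)"
  by (simp add: entry_def schur_algebra_def unit_tensor_tensors) (simp add: unit_tensor_def)

lemma entry_zero: "w \<in> words n d \<Longrightarrow> entry \<zero>\<^bsub>schur_algebra n d\<^esub> u w = 0"
  by (simp add: entry_def schur_algebra_def unit_tensor_tensors)

lemma entry_add:
  "w \<in> words n d \<Longrightarrow> entry (f \<oplus>\<^bsub>schur_algebra n d\<^esub> g) u w = entry f u w + entry g u w"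
  by (simp add: entry_def schur_algebra_def unit_tensor_tensors)

lemma entry_smult:
  "w \<in> words n d \<Longrightarrow> entry (q \<odot>\<^bsub>schur_algebra n d\<^esub> f) u w = q * entry f u w"
  by (simp add: entry_def schur_algebra_def unit_tensor_tensors)

lemma smult_closed:
  assumes "f \<in> carrier (schur_algebra n d)"
  shows "q \<odot>\<^bsub>schur_algebra n d\<^esub> f \<in> carrier (schur_algebra n d)"
proof -
  have cl: "(\<lambda>w. s w + t w) \<in> tensors UNIV n d" "(\<lambda>w. q * t w) \<in> tensors UNIV n d"
    if "s \<in> tensors UNIV n d" "t \<in> tensors UNIV n d" for s t q
    using that by (simp_all add: tensors_def)
  show ?thesis
    using assms endo_closed[OF assms] unfolding schur_carrier
    by (auto simp: schur_algebra_def tensor_endos_def cl place_perm_tensors algebra_simps)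
       (auto simp: place_perm_def cl)
qed

lemma entry_uminus:
  assumes "f \<in> carrier (schur_algebra n d)" "w \<in> words n d"
  shows "entry (\<ominus>\<^bsub>schur_algebra n d\<^esub> f) u w = - entry f u w"
proof -
  interpret ring "schur_algebra n d" by (rule ring_schur_algebra)
  have "entry (f \<oplus>\<^bsub>schur_algebra n d\<^esub> \<ominus>\<^bsub>schur_algebra n d\<^esub> f) u w = 0"
    using assms entry_zero[of w n d u] by (simp add: r_neg)
  then show ?thesis using assms by (simp add: entry_add)
qed

lemma entry_minus:
  assumes "f \<in> carrier (schur_algebra n d)" "g \<in> carrier (schur_algebra n d)" "w \<in> words n d"
  shows "entry (f \<ominus>\<^bsub>schur_algebra n d\<^esub> g) u w = entry f u w - entry g u w"
  using assms by (simp add: a_minus_def entry_add entry_uminus)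

lemma entry_add_pow:
  fixes c :: int
  assumes "f \<in> carrier (schur_algebra n d)" "w \<in> words n d"
  shows "entry ([c] \<cdot>\<^bsub>schur_algebra n d\<^esub> f) u w = of_int c * entry f u w"
proof -
  interpret ring "schur_algebra n d" by (rule ring_schur_algebra)
  have nat: "entry ([k] \<cdot>\<^bsub>schur_algebra n d\<^esub> f) u w = of_nat k * entry f u w" for k :: nat
    using assms by (induction k) (auto simp: entry_zero entry_add algebra_simps add_pow_def)
  show ?thesis
  proof (cases "c < 0")
    case True
    then show ?thesis using assms nat[of "nat (- c)"]
      by (simp add: add_pow_int_lt entry_uminus)
  next
    case False
    then show ?thesis using nat[of "nat c"] by (simp add: add_pow_int_ge)
  qed
qed

lemma entry_finsum:
  assumes "finite F" "g \<in> F \<rightarrow> carrier (schur_algebra n d)" "w \<in> words n d"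
  shows "entry (\<Oplus>\<^bsub>schur_algebra n d\<^esub>b\<in>F. g b) u w = (\<Sum>b\<in>F. entry (g b) u w)"
proof -
  interpret ring "schur_algebra n d" by (rule ring_schur_algebra)
  show ?thesis
    using assms by (induction F) (auto simp: entry_zero entry_add finsum_insert Pi_iff)
qed

text \<open>\<open>place_perm\<close> precomposes with \<open>permute_list \<sigma>\<close>, so it
  carries the basis tensor of \<open>permute_list \<sigma> w\<close> to that of w; commuting with it
  makes the matrix constant on orbits.\<close>

lemma entry_permute:
  assumes f: "f \<in> carrier (schur_algebra n d)" and s: "\<sigma> permutes {..<d}" and w: "w \<in> words n d"
    and u: "length u = d"
  shows "entry f (permute_list \<sigma> u) (permute_list \<sigma> w) = entry f u w"
proof -
  have l: "length w = d" using w by (simp add: words_def)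
  have pw: "permute_list \<sigma> w \<in> words n d" using w words_permute_list[OF s l] by simp
  have "place_perm \<sigma> (unit_tensor (permute_list \<sigma> w)) = unit_tensor w"
  proof
    fix v
    have "permute_list \<sigma> v = permute_list \<sigma> w \<longleftrightarrow> v = w"
    proof
      assume eq: "permute_list \<sigma> v = permute_list \<sigma> w"
      then have lv: "length v = d" using l by (metis length_permute_list)
      show "v = w"
      proof (rule nth_equalityI)
        fix i assume i: "i < length v"
        then obtain k where k: "k < d" "\<sigma> k = i"
          using s lv by (metis lessThan_iff permutes_def permutes_not_in)
        have "permute_list \<sigma> v ! k = permute_list \<sigma> w ! k" using eq by simp
        then show "v ! i = w ! i" using k lv l s by (simp add: permute_list_nth)
      qed (simp add: lv l)
    qed simp
    then show "place_perm \<sigma> (unit_tensor (permute_list \<sigma> w)) v = unit_tensor w v"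
      by (simp add: place_perm_def unit_tensor_def)
  qed
  moreover have "f (place_perm \<sigma> (unit_tensor (permute_list \<sigma> w))) =
      place_perm \<sigma> (f (unit_tensor (permute_list \<sigma> w)))"
    using f s unit_tensor_tensors[OF pw, of UNIV] unfolding schur_carrier tensor_endos_def by simp
  ultimately show ?thesis by (simp add: entry_def place_perm_def)
qed

text \<open>The lattice is spanned by the basis tensors over the integers, so integral columns
  already give stability of the whole lattice.\<close>

lemma integral_schur_algebra_iff:
  "f \<in> integral_schur_algebra n d \<longleftrightarrow>
     f \<in> carrier (schur_algebra n d) \<and> (\<forall>u\<in>words n d. \<forall>w\<in>words n d. entry f u w \<in> \<int>)"
proof (intro iffI conjI ballI)
  assume f: "f \<in> integral_schur_algebra n d"
  then show "f \<in> carrier (schur_algebra n d)" by (simp add: integral_schur_algebra_def)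
  fix u w assume "u \<in> words n d" "w \<in> words n d"
  then have t: "unit_tensor w \<in> tensors \<int> n d" by (simp add: unit_tensor_tensors)
  then have "f (unit_tensor w) \<in> tensors \<int> n d"
    using f by (auto simp: integral_schur_algebra_def tensor_endos_def PiE_def restrict_def Pi_iff)
  then show "entry f u w \<in> \<int>" by (simp add: entry_def tensors_def)
next
  assume a: "f \<in> carrier (schur_algebra n d) \<and> (\<forall>u\<in>words n d. \<forall>w\<in>words n d. entry f u w \<in> \<int>)"
  then have f: "f \<in> carrier (schur_algebra n d)" by simp
  have sub: "t \<in> tensors UNIV n d" if "t \<in> tensors \<int> n d" for t
    using that by (simp add: tensors_def)
  have cl: "f t \<in> tensors \<int> n d" if t: "t \<in> tensors \<int> n d" for t
  proof -
    have "f t u \<in> \<int>" for u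
    proof (cases "u \<in> words n d")
      case True
      then show ?thesis using a t
        by (auto simp: endo_expansion[OF f sub[OF t]] tensors_def intro!: Ints_sum Ints_mult)
    next
      case False
      then show ?thesis using endo_closed[OF f sub[OF t]] by (simp add: tensors_def)
    qed
    then show ?thesis using endo_closed[OF f sub[OF t]] by (simp add: tensors_def)
  qed
  have cl2: "(\<lambda>w. s w + t w) \<in> tensors \<int> n d" "q \<in> \<int> \<Longrightarrow> (\<lambda>w. q * t w) \<in> tensors \<int> n d"
    if "s \<in> tensors \<int> n d" "t \<in> tensors \<int> n d" for s t q
    using that by (simp_all add: tensors_def)
  show "f \<in> integral_schur_algebra n d"
    using f unfolding integral_schur_algebra_def mem_Collect_eq
    by (auto simp: schur_carrier tensor_endos_def cl cl2 place_perm_tensors sub)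
qed

section \<open>Places where two words differ\<close>

definition diff_places :: "nat list \<Rightarrow> nat list \<Rightarrow> nat set" where
  "diff_places u w = {p. p < length u \<and> u ! p \<noteq> w ! p}"

text \<open>The orbit of a pair of words is the multiset of all its pairs of letters. This is the
  off-diagonal part, whose size is the degree in all triangularity arguments.\<close>

definition moves :: "nat list \<Rightarrow> nat list \<Rightarrow> (nat \<times> nat) multiset" where
  "moves u w = image_mset (\<lambda>p. (u ! p, w ! p)) (mset_set (diff_places u w))"

lemma finite_diff_places [simp]: "finite (diff_places u w)"
  by (simp add: diff_places_def)

lemma size_moves: "size (moves u w) = card (diff_places u w)"
  by (simp add: moves_def)

lemma set_moves: "set_mset (moves u w) = (\<lambda>p. (u ! p, w ! p)) ` diff_places u w"
  by (simp add: moves_def)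

lemma moves_replicate_iff:
  "moves u w = replicate_mset m \<alpha> \<longleftrightarrow>
     card (diff_places u w) = m \<and> (\<forall>p\<in>diff_places u w. (u ! p, w ! p) = \<alpha>)"
proof
  assume a: "moves u w = replicate_mset m \<alpha>"
  have "(u ! p, w ! p) \<in># replicate_mset m \<alpha>" if "p \<in> diff_places u w" for p
    using that set_moves[of u w] unfolding a by blast
  then have "(u ! p, w ! p) = \<alpha>" if "p \<in> diff_places u w" for p
    using that by (metis in_replicate_mset)
  then show "card (diff_places u w) = m \<and> (\<forall>p\<in>diff_places u w. (u ! p, w ! p) = \<alpha>)"
    using arg_cong[OF a, of size] by (simp add: size_moves)
next
  assume a: "card (diff_places u w) = m \<and> (\<forall>p\<in>diff_places u w. (u ! p, w ! p) = \<alpha>)"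
  then have "moves u w = image_mset (\<lambda>p. \<alpha>) (mset_set (diff_places u w))"
    unfolding moves_def by (intro image_mset_cong) simp
  then show "moves u w = replicate_mset m \<alpha>" using a by (simp add: image_mset_const_eq)
qed

lemma moves_eq_empty_iff:
  assumes "u \<in> words n d" "w \<in> words n d"
  shows "moves u w = {#} \<longleftrightarrow> u = w"
  using assms by (auto simp: moves_def mset_set_empty_iff diff_places_def words_def intro: nth_equalityI)

lemma diff_places_triangle:
  assumes "length u = length v"
  shows "diff_places u w \<subseteq> diff_places u v \<union> diff_places v w"
  using assms by (auto simp: diff_places_def)

text \<open>In a place changed by only one of the two steps, the other step is trivial, so the pair
  of letters of the changing step is already the pair of u and w.\<close>

lemma moves_add:
  assumes "length u = length v" "diff_places u v \<inter> diff_places v w = {}"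
  shows "diff_places u w = diff_places u v \<union> diff_places v w"
    and "moves u w = moves u v + moves v w"
proof -
  have 1: "u ! p = v ! p" if "p \<in> diff_places v w" for p
    using assms that by (auto simp: diff_places_def)
  have 2: "v ! p = w ! p" if "p \<in> diff_places u v" for p
    using assms that by (auto simp: diff_places_def)
  show D: "diff_places u w = diff_places u v \<union> diff_places v w"
  proof
    show "diff_places u w \<subseteq> diff_places u v \<union> diff_places v w"
      using diff_places_triangle[OF assms(1)] .
    show "diff_places u v \<union> diff_places v w \<subseteq> diff_places u w"
    proof
      fix p assume "p \<in> diff_places u v \<union> diff_places v w"
      show "p \<in> diff_places u w"
      proof (cases "p \<in> diff_places u v")
        case True
        then show ?thesis using 2[OF True] by (simp add: diff_places_def)
      next
        case False
        then have p: "p \<in> diff_places v w" using \<open>p \<in> diff_places u v \<union> diff_places v w\<close> by blast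
        then show ?thesis using 1[OF p] assms(1) by (simp add: diff_places_def)
      qed
    qed
  qed
  have "moves u w = image_mset (\<lambda>p. (u ! p, w ! p)) (mset_set (diff_places u v)) +
      image_mset (\<lambda>p. (u ! p, w ! p)) (mset_set (diff_places v w))"
    unfolding moves_def D using assms by (simp add: mset_set_Union)
  also have "\<dots> = moves u v + moves v w"
    unfolding moves_def using 1 2 by (intro arg_cong2[of _ _ _ _ "(+)"] image_mset_cong) auto
  finally show "moves u w = moves u v + moves v w" .
qed

section \<open>Entries of root vectors and their divided powers\<close>

lemma words_update: "w \<in> words n d \<Longrightarrow> j \<in> {1..n} \<Longrightarrow> w[k := j] \<in> words n d"
  using set_update_subset_insert[of w k j] by (fastforce simp: words_def)

lemma words_nth: "w \<in> words n d \<Longrightarrow> p < d \<Longrightarrow> w ! p \<in> {1..n}"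
  unfolding words_def using nth_mem[of p w] by blast

lemma diff_places_update:
  "i < length u \<Longrightarrow> diff_places u (u[i := a]) = (if u ! i = a then {} else {i})"
  "i < length u \<Longrightarrow> diff_places (u[i := a]) u = (if u ! i = a then {} else {i})"
  by (auto simp: diff_places_def nth_list_update)

lemma entry_gl_op_matrix_unit:
  assumes "j \<in> {1..n}" "u \<in> words n d" "w \<in> words n d"
  shows "entry (gl_op n d (matrix_unit i j)) u w = of_nat (card {k. k < d \<and> u ! k = i \<and> u[k := j] = w})"
proof -
  have "entry (gl_op n d (matrix_unit i j)) u w =
      (\<Sum>k<d. \<Sum>b=1..n. matrix_unit i j (u ! k) b * unit_tensor w (u[k := b]))"
    using assms by (simp add: entry_def gl_op_def unit_tensor_tensors gl_action_def)
  also have "\<dots> = (\<Sum>k<d. \<Sum>b=1..n. if b = j then of_bool (u ! k = i \<and> u[k := j] = w) else 0)"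
    by (intro sum.cong) (auto simp: matrix_unit_def unit_tensor_def)
  also have "\<dots> = (\<Sum>k<d. of_bool (u ! k = i \<and> u[k := j] = w))"
    using assms(1) by simp
  also have "\<dots> = of_nat (card ({k. k < d \<and> u ! k = i \<and> u[k := j] = w}))"
    by (simp add: of_bool_def sum.If_cases lessThan_def Int_def)
  finally show ?thesis .
qed

text \<open>As i and j differ, a place that contributes is the only place where u and w differ, so
  the count is 0 or 1.\<close>

lemma entry_gl_op_off_diagonal:
  assumes "j \<in> {1..n}" "i \<noteq> j" "u \<in> words n d" "w \<in> words n d"
  shows "entry (gl_op n d (matrix_unit i j)) u w = of_bool (moves u w = {#(i, j)#})"
proof -
  let ?K = "{k. k < d \<and> u ! k = i \<and> u[k := j] = w}"
  have l: "length u = d" "length w = d" using assms by (auto simp: words_def)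
  have 1: "?K = {k}" if "diff_places u w = {k}" "u ! k = i" "w ! k = j" for k
  proof -
    have k: "k < d" using that l by (auto simp: diff_places_def)
    have "u ! p = w ! p" if "p < d" "p \<noteq> k" for p
      using that l \<open>diff_places u w = {k}\<close> by (auto simp: diff_places_def)
    then have "u[k := j] = w"
      using that l k by (intro nth_equalityI) (auto simp: nth_list_update)
    moreover have "l = k" if "l \<in> ?K" for l
      using that \<open>diff_places u w = {k}\<close> assms(2) l diff_places_update(1)[of l u j] by auto
    ultimately show ?thesis using k that(2) by blast
  qed
  have m: "moves u w = {#(i, j)#} \<longleftrightarrow> (\<exists>k. diff_places u w = {k} \<and> u ! k = i \<and> w ! k = j)"
    using moves_replicate_iff[of u w 1 "(i, j)"] by (auto simp: card_1_singleton_iff)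
  have 2: "moves u w = {#(i, j)#}" if "k \<in> ?K" for k
    unfolding m using that assms(2) l diff_places_update(1)[of k u j] by auto
  show ?thesis
  proof (cases "moves u w = {#(i, j)#}")
    case True
    then obtain k where "diff_places u w = {k}" "u ! k = i" "w ! k = j" using m by blast
    then show ?thesis using 1[of k] True entry_gl_op_matrix_unit[OF assms(1,3,4)] by simp
  next
    case False
    then have K: "?K = {}" using 2 by blast
    show ?thesis unfolding entry_gl_op_matrix_unit[OF assms(1,3,4)] K using False by simp
  qed
qed

lemma entry_H_op:
  assumes "i \<in> {1..n}" "u \<in> words n d" "w \<in> words n d"
  shows "entry (H_op n d i) u w = of_bool (u = w) * of_nat (count_list u i)"
proof -
  have l: "length u = d" using assms(2) by (simp add: words_def)
  have "{k. k < d \<and> u ! k = i \<and> u[k := i] = w} = (if u = w then {k. k < d \<and> u ! k = i} else {})"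
    using list_update_id by auto
  moreover have "count_list u i = card {k. k < d \<and> u ! k = i}"
    unfolding count_list_eq_length_filter length_filter_conv_card l by (simp add: eq_commute)
  ultimately show ?thesis
    unfolding H_op_def entry_gl_op_matrix_unit[OF assms] by simp
qed

text \<open>A matrix acts as the sum of its actions on single places. Actions on two different
  places commute and cancel; on one place the commutator of the matrices remains.\<close>

lemma gl_action_commutator:
  assumes w: "w \<in> words n d"
  shows "gl_action n d X (gl_action n d Y t) w - gl_action n d Y (gl_action n d X t) w =
    gl_action n d (\<lambda>a b. \<Sum>c=1..n. X a c * Y c b - Y a c * X c b) t w"
proof -
  define F where "F X Y k l = (\<Sum>a=1..n. \<Sum>b=1..n. X (w ! k) a * (Y (w[k := a] ! l) b * t (w[k := a, l := b])))"
    for X Y :: "nat \<Rightarrow> nat \<Rightarrow> rat" and k l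
  have l: "length w = d" using w by (simp add: words_def)
  have XY: "gl_action n d X (gl_action n d Y t) w = (\<Sum>k<d. \<Sum>l<d. F X Y k l)" for X Y
  proof -
    have "gl_action n d X (gl_action n d Y t) w =
      (\<Sum>k<d. \<Sum>a=1..n. \<Sum>l<d. \<Sum>b=1..n. X (w ! k) a * (Y (w[k := a] ! l) b * t (w[k := a, l := b])))"
      using w words_update[OF w]
      by (auto simp: gl_action_def[of _ _ X] gl_action_def[of _ _ Y] sum_distrib_left intro!: sum.cong)
    also have "\<dots> = (\<Sum>k<d. \<Sum>l<d. F X Y k l)"
      unfolding F_def by (intro sum.cong sum.swap refl)
    finally show ?thesis .
  qed
  have off: "F X Y k l = F Y X l k" if "k \<noteq> l" for k l
    unfolding F_def using that
    by (subst sum.swap) (simp add: mult.left_commute list_update_swap)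
  have diag: "F X Y k k - F Y X k k =
      (\<Sum>b=1..n. (\<Sum>c=1..n. X (w ! k) c * Y c b - Y (w ! k) c * X c b) * t (w[k := b]))" if "k < d" for k
  proof -
    have "F X Y k k = (\<Sum>b=1..n. (\<Sum>c=1..n. X (w ! k) c * Y c b) * t (w[k := b]))" for X Y
      unfolding F_def using that l
      by (subst sum.swap) (simp add: sum_distrib_right mult.assoc)
    then show ?thesis by (simp add: sum_subtractf left_diff_distrib)
  qed
  have "(\<Sum>k<d. \<Sum>l<d. F X Y k l) - (\<Sum>k<d. \<Sum>l<d. F Y X k l) =
      (\<Sum>k<d. \<Sum>l<d. F X Y k l - F Y X l k)"
    by (subst (2) sum.swap) (simp add: sum_subtractf)
  also have "\<dots> = (\<Sum>k<d. \<Sum>l<d. if l = k then F X Y k k - F Y X k k else 0)"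
    by (intro sum.cong refl) (use off in auto)
  also have "\<dots> = (\<Sum>k<d. F X Y k k - F Y X k k)" by simp
  also have "\<dots> = gl_action n d (\<lambda>a b. \<Sum>c=1..n. X a c * Y c b - Y a c * X c b) t w"
    using w by (auto simp: gl_action_def diag intro!: sum.cong)
  finally show ?thesis by (simp add: XY)
qed

lemma gl_op_commutator:
  "gl_op n d X \<otimes>\<^bsub>schur_algebra n d\<^esub> gl_op n d Y \<ominus>\<^bsub>schur_algebra n d\<^esub>
     gl_op n d Y \<otimes>\<^bsub>schur_algebra n d\<^esub> gl_op n d X =
   gl_op n d (\<lambda>a b. \<Sum>c=1..n. X a c * Y c b - Y a c * X c b)" (is "?L = ?R")
proof (rule schur_eqI)
  interpret ring "schur_algebra n d" by (rule ring_schur_algebra)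
  show "?L \<in> carrier (schur_algebra n d)" "?R \<in> carrier (schur_algebra n d)"
    by (simp_all add: gl_op_closed)
  fix u w assume u: "u \<in> words n d" and w: "w \<in> words n d"
  have T: "gl_action n d X t \<in> tensors UNIV n d" for X t by (simp add: tensors_def gl_action_def)
  show "entry ?L u w = entry ?R u w"
    using gl_action_commutator[OF u, of X Y "unit_tensor w"] w
    by (simp add: entry_minus gl_op_closed)
       (simp add: entry_def gl_op_def unit_tensor_tensors schur_algebra_def compose_def T)
qed

lemma gl_op_commutator_matrix_units:
  assumes "j \<in> {1..n}" "i \<noteq> l"
  shows "gl_op n d (matrix_unit i j) \<otimes>\<^bsub>schur_algebra n d\<^esub> gl_op n d (matrix_unit j l) \<ominus>\<^bsub>schur_algebra n d\<^esub>
     gl_op n d (matrix_unit j l) \<otimes>\<^bsub>schur_algebra n d\<^esub> gl_op n d (matrix_unit i j) =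
   gl_op n d (matrix_unit i l)"
proof -
  have "(\<Sum>c=1..n. matrix_unit i j a c * matrix_unit j l c b - matrix_unit j l a c * matrix_unit i j c b) =
      matrix_unit i l a b" for a b
  proof -
    have "(\<Sum>c=1..n. matrix_unit i j a c * matrix_unit j l c b - matrix_unit j l a c * matrix_unit i j c b) =
      (\<Sum>c=1..n. if c = j then matrix_unit i l a b else 0)"
      using assms(2) by (intro sum.cong) (auto simp: matrix_unit_def)
    then show ?thesis using assms(1) by simp
  qed
  then show ?thesis unfolding gl_op_commutator by presburger
qed

text \<open>The commutator of the matrix units at (i, i + 1) and (i + 1, j) is the one at (i, j),
  which is the step of the recursion.\<close>

lemma pos_root_vector_eq:
  "1 \<le> i \<Longrightarrow> i < j \<Longrightarrow> j \<le> n \<Longrightarrow> pos_root_vector n d i j = gl_op n d (matrix_unit i j)"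
proof (induction n d i j rule: pos_root_vector.induct)
  case (1 n d i j)
  show ?case
  proof (cases "j - i > 1")
    case True
    then show ?thesis using 1 gl_op_commutator_matrix_units[of "i + 1" n i j d]
      by (subst pos_root_vector.simps) (simp add: e_op_def)
  next
    case False
    then have "j = i + 1" using 1 by simp
    then show ?thesis by (subst pos_root_vector.simps) (simp add: e_op_def)
  qed
qed

lemma neg_root_vector_eq:
  "1 \<le> i \<Longrightarrow> i < j \<Longrightarrow> j \<le> n \<Longrightarrow> neg_root_vector n d i j = gl_op n d (matrix_unit j i)"
proof (induction n d i j rule: neg_root_vector.induct)
  case (1 n d i j)
  show ?case
  proof (cases "j - i > 1")
    case True
    then show ?thesis using 1 gl_op_commutator_matrix_units[of "i + 1" n j i d]
      by (subst neg_root_vector.simps) (simp add: f_op_def)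
  next
    case False
    then have "j = i + 1" using 1 by simp
    then show ?thesis by (subst neg_root_vector.simps) (simp add: f_op_def)
  qed
qed

lemma root_vector_eq:
  assumes "i \<in> {1..n}" "j \<in> {1..n}" "i \<noteq> j"
  shows "root_vector n d (i, j) = gl_op n d (matrix_unit i j)"
  using assms by (auto simp: root_vector_def pos_root_vector_eq neg_root_vector_eq)

text \<open>A middle word arises by undoing the change in one of the \<open>Suc m\<close> changed
  places of w, so there is one for each of these places. These factors accumulate to the factorial
  that the divided power removes.\<close>

lemma card_one_step:
  assumes ij: "i \<in> {1..n}" "i \<noteq> j" and u: "u \<in> words n d" and w: "w \<in> words n d"
  shows "card {v \<in> words n d. moves u v = replicate_mset m (i, j) \<and> moves v w = {#(i, j)#}} =
    (if moves u w = replicate_mset (Suc m) (i, j) then Suc m else 0)"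
proof -
  let ?V = "{v \<in> words n d. moves u v = replicate_mset m (i, j) \<and> moves v w = {#(i, j)#}}"
  have A: "moves u w = replicate_mset (Suc m) (i, j) \<and> v \<in> (\<lambda>k. w[k := i]) ` diff_places u w"
    if v: "v \<in> ?V" for v
  proof -
    have l: "length u = d" "length v = d" "length w = d" using u w v by (auto simp: words_def)
    have "moves v w = replicate_mset 1 (i, j)" using v by simp
    then obtain k where k: "diff_places v w = {k}" "v ! k = i" "w ! k = j"
      unfolding moves_replicate_iff by (auto simp: card_1_singleton_iff)
    \<comment> \<open>The places changed on the way to v carry j, but v has i in place k.\<close>
    have "k \<notin> diff_places u v"
      using v k ij by (auto simp: moves_replicate_iff)
    then have d: "diff_places u v \<inter> diff_places v w = {}" using k by simp
    have "k \<in> diff_places u w" using moves_add(1)[OF _ d] l k by simp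
    moreover have "v = w[k := i]"
    proof (rule nth_equalityI)
      fix p assume "p < length v"
      then show "v ! p = w[k := i] ! p"
        using k l by (cases "p = k") (auto simp: diff_places_def)
    qed (simp add: l)
    moreover have "moves u w = replicate_mset (Suc m) (i, j)"
      using moves_add(2)[OF _ d] l v by simp
    ultimately show ?thesis by blast
  qed
  show ?thesis
  proof (cases "moves u w = replicate_mset (Suc m) (i, j)")
    case True
    have D: "card (diff_places u w) = Suc m" and uw: "\<And>p. p \<in> diff_places u w \<Longrightarrow> u ! p = i \<and> w ! p = j"
      using True unfolding moves_replicate_iff by auto
    have l: "length u = d" "length w = d" using u w by (auto simp: words_def)
    have "w[k := i] \<in> ?V" if k: "k \<in> diff_places u w" for k
    proof -
      have kd: "k < d" using k l by (simp add: diff_places_def)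
      have "diff_places (w[k := i]) w = {k}"
        using diff_places_update(2)[of k w i] uw[OF k] ij kd l by simp
      then have 1: "moves (w[k := i]) w = replicate_mset 1 (i, j)"
        unfolding moves_replicate_iff using uw[OF k] kd l by simp
      have "diff_places u (w[k := i]) = diff_places u w - {k}"
        using uw[OF k] kd l by (auto simp: diff_places_def nth_list_update)
      then have "moves u (w[k := i]) = replicate_mset m (i, j)"
        unfolding moves_replicate_iff using D k uw by auto
      then show ?thesis using 1 words_update[OF w ij(1)] by simp
    qed
    then have "?V = (\<lambda>k. w[k := i]) ` diff_places u w" using A by blast
    moreover have "inj_on (\<lambda>k. w[k := i]) (diff_places u w)"
    proof (rule inj_onI, rule ccontr)
      fix k q assume k: "k \<in> diff_places u w" "q \<in> diff_places u w" "w[k := i] = w[q := i]" "k \<noteq> q"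
      then have "w[k := i] ! k = w ! k" by simp
      moreover have "w[k := i] ! k = i" using k(1) l by (simp add: diff_places_def)
      ultimately show False using uw[OF k(1)] ij by simp
    qed
    ultimately show ?thesis using True D by (simp add: card_image)
  next
    case False
    then have "?V = {}" using A by blast
    then show ?thesis using False by (metis card.empty)
  qed
qed

lemma sum_of_bool_card: "finite A \<Longrightarrow> (\<Sum>x\<in>A. of_bool (P x)) = (of_nat (card {x \<in> A. P x}) :: rat)"
  by (simp add: of_bool_def sum.If_cases Int_def)

lemma entry_divided_power:
  assumes ij: "i \<in> {1..n}" "j \<in> {1..n}" "i \<noteq> j" and u: "u \<in> words n d" and w: "w \<in> words n d"
  shows "entry (divided_power n d (gl_op n d (matrix_unit i j)) m) u w =
    of_bool (moves u w = replicate_mset m (i, j))"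
proof -
  interpret ring "schur_algebra n d" by (rule ring_schur_algebra)
  let ?x = "gl_op n d (matrix_unit i j)"
  have "entry (?x [^]\<^bsub>schur_algebra n d\<^esub> m) u w = fact m * of_bool (moves u w = replicate_mset m (i, j))"
    using w
  proof (induction m arbitrary: w)
    case 0
    then show ?case using u by (simp add: entry_one moves_eq_empty_iff)
  next
    case (Suc m)
    have "entry (?x [^]\<^bsub>schur_algebra n d\<^esub> Suc m) u w =
      (\<Sum>v\<in>words n d. entry (?x [^]\<^bsub>schur_algebra n d\<^esub> m) u v * entry ?x v w)"
      using Suc.prems by (simp add: entry_mult gl_op_closed)
    also have "\<dots> = (\<Sum>v\<in>words n d. fact m *
        of_bool (moves u v = replicate_mset m (i, j) \<and> moves v w = {#(i, j)#}))"
      using Suc ij by (intro sum.cong) (auto simp: entry_gl_op_off_diagonal)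
    also have "\<dots> = fact m * of_nat (card {v \<in> words n d.
        moves u v = replicate_mset m (i, j) \<and> moves v w = {#(i, j)#}})"
      by (simp only: sum_distrib_left[symmetric] sum_of_bool_card finite_words)
    also have "\<dots> = fact (Suc m) * of_bool (moves u w = replicate_mset (Suc m) (i, j))"
      unfolding card_one_step[OF ij(1,3) u Suc.prems] by simp
    finally show ?case .
  qed
  then show ?thesis using w by (simp add: divided_power_def entry_smult)
qed

section \<open>Products of elements and the weight idempotents\<close>

lemma divided_power_closed:
  "x \<in> carrier (schur_algebra n d) \<Longrightarrow> divided_power n d x m \<in> carrier (schur_algebra n d)"
  unfolding divided_power_def
  by (intro smult_closed monoid.nat_pow_closed ring.is_monoid ring_schur_algebra)

lemma schur_prod_closed:
  assumes "set fs \<subseteq> carrier (schur_algebra n d)"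
  shows "schur_prod n d fs \<in> carrier (schur_algebra n d)"
proof -
  interpret ring "schur_algebra n d" by (rule ring_schur_algebra)
  show ?thesis using assms by (induction fs) (auto simp: schur_prod_def)
qed

lemma schur_prod_append:
  assumes "set fs \<subseteq> carrier (schur_algebra n d)" "set gs \<subseteq> carrier (schur_algebra n d)"
  shows "schur_prod n d (fs @ gs) = schur_prod n d fs \<otimes>\<^bsub>schur_algebra n d\<^esub> schur_prod n d gs"
proof -
  interpret ring "schur_algebra n d" by (rule ring_schur_algebra)
  have C: "schur_prod n d (f # fs) = f \<otimes>\<^bsub>schur_algebra n d\<^esub> schur_prod n d fs" for f fs
    by (simp add: schur_prod_def)
  have N: "schur_prod n d [] = \<one>\<^bsub>schur_algebra n d\<^esub>" by (simp add: schur_prod_def)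
  show ?thesis using assms
  proof (induction fs)
    case (Cons f fs)
    then show ?case
      using schur_prod_closed[of fs n d] schur_prod_closed[OF assms(2)] by (simp add: C m_assoc)
  qed (use schur_prod_closed[OF assms(2)] in \<open>simp add: N\<close>)
qed

lemma entry_schur_prod_diagonal:
  assumes "\<And>k. k \<in> set ks \<Longrightarrow> F k \<in> carrier (schur_algebra n d)"
    and "\<And>k u w. k \<in> set ks \<Longrightarrow> u \<in> words n d \<Longrightarrow> w \<in> words n d \<Longrightarrow>
      entry (F k) u w = of_bool (u = w) * \<phi> k u"
    and w: "w \<in> words n d" and "u \<in> words n d"
  shows "entry (schur_prod n d (map F ks)) u w = of_bool (u = w) * (\<Prod>k\<leftarrow>ks. \<phi> k u)"
  using assms(1,2,4)
proof (induction ks arbitrary: u)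
  case Nil
  then show ?case using w by (simp add: schur_prod_def entry_one)
next
  case (Cons k ks)
  have c: "schur_prod n d (map F ks) \<in> carrier (schur_algebra n d)"
    using Cons.prems(1) by (intro schur_prod_closed) auto
  have "entry (schur_prod n d (map F (k # ks))) u w =
      (\<Sum>v\<in>words n d. entry (F k) u v * entry (schur_prod n d (map F ks)) v w)"
    using Cons.prems(1)[of k] c w entry_mult[of "F k" n d "schur_prod n d (map F ks)" w u]
    by (simp add: schur_prod_def)
  also have "\<dots> = (\<Sum>v\<in>words n d. if v = u then of_bool (u = w) * (\<phi> k u * (\<Prod>k\<leftarrow>ks. \<phi> k u)) else 0)"
    using Cons by (intro sum.cong) auto
  also have "\<dots> = of_bool (u = w) * (\<Prod>k\<leftarrow>k # ks. \<phi> k u)"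
    using Cons.prems(3) by (simp add: finite_words)
  finally show ?case .
qed

lemma H_binom_closed: "H_binom n d i m \<in> carrier (schur_algebra n d)"
proof -
  interpret ring "schur_algebra n d" by (rule ring_schur_algebra)
  show ?thesis
    unfolding H_binom_def H_op_def
    by (intro smult_closed schur_prod_closed) (auto simp: smult_closed gl_op_closed)
qed

lemma entry_H_binom:
  assumes i: "i \<in> {1..n}" and u: "u \<in> words n d" and w: "w \<in> words n d"
  shows "entry (H_binom n d i m) u w = of_bool (u = w) * of_nat (count_list u i choose m)"
proof -
  interpret ring "schur_algebra n d" by (rule ring_schur_algebra)
  let ?F = "\<lambda>k. H_op n d i \<ominus>\<^bsub>schur_algebra n d\<^esub> (of_nat k \<odot>\<^bsub>schur_algebra n d\<^esub> \<one>\<^bsub>schur_algebra n d\<^esub>)"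
  have c: "H_op n d i \<in> carrier (schur_algebra n d)" by (simp add: H_op_def gl_op_closed)
  have "entry (schur_prod n d (map ?F [0..<m])) u w =
      of_bool (u = w) * (\<Prod>k\<leftarrow>[0..<m]. of_nat (count_list u i) - of_nat k)"
  proof (rule entry_schur_prod_diagonal[where \<phi> = "\<lambda>k u. of_nat (count_list u i) - of_nat k"])
    fix k u w assume uw: "u \<in> words n d" "w \<in> words n d"
    show "entry (?F k) u w = of_bool (u = w) * (of_nat (count_list u i) - of_nat k)"
      using uw i c by (simp add: entry_minus smult_closed entry_smult entry_one entry_H_op)
  qed (use c u w smult_closed in auto)
  also have "(\<Prod>k\<leftarrow>[0..<m]. of_nat (count_list u i) - of_nat k) =
      (\<Prod>k = 0..<m. of_nat (count_list u i) - of_nat k :: rat)"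
    by (subst prod.distinct_set_conv_list[symmetric]) auto
  finally show ?thesis
    using w by (simp add: H_binom_def entry_smult binomial_gbinomial gbinomial_prod_rev)
qed

lemma sum_count_list_words: "u \<in> words n d \<Longrightarrow> (\<Sum>i=1..n. count_list u i) = d"
  using sum_count_set[of u "{1..n}"] by (simp add: words_def)

lemma val_idem_word_closed: "val n d (idem_word n \<mu>) \<in> carrier (schur_algebra n d)"
  unfolding val_def by (rule schur_prod_closed) (auto simp: idem_word_def H_binom_closed)

text \<open>The product of the binomials is 1 on words of weight \<mu>. Any other word contains some
  letter i fewer than \<open>\<mu> i\<close> times, since both multiplicity vectors have sum d, and
  the corresponding binomial vanishes.\<close>

lemma entry_val_idem_word:
  assumes \<mu>: "\<mu> \<in> weights n d" and u: "u \<in> words n d" and w: "w \<in> words n d"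
  shows "entry (val n d (idem_word n \<mu>)) u w =
    of_bool (u = w \<and> (\<forall>i\<in>{1..n}. count_list u i = \<mu> i))"
proof -
  have "entry (val n d (idem_word n \<mu>)) u w =
      of_bool (u = w) * (\<Prod>i\<leftarrow>[1..<n + 1]. of_nat (count_list u i choose \<mu> i))"
    unfolding val_def idem_word_def map_map
    by (rule entry_schur_prod_diagonal[where \<phi> = "\<lambda>i u. of_nat (count_list u i choose \<mu> i)"])
      (use u w in \<open>auto simp: H_binom_closed entry_H_binom\<close>)
  also have "(\<Prod>i\<leftarrow>[1..<n + 1]. of_nat (count_list u i choose \<mu> i)) =
      (\<Prod>i\<in>{1..n}. of_nat (count_list u i choose \<mu> i) :: rat)"
    by (subst prod.distinct_set_conv_list[symmetric]) (auto intro!: prod.cong)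
  also have "\<dots> = of_bool (\<forall>i\<in>{1..n}. count_list u i = \<mu> i)"
  proof (cases "\<forall>i\<in>{1..n}. count_list u i = \<mu> i")
    case False
    have "\<exists>i\<in>{1..n}. count_list u i < \<mu> i"
    proof (rule ccontr)
      assume a: "\<not> ?thesis"
      obtain i where i: "i \<in> {1..n}" "count_list u i \<noteq> \<mu> i" using False by blast
      have "(\<Sum>i=1..n. \<mu> i) < (\<Sum>i=1..n. count_list u i)"
      proof (rule sum_strict_mono_ex1)
        show "\<exists>i\<in>{1..n}. \<mu> i < count_list u i" using a i by (metis linorder_neqE_nat)
      qed (use a in \<open>auto simp: not_less\<close>)
      then show False using \<mu> sum_count_list_words[OF u] by (simp add: weights_def)
    qed
    then have "(\<Prod>i\<in>{1..n}. of_nat (count_list u i choose \<mu> i) :: rat) = 0" by auto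
    then show ?thesis using False by simp
  qed simp
  finally show ?thesis by (simp only: of_bool_conj)
qed

section \<open>Leading orbits of products\<close>

text \<open>The multiset \<open>E\<close> determines an orbit of the place permutations on pairs of words; all other orbits
  in the support of the matrix consist of pairs that differ in fewer than \<open>|E|\<close> places.\<close>

definition leading :: "nat \<Rightarrow> nat \<Rightarrow> (nat list \<Rightarrow> nat list \<Rightarrow> rat) \<Rightarrow> (nat \<times> nat) multiset \<Rightarrow> bool" where
  "leading n d P E \<longleftrightarrow> (\<forall>u\<in>words n d. \<forall>w\<in>words n d.
     (P u w \<noteq> 0 \<longrightarrow> size (moves u w) \<le> size E) \<and>
     (size (moves u w) = size E \<longrightarrow> P u w = of_bool (moves u w = E)))"

lemma leadingD:
  assumes "leading n d P E" "u \<in> words n d" "w \<in> words n d"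
  shows "P u w \<noteq> 0 \<Longrightarrow> size (moves u w) \<le> size E"
    and "size (moves u w) = size E \<Longrightarrow> P u w = of_bool (moves u w = E)"
  using assms by (auto simp: leading_def)

text \<open>With S the set of pairs moved by the left factor, this is the only possible middle word
  of a leading path from u to w.\<close>

definition partial_moves :: "(nat \<times> nat) set \<Rightarrow> nat list \<Rightarrow> nat list \<Rightarrow> nat list" where
  "partial_moves S u w = map (\<lambda>(a, b). if (a, b) \<in> S then b else a) (zip u w)"

lemma partial_moves_words:
  assumes "u \<in> words n d" "w \<in> words n d"
  shows "partial_moves S u w \<in> words n d"
proof -
  have "set (partial_moves S u w) \<subseteq> set u \<union> set w"
    by (auto simp: partial_moves_def elim!: in_set_zipE)
  then show ?thesis using assms by (auto simp: words_def partial_moves_def)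
qed

section \<open>Factorization through a middle word\<close>

context
  fixes n d :: nat and P1 P2 :: "nat list \<Rightarrow> nat list \<Rightarrow> rat" and E1 E2 u w
  assumes lead: "leading n d P1 E1" "leading n d P2 E2"
    and disj: "set_mset E1 \<inter> set_mset E2 = {}"
    and u: "u \<in> words n d" and w: "w \<in> words n d"
begin

lemma moves_factorization_le:
  assumes v: "v \<in> words n d" and nz: "P1 u v \<noteq> 0" "P2 v w \<noteq> 0"
  shows "size (moves u w) \<le> size E1 + size E2"
proof -
  have "size (moves u w) \<le> size (moves u v) + size (moves v w)"
    using card_mono[OF _ diff_places_triangle[of u v w]] card_Un_le[of "diff_places u v" "diff_places v w"] u v
    by (simp add: size_moves words_def)
  then show ?thesis
    using leadingD(1)[OF lead(1) u v nz(1)] leadingD(1)[OF lead(2) v w nz(2)] by simp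
qed

text \<open>The two steps change at most |E1| and |E2| places, so equality forces both bounds to be
  attained in disjoint sets of places. Since E1 and E2 share no pair, the pair of letters in a place
  tells which step changed it.\<close>

lemma moves_factorization_eq:
  assumes v: "v \<in> words n d" and nz: "P1 u v \<noteq> 0" "P2 v w \<noteq> 0"
    and size: "size (moves u w) = size E1 + size E2"
  shows "moves u w = E1 + E2" "v = partial_moves (set_mset E1) u w"
proof -
  have l: "length u = d" "length v = d" "length w = d" using u v w by (auto simp: words_def)
  have 1: "size (moves u v) \<le> size E1" "size (moves v w) \<le> size E2"
    using leadingD(1)[OF lead(1) u v nz(1)] leadingD(1)[OF lead(2) v w nz(2)] .
  have "card (diff_places u w) \<le> card (diff_places u v \<union> diff_places v w)"
    using diff_places_triangle[of u v w] l by (intro card_mono) auto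
  moreover have "card (diff_places u v) + card (diff_places v w) =
      card (diff_places u v \<union> diff_places v w) + card (diff_places u v \<inter> diff_places v w)"
    by (intro card_Un_Int) auto
  ultimately have 2: "size (moves u v) = size E1" "size (moves v w) = size E2"
    and 3: "card (diff_places u v \<inter> diff_places v w) = 0"
    using 1 size unfolding size_moves by linarith+
  have E: "moves u v = E1" "moves v w = E2"
    using leadingD(2)[OF lead(1) u v 2(1)] leadingD(2)[OF lead(2) v w 2(2)] nz by auto
  have d: "diff_places u v \<inter> diff_places v w = {}" using 3 by simp
  show "moves u w = E1 + E2" using moves_add(2)[OF _ d] l E by simp
  show "v = partial_moves (set_mset E1) u w"
  proof (rule nth_equalityI)
    fix p assume "p < length v"
    then have p: "p < d" using l by simp
    have "v ! p = (if (u ! p, w ! p) \<in># E1 then w ! p else u ! p)"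
    proof (cases "p \<in> diff_places u v")
      case True
      then have "v ! p = w ! p" "(u ! p, v ! p) \<in># E1"
        using d p l set_moves[of u v] E by (auto simp: diff_places_def)
      then show ?thesis by simp
    next
      case False
      then have uv: "u ! p = v ! p" using p l by (simp add: diff_places_def)
      show ?thesis
      proof (cases "v ! p = w ! p")
        case False
        then have "p \<in> diff_places v w" using p l by (simp add: diff_places_def)
        then have "(u ! p, w ! p) \<in># E2" using set_moves[of v w] E uv by force
        then have "(u ! p, w ! p) \<notin># E1" using disj by blast
        then show ?thesis using uv by simp
      qed (use uv in simp)
    qed
    then show "v ! p = partial_moves (set_mset E1) u w ! p"
      using p l by (simp add: partial_moves_def)
  qed (simp add: l partial_moves_def)
qed

text \<open>Filtering the moves from u to w by membership in E1 splits them into the moves of the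
  two steps, because E1 and E2 have disjoint supports.\<close>

lemma moves_factorization:
  assumes m: "moves u w = E1 + E2"
  shows "P1 u (partial_moves (set_mset E1) u w) = 1" "P2 (partial_moves (set_mset E1) u w) w = 1"
proof -
  define v where "v = partial_moves (set_mset E1) u w"
  have v: "v \<in> words n d" unfolding v_def using u w by (rule partial_moves_words)
  have l: "length u = d" "length v = d" "length w = d" using u v w by (auto simp: words_def)
  have vp: "v ! p = (if (u ! p, w ! p) \<in># E1 then w ! p else u ! p)" if "p < d" for p
    using that l by (simp add: v_def partial_moves_def)
  have 1: "diff_places u v = {p \<in> diff_places u w. (u ! p, w ! p) \<in># E1}"
    "diff_places v w = {p \<in> diff_places u w. (u ! p, w ! p) \<notin># E1}"
    using vp l by (auto simp: diff_places_def split: if_splits)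
  have f: "filter_mset (\<lambda>q. q \<in># E1) (E1 + E2) = E1" "filter_mset (\<lambda>q. q \<notin># E1) (E1 + E2) = E2"
    using disj by (auto simp: multiset_eq_iff not_in_iff[symmetric])
  have fm: "filter_mset Q (moves u w) =
      image_mset (\<lambda>p. (u ! p, w ! p)) (mset_set {p \<in> diff_places u w. Q (u ! p, w ! p)})" for Q
    by (simp add: moves_def filter_mset_image_mset)
  have "moves u v = filter_mset (\<lambda>q. q \<in># E1) (moves u w)"
    unfolding fm moves_def[of u v] 1
    by (intro image_mset_cong) (use vp l in \<open>auto simp: diff_places_def\<close>)
  then have E1: "moves u v = E1" using m f by simp
  have "moves v w = filter_mset (\<lambda>q. q \<notin># E1) (moves u w)"
    unfolding fm moves_def[of v w] 1
    by (intro image_mset_cong) (use vp l in \<open>auto simp: diff_places_def\<close>)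
  then have E2: "moves v w = E2" using m f by simp
  show "P1 u (partial_moves (set_mset E1) u w) = 1" "P2 (partial_moves (set_mset E1) u w) w = 1"
    using leadingD(2)[OF lead(1) u v] leadingD(2)[OF lead(2) v w] E1 E2 by (auto simp: v_def)
qed

text \<open>The factor \<open>of_bool (Q v)\<close> is the diagonal of an idempotent between the two
  factors; a constantly true Q gives a plain product. In top degree only the forced middle word
  survives in the sum.\<close>

lemma leading_sandwich:
  shows "(\<Sum>v\<in>words n d. P1 u v * of_bool (Q v) * P2 v w) \<noteq> 0 \<Longrightarrow> size (moves u w) \<le> size E1 + size E2"
    and "size (moves u w) = size E1 + size E2 \<Longrightarrow>
      (\<Sum>v\<in>words n d. P1 u v * of_bool (Q v) * P2 v w) =
        of_bool (moves u w = E1 + E2 \<and> Q (partial_moves (set_mset E1) u w))"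
proof -
  assume "(\<Sum>v\<in>words n d. P1 u v * of_bool (Q v) * P2 v w) \<noteq> 0"
  then obtain v where "v \<in> words n d" "P1 u v * of_bool (Q v) * P2 v w \<noteq> 0"
    by (rule sum.not_neutral_contains_not_neutral)
  then show "size (moves u w) \<le> size E1 + size E2"
    using moves_factorization_le[of v] by simp
next
  assume s: "size (moves u w) = size E1 + size E2"
  let ?v = "partial_moves (set_mset E1) u w"
  have "(\<Sum>v\<in>words n d. P1 u v * of_bool (Q v) * P2 v w) =
      (\<Sum>v\<in>words n d. if v = ?v then of_bool (moves u w = E1 + E2 \<and> Q ?v) else 0)"
  proof (rule sum.cong)
    fix v assume v: "v \<in> words n d"
    show "P1 u v * of_bool (Q v) * P2 v w = (if v = ?v then of_bool (moves u w = E1 + E2 \<and> Q ?v) else 0)"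
    proof (cases "v = ?v \<and> moves u w = E1 + E2")
      case True
      then show ?thesis using moves_factorization by simp
    next
      case False
      then have "P1 u v = 0 \<or> P2 v w = 0" using moves_factorization_eq[OF v _ _ s] by blast
      then show ?thesis using False by auto
    qed
  qed simp
  also have "\<dots> = of_bool (moves u w = E1 + E2 \<and> Q ?v)"
    using partial_moves_words[OF u w] by (simp add: finite_words)
  finally show "(\<Sum>v\<in>words n d. P1 u v * of_bool (Q v) * P2 v w) = of_bool (moves u w = E1 + E2 \<and> Q ?v)" .
qed

end

section \<open>Products of divided powers on both sides of an idempotent\<close>

definition total_moves :: "((nat \<times> nat) \<times> nat) list \<Rightarrow> (nat \<times> nat) multiset" where
  "total_moves L = (\<Sum>(\<alpha>, m)\<leftarrow>L. replicate_mset m \<alpha>)"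

lemma total_moves_simps [simp]:
  "total_moves [] = {#}" "total_moves ((\<alpha>, m) # L) = replicate_mset m \<alpha> + total_moves L"
  by (simp_all add: total_moves_def)

lemma set_total_moves: "set_mset (total_moves L) \<subseteq> fst ` set L"
proof (induction L)
  case (Cons x L)
  then show ?case by (cases x) (auto split: if_splits)
qed simp

definition roots :: "nat \<Rightarrow> (nat \<times> nat) set" where
  "roots n = {(i, j). i \<in> {1..n} \<and> j \<in> {1..n} \<and> i \<noteq> j}"

definition power_word :: "((nat \<times> nat) \<times> nat) list \<Rightarrow> factor list" where
  "power_word L = map (\<lambda>(\<alpha>, m). Div_Pow \<alpha> m) L"

lemma root_power_closed:
  "\<alpha> \<in> roots n \<Longrightarrow> factor_val n d (Div_Pow \<alpha> m) \<in> carrier (schur_algebra n d)"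
  by (cases \<alpha>) (auto simp: roots_def root_vector_eq divided_power_closed gl_op_closed)

lemma entry_root_power:
  assumes "\<alpha> \<in> roots n" "u \<in> words n d" "w \<in> words n d"
  shows "entry (factor_val n d (Div_Pow \<alpha> m)) u w = of_bool (moves u w = replicate_mset m \<alpha>)"
  using assms by (cases \<alpha>) (auto simp: roots_def root_vector_eq entry_divided_power)

lemma leading_root_power:
  "\<alpha> \<in> roots n \<Longrightarrow> leading n d (entry (factor_val n d (Div_Pow \<alpha> m))) (replicate_mset m \<alpha>)"
  by (auto simp: leading_def entry_root_power simp del: factor_val.simps)

lemma val_power_word_closed:
  "fst ` set L \<subseteq> roots n \<Longrightarrow> val n d (power_word L) \<in> carrier (schur_algebra n d)"
  unfolding val_def power_word_def
  by (rule schur_prod_closed) (auto simp: root_power_closed simp del: factor_val.simps)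

text \<open>Distinct roots keep the moves of the first factor disjoint from those of the rest, which
  is what \<open>leading_sandwich\<close> asks for in each induction step.\<close>

lemma leading_power_word:
  assumes "distinct (map fst L)" "fst ` set L \<subseteq> roots n"
  shows "leading n d (entry (val n d (power_word L))) (total_moves L)"
  using assms
proof (induction L)
  case Nil
  then show ?case
    by (auto simp: leading_def val_def power_word_def schur_prod_def entry_one moves_eq_empty_iff)
next
  case (Cons x L)
  obtain \<alpha> m where x: "x = (\<alpha>, m)" by (cases x)
  have \<alpha>: "\<alpha> \<in> roots n" "\<alpha> \<notin> fst ` set L" and L: "fst ` set L \<subseteq> roots n"
    using Cons.prems by (auto simp: x)
  let ?P = "entry (factor_val n d (Div_Pow \<alpha> m))" and ?R = "entry (val n d (power_word L))"
  have V: "val n d (power_word (x # L)) =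
      factor_val n d (Div_Pow \<alpha> m) \<otimes>\<^bsub>schur_algebra n d\<^esub> val n d (power_word L)"
    by (simp add: x val_def power_word_def schur_prod_def)
  have entry: "entry (val n d (power_word (x # L))) u w =
      (\<Sum>v\<in>words n d. ?P u v * of_bool True * ?R v w)" if "w \<in> words n d" for u w
    unfolding V using that \<alpha>(1) L
    by (simp add: entry_mult root_power_closed val_power_word_closed del: factor_val.simps)
  have dj: "set_mset (replicate_mset m \<alpha>) \<inter> set_mset (total_moves L) = {}"
    using \<alpha>(2) set_total_moves[of L] by auto
  have "leading n d ?R (total_moves L)" using Cons by simp
  note S = leading_sandwich[OF leading_root_power[OF \<alpha>(1)] this dj, where Q = "\<lambda>v. True"]
  show ?case
    unfolding leading_def
    by (intro ballI) (simp only: x entry[unfolded x] total_moves_simps size_union conj_commute;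
        use S in \<open>simp del: factor_val.simps\<close>)
qed

text \<open>The idempotent restricts the sum over middle words to those of weight \<mu>, so
  \<open>leading_sandwich\<close> applies with this condition as its Q.\<close>

lemma entry_power_idem_power:
  assumes L: "distinct (map fst L1)" "fst ` set L1 \<subseteq> roots n" "distinct (map fst L2)" "fst ` set L2 \<subseteq> roots n"
    and disj: "fst ` set L1 \<inter> fst ` set L2 = {}"
    and \<mu>: "\<mu> \<in> weights n d" and u: "u \<in> words n d" and w: "w \<in> words n d"
  defines "y \<equiv> val n d (power_word L1 @ idem_word n \<mu> @ power_word L2)"
  shows "entry y u w \<noteq> 0 \<Longrightarrow> size (moves u w) \<le> size (total_moves L1) + size (total_moves L2)"
    and "size (moves u w) = size (total_moves L1) + size (total_moves L2) \<Longrightarrow>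
      entry y u w = of_bool (moves u w = total_moves L1 + total_moves L2 \<and>
        (\<forall>i\<in>{1..n}. count_list (partial_moves (set_mset (total_moves L1)) u w) i = \<mu> i))"
proof -
  interpret ring "schur_algebra n d" by (rule ring_schur_algebra)
  have cl: "set (map (factor_val n d) (power_word L)) \<subseteq> carrier (schur_algebra n d)"
    if "fst ` set L \<subseteq> roots n" for L
    using that by (auto simp: power_word_def root_power_closed simp del: factor_val.simps)
  have ci: "set (map (factor_val n d) (idem_word n \<mu>)) \<subseteq> carrier (schur_algebra n d)"
    by (auto simp: idem_word_def H_binom_closed)
  have y: "y = val n d (power_word L1) \<otimes>\<^bsub>schur_algebra n d\<^esub>
      (val n d (idem_word n \<mu>) \<otimes>\<^bsub>schur_algebra n d\<^esub> val n d (power_word L2))"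
    unfolding y_def val_def map_append
    using cl[OF L(2)] cl[OF L(4)] ci by (simp add: schur_prod_append)
  let ?Q = "\<lambda>v. \<forall>i\<in>{1..n}. count_list v i = \<mu> i"
  have e: "entry y u w = (\<Sum>v\<in>words n d. entry (val n d (power_word L1)) u v * of_bool (?Q v) *
      entry (val n d (power_word L2)) v w)"
  proof -
    have "entry y u w = (\<Sum>v\<in>words n d. entry (val n d (power_word L1)) u v *
        (\<Sum>x\<in>words n d. entry (val n d (idem_word n \<mu>)) v x * entry (val n d (power_word L2)) x w))"
      unfolding y using w L val_power_word_closed val_idem_word_closed by (simp add: entry_mult)
    also have "\<dots> = (\<Sum>v\<in>words n d. entry (val n d (power_word L1)) u v *
        (\<Sum>x\<in>words n d. if x = v then of_bool (?Q v) * entry (val n d (power_word L2)) v w else 0))"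
      by (intro sum.cong arg_cong2[of _ _ _ _ "(*)"] refl) (auto simp: entry_val_idem_word[OF \<mu>])
    finally show ?thesis by (simp add: finite_words mult.assoc)
  qed
  have dj: "set_mset (total_moves L1) \<inter> set_mset (total_moves L2) = {}"
    using disj set_total_moves[of L1] set_total_moves[of L2] by blast
  note S = leading_sandwich[OF leading_power_word[OF L(1,2)] leading_power_word[OF L(3,4)] dj u w, where Q = ?Q]
  show "entry y u w \<noteq> 0 \<Longrightarrow> size (moves u w) \<le> size (total_moves L1) + size (total_moves L2)"
    unfolding e by (rule S(1))
  show "size (moves u w) = size (total_moves L1) + size (total_moves L2) \<Longrightarrow>
      entry y u w = of_bool (moves u w = total_moves L1 + total_moves L2 \<and>
        ?Q (partial_moves (set_mset (total_moves L1)) u w))"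
    unfolding e by (rule S(2))
qed

section \<open>Bases from unitriangular matrices\<close>

lemma integral_closed:
  assumes "f \<in> integral_schur_algebra n d" "g \<in> integral_schur_algebra n d"
  shows "f \<otimes>\<^bsub>schur_algebra n d\<^esub> g \<in> integral_schur_algebra n d"
    and "f \<oplus>\<^bsub>schur_algebra n d\<^esub> g \<in> integral_schur_algebra n d"
    and "f \<ominus>\<^bsub>schur_algebra n d\<^esub> g \<in> integral_schur_algebra n d"
    and "\<ominus>\<^bsub>schur_algebra n d\<^esub> f \<in> integral_schur_algebra n d"
proof -
  interpret ring "schur_algebra n d" by (rule ring_schur_algebra)
  show "f \<otimes>\<^bsub>schur_algebra n d\<^esub> g \<in> integral_schur_algebra n d"
    "f \<oplus>\<^bsub>schur_algebra n d\<^esub> g \<in> integral_schur_algebra n d"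
    "f \<ominus>\<^bsub>schur_algebra n d\<^esub> g \<in> integral_schur_algebra n d"
    "\<ominus>\<^bsub>schur_algebra n d\<^esub> f \<in> integral_schur_algebra n d"
    using assms unfolding integral_schur_algebra_iff
    by (auto simp: entry_mult entry_add entry_minus entry_uminus intro!: Ints_sum Ints_mult)
qed

lemma lincomb_closed:
  assumes "g \<in> F \<rightarrow> carrier (schur_algebra n d)"
  shows "(\<Oplus>\<^bsub>schur_algebra n d\<^esub>j\<in>F. [(c j :: int)] \<cdot>\<^bsub>schur_algebra n d\<^esub> g j) \<in> carrier (schur_algebra n d)"
proof -
  interpret ring "schur_algebra n d" by (rule ring_schur_algebra)
  show ?thesis using assms by (intro finsum_closed) (auto simp: Pi_iff intro!: add.int_pow_closed[folded add_pow_def])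
qed

lemma entry_lincomb:
  assumes "finite F" "g \<in> F \<rightarrow> carrier (schur_algebra n d)" "w \<in> words n d"
  shows "entry (\<Oplus>\<^bsub>schur_algebra n d\<^esub>j\<in>F. [(c j :: int)] \<cdot>\<^bsub>schur_algebra n d\<^esub> g j) u w =
    (\<Sum>j\<in>F. of_int (c j) * entry (g j) u w)"
proof -
  interpret ring "schur_algebra n d" by (rule ring_schur_algebra)
  have "(\<lambda>j. [(c j :: int)] \<cdot>\<^bsub>schur_algebra n d\<^esub> g j) \<in> F \<rightarrow> carrier (schur_algebra n d)"
    using assms(2) by (auto simp: Pi_iff intro!: add.int_pow_closed[folded add_pow_def])
  from entry_finsum[OF assms(1) this assms(3)] show ?thesis
    using assms by (auto simp: entry_add_pow Pi_iff intro!: sum.cong)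
qed

text \<open>The pairs (U i, V i) are test positions that together detect every element. At position
  i only \<open>y i\<close> and elements of larger degree can be nonzero, so integral entries are
  cleared from the largest degree downwards, with pivots 1 and without division.\<close>

lemma unitriangular_Z_basis:
  fixes deg :: "'i \<Rightarrow> nat"
  assumes I: "finite I" and y: "y \<in> I \<rightarrow> integral_schur_algebra n d"
    and UV: "\<And>i. i \<in> I \<Longrightarrow> U i \<in> words n d" "\<And>i. i \<in> I \<Longrightarrow> V i \<in> words n d"
    and diag: "\<And>i. i \<in> I \<Longrightarrow> entry (y i) (U i) (V i) = 1"
    and tri: "\<And>i j. i \<in> I \<Longrightarrow> j \<in> I \<Longrightarrow> i \<noteq> j \<Longrightarrow> deg j \<le> deg i \<Longrightarrow> entry (y j) (U i) (V i) = 0"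
    and sep: "\<And>x. x \<in> carrier (schur_algebra n d) \<Longrightarrow> (\<And>i. i \<in> I \<Longrightarrow> entry x (U i) (V i) = 0) \<Longrightarrow>
      x = \<zero>\<^bsub>schur_algebra n d\<^esub>"
  shows "inj_on y I" "Z_basis (schur_algebra n d) (y ` I) (integral_schur_algebra n d)"
proof -
  interpret ring "schur_algebra n d" by (rule ring_schur_algebra)
  let ?S = "schur_algebra n d"
  have yc: "y \<in> I \<rightarrow> carrier ?S" using y by (auto simp: integral_schur_algebra_iff)
  have indep: "\<forall>i\<in>I. c i = 0"
    if c: "\<And>i. i \<in> I \<Longrightarrow> (\<Sum>j\<in>I. of_int (c j) * entry (y j) (U i) (V i)) = 0" for c :: "'i \<Rightarrow> int"
  proof (rule ccontr)
    assume a: "\<not> (\<forall>i\<in>I. c i = 0)"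
    let ?J = "{i \<in> I. c i \<noteq> 0}"
    \<comment> \<open>At an index of maximal degree with nonzero coefficient no other summand
      contributes.\<close>
    have "Max (deg ` ?J) \<in> deg ` ?J" using a I by (intro Max_in) auto
    then obtain i where i: "i \<in> I" "c i \<noteq> 0" "deg i = Max (deg ` ?J)" by auto
    have "deg j \<le> deg i" if "j \<in> I" "c j \<noteq> 0" for j
      using that I i by simp
    then have "(\<Sum>j\<in>I. of_int (c j) * entry (y j) (U i) (V i)) = (\<Sum>j\<in>I. if j = i then of_int (c i) else 0)"
      using tri[OF i(1)] diag[OF i(1)] by (intro sum.cong) auto
    then show False using c[OF i(1)] i I by simp
  qed
  show inj: "inj_on y I"
  proof (rule inj_onI, rule ccontr)
    fix i j assume a: "i \<in> I" "j \<in> I" "y i = y j" "i \<noteq> j"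
    then show False
      using tri[of i j] tri[of j i] diag[of i] diag[of j] by (cases "deg j \<le> deg i") auto
  qed
  \<comment> \<open>\<open>k\<close> bounds the degrees that still have to be cleared; at
    \<open>k = 0\<close> all test entries vanish and \<open>sep\<close> applies.\<close>
  have span: "\<exists>c :: 'i \<Rightarrow> int. x = (\<Oplus>\<^bsub>?S\<^esub>j\<in>I. [c j] \<cdot>\<^bsub>?S\<^esub> y j)"
    if "x \<in> integral_schur_algebra n d" "\<And>i. i \<in> I \<Longrightarrow> deg i \<ge> k \<Longrightarrow> entry x (U i) (V i) = 0" for k x
    using that
  proof (induction k arbitrary: x)
    case 0
    then have "x = \<zero>\<^bsub>?S\<^esub>" by (intro sep) (auto simp: integral_schur_algebra_iff)
    moreover have "(\<Oplus>\<^bsub>?S\<^esub>j\<in>I. [(0::int)] \<cdot>\<^bsub>?S\<^esub> y j) = \<zero>\<^bsub>?S\<^esub>"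
      by (intro sep lincomb_closed yc) (simp add: entry_lincomb[OF I yc UV(2), where c = "\<lambda>_. 0"])
    ultimately show ?case by (intro exI[of _ "\<lambda>_. 0"]) simp
  next
    case (Suc k)
    \<comment> \<open>The entry is an integer, and the floor only converts it to type
      \<open>int\<close>. Subtracting \<open>?z\<close> clears degree k and leaves the zeros in
      larger degrees alone.\<close>
    define c where "c j = (if deg j = k then \<lfloor>entry x (U j) (V j)\<rfloor> else 0)" for j
    let ?z = "\<Oplus>\<^bsub>?S\<^esub>j\<in>I. [c j] \<cdot>\<^bsub>?S\<^esub> y j"
    have x: "x \<in> carrier ?S" and xi: "\<And>u w. u \<in> words n d \<Longrightarrow> w \<in> words n d \<Longrightarrow> entry x u w \<in> \<int>"
      using Suc.prems(1) by (auto simp: integral_schur_algebra_iff)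
    have z: "?z \<in> carrier ?S" by (rule lincomb_closed[OF yc])
    have "?z \<in> integral_schur_algebra n d"
      unfolding integral_schur_algebra_iff using z y
      by (auto simp: entry_lincomb[OF I yc] integral_schur_algebra_iff Pi_iff intro!: Ints_sum Ints_mult)
    then have x': "x \<ominus>\<^bsub>?S\<^esub> ?z \<in> integral_schur_algebra n d" using Suc.prems(1) integral_closed by blast
    have "entry (x \<ominus>\<^bsub>?S\<^esub> ?z) (U i) (V i) = 0" if i: "i \<in> I" "deg i \<ge> k" for i
    proof -
      have "(\<Sum>j\<in>I. of_int (c j) * entry (y j) (U i) (V i)) = (\<Sum>j\<in>I. if j = i then of_int (c i) else 0)"
        using tri[OF i(1)] diag[OF i(1)] i by (intro sum.cong) (auto simp: c_def)
      then have "entry (x \<ominus>\<^bsub>?S\<^esub> ?z) (U i) (V i) = entry x (U i) (V i) - of_int (c i)"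
        using i I by (simp add: entry_minus[OF x z UV(2)] entry_lincomb[OF I yc UV(2)])
      then show ?thesis
        using xi[OF UV[OF i(1)]] i Suc.prems(2)[OF i(1)] by (auto simp: c_def elim!: Ints_cases)
    qed
    then obtain c' :: "'i \<Rightarrow> int" where c': "x \<ominus>\<^bsub>?S\<^esub> ?z = (\<Oplus>\<^bsub>?S\<^esub>j\<in>I. [c' j] \<cdot>\<^bsub>?S\<^esub> y j)"
      using Suc.IH[OF x'] by blast
    have "x = (\<Oplus>\<^bsub>?S\<^esub>j\<in>I. [(c j + c' j)] \<cdot>\<^bsub>?S\<^esub> y j)"
    proof (rule schur_eqI[OF x lincomb_closed[OF yc]])
      fix u w assume w: "w \<in> words n d"
      have "entry x u w - (\<Sum>j\<in>I. of_int (c j) * entry (y j) u w) = (\<Sum>j\<in>I. of_int (c' j) * entry (y j) u w)"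
        using arg_cong[OF c', of "\<lambda>f. entry f u w"]
        by (simp add: entry_minus[OF x z w] entry_lincomb[OF I yc w])
      then show "entry x u w = entry (\<Oplus>\<^bsub>?S\<^esub>j\<in>I. [(c j + c' j)] \<cdot>\<^bsub>?S\<^esub> y j) u w"
        unfolding entry_lincomb[OF I yc w] by (simp add: distrib_right sum.distrib)
    qed
    then show ?case by (intro exI[of _ "\<lambda>j. c j + c' j"])
  qed
  show "Z_basis ?S (y ` I) (integral_schur_algebra n d)"
    unfolding Z_basis_def
  proof (intro conjI allI impI)
    show "y ` I \<subseteq> integral_schur_algebra n d" using y by blast
  next
    fix F and c :: "(tensor \<Rightarrow> tensor) \<Rightarrow> int"
    assume F: "finite F \<and> F \<subseteq> y ` I \<and> (\<Oplus>\<^bsub>?S\<^esub>b\<in>F. [c b] \<cdot>\<^bsub>?S\<^esub> b) = \<zero>\<^bsub>?S\<^esub>"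
    have Fc: "(\<lambda>b. b) \<in> F \<rightarrow> carrier ?S" using F yc by auto
    \<comment> \<open>Independence in \<open>Z_basis\<close> concerns finite sets of elements;
      extending the coefficients by zero reduces it to the family indexed by
      \<open>I\<close>.\<close>
    define c' where "c' j = (if y j \<in> F then c (y j) else 0)" for j
    have "(\<Sum>j\<in>I. of_int (c' j) * entry (y j) (U i) (V i)) = 0" if i: "i \<in> I" for i
    proof -
      have "(\<Sum>b\<in>F. of_int (c b) * entry b (U i) (V i)) = 0"
        unfolding entry_lincomb[OF conjunct1[OF F] Fc UV(2)[OF i], symmetric] conjunct2[OF conjunct2[OF F]]
        by (rule entry_zero[OF UV(2)[OF i]])
      moreover have "(\<Sum>b\<in>F. of_int (c b) * entry b (U i) (V i)) =
          (\<Sum>b\<in>y ` I. of_int (if b \<in> F then c b else 0) * entry b (U i) (V i))"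
        using F I by (intro sum.mono_neutral_cong_left) auto
      moreover have "\<dots> = (\<Sum>j\<in>I. of_int (c' j) * entry (y j) (U i) (V i))"
        by (simp add: sum.reindex[OF inj] c'_def o_def)
      ultimately show ?thesis by simp
    qed
    then have c0: "\<forall>i\<in>I. c' i = 0" by (rule indep)
    show "\<forall>b\<in>F. c b = 0"
    proof
      fix b assume b: "b \<in> F"
      then obtain i where "i \<in> I" "b = y i" using F by blast
      then show "c b = 0" using c0 b by (auto simp: c'_def)
    qed
  next
    show "\<forall>x\<in>integral_schur_algebra n d. \<exists>F c. finite F \<and> F \<subseteq> y ` I \<and>
        x = (\<Oplus>\<^bsub>?S\<^esub>b\<in>F. [(c b :: int)] \<cdot>\<^bsub>?S\<^esub> b)"
    proof
      fix x assume x: "x \<in> integral_schur_algebra n d"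
      have "\<exists>c :: 'i \<Rightarrow> int. x = (\<Oplus>\<^bsub>?S\<^esub>j\<in>I. [c j] \<cdot>\<^bsub>?S\<^esub> y j)"
      \<comment> \<open>A bound above all degrees starts the elimination, since no index reaches
        it.\<close>
      proof (rule span[OF x])
        fix i assume "i \<in> I" "Suc (Max (deg ` I)) \<le> deg i"
        moreover from this(1) have "deg i \<le> Max (deg ` I)" using I by simp
        ultimately show "entry x (U i) (V i) = 0" by simp
      qed
      then obtain c :: "'i \<Rightarrow> int" where c: "x = (\<Oplus>\<^bsub>?S\<^esub>j\<in>I. [c j] \<cdot>\<^bsub>?S\<^esub> y j)"
        by (elim exE)
      have Fc: "(\<lambda>b. b) \<in> y ` I \<rightarrow> carrier ?S" using yc by auto
      have "x = (\<Oplus>\<^bsub>?S\<^esub>b\<in>y ` I. [c (inv_into I y b)] \<cdot>\<^bsub>?S\<^esub> b)"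
      proof (rule schur_eqI)
        show "x \<in> carrier ?S" using x by (simp add: integral_schur_algebra_iff)
        show "(\<Oplus>\<^bsub>?S\<^esub>b\<in>y ` I. [c (inv_into I y b)] \<cdot>\<^bsub>?S\<^esub> b) \<in> carrier ?S"
          by (rule lincomb_closed[OF Fc])
        fix u w assume w: "w \<in> words n d"
        show "entry x u w = entry (\<Oplus>\<^bsub>?S\<^esub>b\<in>y ` I. [c (inv_into I y b)] \<cdot>\<^bsub>?S\<^esub> b) u w"
          unfolding c entry_lincomb[OF I yc w] entry_lincomb[OF finite_imageI[OF I] Fc w]
          using inj by (simp add: sum.reindex o_def)
      qed
      then show "\<exists>F c. finite F \<and> F \<subseteq> y ` I \<and> x = (\<Oplus>\<^bsub>?S\<^esub>b\<in>F. [(c b :: int)] \<cdot>\<^bsub>?S\<^esub> b)"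
        using I by (intro exI[of _ "y ` I"] exI[of _ "\<lambda>b. c (inv_into I y b)"]) auto
    qed
  qed
qed

text \<open>The orbits of the place permutations on pairs of words are the multisets of pairs of letters.\<close>

definition orbits :: "nat \<Rightarrow> nat \<Rightarrow> (nat \<times> nat) multiset set" where
  "orbits n d = {Q. size Q = d \<and> set_mset Q \<subseteq> {1..n} \<times> {1..n}}"

text \<open>Any listing of the pairs will do: its first and its second components form a pair of
  words in the orbit, which serves as test position.\<close>

definition rep :: "(nat \<times> nat) multiset \<Rightarrow> (nat \<times> nat) list" where
  "rep Q = (SOME xs. mset xs = Q)"

lemma mset_rep: "mset (rep Q) = Q"
  unfolding rep_def by (rule someI_ex) (rule ex_mset)

lemma finite_orbits: "finite (orbits n d)"
proof (rule finite_subset)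
  show "orbits n d \<subseteq> mset ` {xs. set xs \<subseteq> {1..n} \<times> {1..n} \<and> length xs = d}"
  proof
    fix Q assume "Q \<in> orbits n d"
    moreover have "set (rep Q) = set_mset Q" "length (rep Q) = size Q"
      by (metis mset_rep set_mset_mset) (metis mset_rep size_mset)
    ultimately show "Q \<in> mset ` {xs. set xs \<subseteq> {1..n} \<times> {1..n} \<and> length xs = d}"
      using mset_rep[of Q] by (intro image_eqI[of _ _ "rep Q"]) (auto simp: orbits_def)
  qed
  show "finite (mset ` {xs. set xs \<subseteq> {1..n} \<times> {1..n} \<and> length xs = d})"
    by (intro finite_imageI finite_lists_length_eq) auto
qed

lemma rep_words:
  assumes "Q \<in> orbits n d"
  shows "map fst (rep Q) \<in> words n d" "map snd (rep Q) \<in> words n d"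
proof -
  have "set (rep Q) = set_mset Q" "length (rep Q) = size Q"
    by (metis mset_rep set_mset_mset) (metis mset_rep size_mset)
  then show "map fst (rep Q) \<in> words n d" "map snd (rep Q) \<in> words n d"
    using assms by (auto simp: words_def orbits_def)
qed

lemma moves_eq_filter:
  assumes "length u = length w"
  shows "moves u w = filter_mset (\<lambda>(a, b). a \<noteq> b) (mset (zip u w))"
proof -
  have "mset (zip u w) = image_mset (\<lambda>p. (u ! p, w ! p)) (mset_set {..<length u})"
  proof -
    have "zip u w = map (\<lambda>p. (u ! p, w ! p)) [0..<length u]"
      using assms by (intro nth_equalityI) auto
    then have "mset (zip u w) = image_mset (\<lambda>p. (u ! p, w ! p)) (mset [0..<length u])"
      by (simp only: mset_map)
    then show ?thesis by (simp add: atLeast0LessThan)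
  qed
  then show ?thesis by (simp add: moves_def filter_mset_image_mset diff_places_def)
qed

lemma moves_rep: "moves (map fst (rep Q)) (map snd (rep Q)) = filter_mset (\<lambda>(a, b). a \<noteq> b) Q"
  by (simp add: moves_eq_filter zip_map_fst_snd mset_rep)

text \<open>The pairs of letters of u and w are a rearrangement of the chosen listing of their
  orbit, so by \<open>entry_permute\<close> every entry equals one at a representative.\<close>

lemma entries_rep_zero:
  assumes f: "f \<in> carrier (schur_algebra n d)"
    and z: "\<And>Q. Q \<in> orbits n d \<Longrightarrow> entry f (map fst (rep Q)) (map snd (rep Q)) = 0"
  shows "f = \<zero>\<^bsub>schur_algebra n d\<^esub>"
proof (rule schur_eqI[OF f])
  interpret ring "schur_algebra n d" by (rule ring_schur_algebra)
  show "\<zero>\<^bsub>schur_algebra n d\<^esub> \<in> carrier (schur_algebra n d)" by simp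
  fix u w assume uw: "u \<in> words n d" "w \<in> words n d"
  then have l: "length u = d" "length w = d" by (auto simp: words_def)
  define Q where "Q = mset (zip u w)"
  have Q: "Q \<in> orbits n d"
    using uw by (auto simp: Q_def orbits_def words_def elim!: in_set_zipE)
  obtain \<sigma> where s: "\<sigma> permutes {..<length (zip u w)}" "permute_list \<sigma> (zip u w) = rep Q"
    using mset_eq_permutation[of "rep Q" "zip u w"] mset_rep[of Q] Q_def by metis
  then have sd: "\<sigma> permutes {..<d}" using l by simp
  have "rep Q = zip (permute_list \<sigma> u) (permute_list \<sigma> w)"
    unfolding s(2)[symmetric] by (rule permute_list_zip[OF sd]) (simp_all add: l)
  then have "map fst (rep Q) = permute_list \<sigma> u" "map snd (rep Q) = permute_list \<sigma> w"
    using l by simp_all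
  then show "entry f u w = entry \<zero>\<^bsub>schur_algebra n d\<^esub> u w"
    using entry_permute[OF f sd uw(2) l(1)] z[OF Q] uw by (simp add: entry_zero)
qed

section \<open>The family of elements indexed by orbits\<close>

lemma count_total_moves:
  "distinct rl \<Longrightarrow> count (total_moves (map (\<lambda>\<alpha>. (\<alpha>, f \<alpha>)) rl)) \<beta> = (if \<beta> \<in> set rl then f \<beta> else 0)"
  by (induction rl) auto

lemma count_image_mset_sum:
  assumes "finite A" "set_mset Q \<subseteq> A"
  shows "count (image_mset g Q) k = (\<Sum>q\<in>{q \<in> A. g q = k}. count Q q)"
proof -
  have "count (image_mset g Q) k = (\<Sum>q\<in>{q \<in> set_mset Q. g q = k}. count Q q)"
    by (simp add: count_image_mset Int_def vimage_def conj_commute)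
  also have "\<dots> = (\<Sum>q\<in>{q \<in> A. g q = k}. count Q q)"
    using assms by (intro sum.mono_neutral_left) (auto simp: count_eq_zero_iff)
  finally show ?thesis .
qed

definition exps :: "(nat \<times> nat) list \<Rightarrow> (nat \<times> nat \<Rightarrow> nat) \<Rightarrow> ((nat \<times> nat) \<times> nat) list" where
  "exps rl f = map (\<lambda>\<alpha>. (\<alpha>, f \<alpha>)) rl"

text \<open>The list \<open>rl1\<close> contains the roots whose divided powers stand to the left of the idempotent, and \<open>rl2\<close>
  contains the others.\<close>

locale root_split =
  fixes n d :: nat and rl1 rl2 :: "(nat \<times> nat) list"
  assumes distinct: "distinct (rl1 @ rl2)" and all_roots: "set (rl1 @ rl2) = roots n"
begin

text \<open>If \<open>(a, b)\<close> are the letters of \<open>u\<close> and \<open>w\<close> in some place and \<open>v\<close> is the word on which the idempotent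
  acts in the leading term, then \<open>mid (a, b)\<close> is the letter of \<open>v\<close> in this place.\<close>

definition mid :: "nat \<times> nat \<Rightarrow> nat" where
  "mid = (\<lambda>(a, b). if (a, b) \<in> set rl1 then b else a)"

text \<open>One function f on all roots replaces the two exponent families A and C. Then
  \<open>Y_plus_part\<close> and \<open>Y_minus_part\<close> are treated alike: they differ only in
  which roots stand on the left.\<close>

definition elt :: "(nat \<Rightarrow> nat) \<Rightarrow> (nat \<times> nat \<Rightarrow> nat) \<Rightarrow> tensor \<Rightarrow> tensor" where
  "elt \<mu> f = val n d (power_word (exps rl1 f) @ idem_word n \<mu> @ power_word (exps rl2 f))"

text \<open>The weight of the middle word in the leading term, restricted because weights are
  extensional functions.\<close>

definition mid_weight :: "(nat \<times> nat) multiset \<Rightarrow> nat \<Rightarrow> nat" where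
  "mid_weight Q = (\<lambda>k\<in>{1..n}. count (image_mset mid Q) k)"

text \<open>Only the off-diagonal multiplicities serve as exponents; the diagonal ones enter through
  the weight.\<close>

definition orbit_elt :: "(nat \<times> nat) multiset \<Rightarrow> tensor \<Rightarrow> tensor" where
  "orbit_elt Q = elt (mid_weight Q) (count Q)"

abbreviation off :: "(nat \<times> nat) multiset \<Rightarrow> (nat \<times> nat) multiset" where
  "off Q \<equiv> filter_mset (\<lambda>(a, b). a \<noteq> b) Q"

lemma exps_simps: "map fst (exps rl f) = rl" "fst ` set (exps rl f) = set rl"
  by (auto simp: exps_def o_def image_image)

lemma mid_range: "q \<in> {1..n} \<times> {1..n} \<Longrightarrow> mid q \<in> {1..n}"
  by (auto simp: mid_def)

lemma mid_diagonal: "mid (a, a) = a"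
  by (simp add: mid_def)

lemma total_moves_exps:
  assumes "Q \<in> orbits n d"
  shows "total_moves (exps rl1 (count Q)) + total_moves (exps rl2 (count Q)) = off Q"
proof (rule multiset_eqI)
  fix \<beta>
  have d: "distinct rl1" "distinct rl2" "set rl1 \<inter> set rl2 = {}" using distinct by auto
  have "count Q \<beta> = 0" if "\<beta> \<notin> roots n" "fst \<beta> \<noteq> snd \<beta>"
  proof -
    have "\<beta> \<notin># Q" using that assms by (cases \<beta>) (auto simp: orbits_def roots_def)
    then show ?thesis by (simp add: not_in_iff)
  qed
  moreover have "fst \<beta> \<noteq> snd \<beta>" if "\<beta> \<in> roots n" using that by (auto simp: roots_def)
  moreover have "\<beta> \<in> roots n \<longleftrightarrow> \<beta> \<in> set rl1 \<or> \<beta> \<in> set rl2" using all_roots by auto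
  ultimately show "count (total_moves (exps rl1 (count Q)) + total_moves (exps rl2 (count Q))) \<beta> = count (off Q) \<beta>"
    using d by (auto simp: exps_def count_total_moves split: prod.splits)
qed

lemma mid_weight_weights:
  assumes "Q \<in> orbits n d"
  shows "mid_weight Q \<in> weights n d"
proof -
  have "set_mset (image_mset mid Q) \<subseteq> {1..n}" using assms mid_range by (auto simp: orbits_def)
  then have "(\<Sum>k\<in>{1..n}. count (image_mset mid Q) k) = (\<Sum>k\<in>set_mset (image_mset mid Q). count (image_mset mid Q) k)"
    by (intro sum.mono_neutral_right) (auto simp: count_eq_zero_iff)
  also have "\<dots> = d" using assms by (simp only: size_multiset_overloaded_eq[symmetric] size_image_mset orbits_def mem_Collect_eq)
  finally show ?thesis by (simp add: weights_def mid_weight_def)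
qed

text \<open>A root of \<open>rl1\<close> is among the left moves only if its exponent is positive,
  which is so for every pair that occurs in Q. Hence the middle word arises by applying
  \<open>mid\<close> in each place.\<close>

lemma count_partial_moves_rep:
  "count_list (partial_moves (set_mset (total_moves (exps rl1 (count Q)))) (map fst (rep Q)) (map snd (rep Q))) k =
    count (image_mset mid Q) k"
proof -
  have d: "distinct rl1" using distinct by simp
  have "q \<in># total_moves (exps rl1 (count Q)) \<longleftrightarrow> q \<in> set rl1" if "q \<in># Q" for q
    using that by (simp add: count_greater_zero_iff[symmetric] exps_def count_total_moves[OF d] del: count_greater_zero_iff)
  moreover have "set (rep Q) = set_mset Q" by (metis mset_rep set_mset_mset)
  ultimately have "partial_moves (set_mset (total_moves (exps rl1 (count Q)))) (map fst (rep Q)) (map snd (rep Q)) =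
      map mid (rep Q)"
    unfolding partial_moves_def zip_map_fst_snd by (intro map_cong) (auto simp: mid_def)
  moreover have "count_list xs k = count (mset xs) k" for xs by (induction xs) auto
  ultimately show ?thesis by (simp add: mset_rep)
qed

text \<open>Since \<open>mid (a, a) = a\<close>, subtracting the contribution of the off-diagonal
  pairs from the middle weight leaves the multiplicities of the diagonal pairs.\<close>

lemma orbit_determined:
  assumes "Q \<in> orbits n d" "Q' \<in> orbits n d" and off: "off Q = off Q'"
    and mid: "\<And>k. k \<in> {1..n} \<Longrightarrow> count (image_mset mid Q) k = count (image_mset mid Q') k"
  shows "Q = Q'"
proof -
  let ?diag = "\<lambda>Q. filter_mset (\<lambda>q. \<not> (case q of (a, b) \<Rightarrow> a \<noteq> b)) Q"
  have diag: "image_mset (\<lambda>a. (a, a)) (image_mset mid (?diag Q)) = ?diag Q" for Q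
  proof -
    have "image_mset ((\<lambda>a. (a, a)) \<circ> mid) (?diag Q) = image_mset id (?diag Q)"
      by (intro image_mset_cong) (auto simp: mid_def)
    then show ?thesis by (simp add: image_mset.compositionality)
  qed
  have "image_mset mid Q = image_mset mid Q'"
  proof (rule multiset_eqI)
    fix k
    show "count (image_mset mid Q) k = count (image_mset mid Q') k"
    proof (cases "k \<in> {1..n}")
      case False
      then have "k \<notin># image_mset mid Q" "k \<notin># image_mset mid Q'"
        using assms(1,2) mid_range by (auto simp: orbits_def)
      then show ?thesis by (simp only: not_in_iff)
    qed (rule mid)
  qed
  moreover have "image_mset mid Q = image_mset mid (off Q) + image_mset mid (?diag Q)" for Q
    by (simp only: image_mset_union[symmetric] multiset_partition[symmetric])
  ultimately have "image_mset mid (off Q) + image_mset mid (?diag Q) =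
      image_mset mid (off Q') + image_mset mid (?diag Q')" by metis
  then have "image_mset mid (?diag Q) = image_mset mid (?diag Q')"
    unfolding off by (rule add_left_imp_eq)
  then have "?diag Q = ?diag Q'" using diag[of Q] diag[of Q'] by argo
  then show ?thesis
    using off multiset_partition[of Q "\<lambda>(a, b). a \<noteq> b"] multiset_partition[of Q' "\<lambda>(a, b). a \<noteq> b"] by argo
qed

lemma roots_facts:
  "distinct (map fst (exps rl1 f))" "fst ` set (exps rl1 f) \<subseteq> roots n"
  "distinct (map fst (exps rl2 f))" "fst ` set (exps rl2 f) \<subseteq> roots n"
  "fst ` set (exps rl1 f) \<inter> fst ` set (exps rl2 f) = {}"
  using distinct all_roots by (auto simp: exps_simps)

text \<open>A nonzero entry at the representative of Q bounds the degree of Q by that of Q'. Under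
  the reverse inequality the leading term applies: the off-diagonal parts agree and the middle word
  has the middle weight of Q', hence Q = Q' by \<open>orbit_determined\<close>.\<close>

lemma orbit_elt_unitriangular:
  assumes Q: "Q \<in> orbits n d" and Q': "Q' \<in> orbits n d"
  shows "entry (orbit_elt Q) (map fst (rep Q)) (map snd (rep Q)) = 1"
    and "Q \<noteq> Q' \<Longrightarrow> size (off Q') \<le> size (off Q) \<Longrightarrow>
      entry (orbit_elt Q') (map fst (rep Q)) (map snd (rep Q)) = 0"
proof -
  note E = entry_power_idem_power[OF roots_facts mid_weight_weights rep_words[OF Q],
      folded elt_def, folded orbit_elt_def]
  have s: "size (total_moves (exps rl1 (count Q))) + size (total_moves (exps rl2 (count Q))) = size (off Q)"
    if "Q \<in> orbits n d" for Q
    using total_moves_exps[OF that] by (metis size_union)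
  show "entry (orbit_elt Q) (map fst (rep Q)) (map snd (rep Q)) = 1"
    using E(2)[OF Q, of "count Q", folded orbit_elt_def] s[OF Q] total_moves_exps[OF Q]
    by (simp add: moves_rep count_partial_moves_rep mid_weight_def)
  assume ne: "Q \<noteq> Q'" and le: "size (off Q') \<le> size (off Q)"
  show "entry (orbit_elt Q') (map fst (rep Q)) (map snd (rep Q)) = 0"
  proof (rule ccontr)
    assume nz: "entry (orbit_elt Q') (map fst (rep Q)) (map snd (rep Q)) \<noteq> 0"
    have "size (off Q) \<le> size (off Q')"
      using E(1)[OF Q', of "count Q'", folded orbit_elt_def, OF nz] s[OF Q'] by (simp add: moves_rep)
    then have "size (off Q) = size (off Q')" using le by simp
    then have o: "off Q = off Q'"
      and w: "\<forall>i\<in>{1..n}. count_list (partial_moves (set_mset (total_moves (exps rl1 (count Q'))))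
        (map fst (rep Q)) (map snd (rep Q))) i = mid_weight Q' i"
      using E(2)[OF Q', of "count Q'", folded orbit_elt_def] nz s[OF Q'] total_moves_exps[OF Q']
      by (auto simp: moves_rep split: if_splits)
    have d: "distinct rl1" using distinct by simp
    \<comment> \<open>The middle word above is formed with the left moves of Q'; they have to be
      those of Q before \<open>count_partial_moves_rep\<close> applies.\<close>
    have "total_moves (exps rl1 (count Q')) = total_moves (exps rl1 (count Q))"
    proof (rule multiset_eqI)
      fix \<beta>
      have "count Q' \<beta> = count Q \<beta>" if "\<beta> \<in> set rl1"
      proof -
        have "\<beta> \<in> roots n" using that all_roots by auto
        then have "fst \<beta> \<noteq> snd \<beta>" by (auto simp: roots_def)
        then show ?thesis using arg_cong[OF o, of "\<lambda>M. count M \<beta>"] by (simp split: prod.splits)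
      qed
      then show "count (total_moves (exps rl1 (count Q'))) \<beta> = count (total_moves (exps rl1 (count Q))) \<beta>"
        by (simp add: exps_def count_total_moves[OF d])
    qed
    then have "count (image_mset mid Q) k = count (image_mset mid Q') k" if "k \<in> {1..n}" for k
      using w that count_partial_moves_rep[of Q k] by (simp add: mid_weight_def)
    then show False using orbit_determined[OF Q Q' o] ne by blast
  qed
qed

text \<open>The content condition in terms of middle letters; it becomes the one with
  \<open>max\<close> or \<open>min\<close> once \<open>mid\<close> is identified.\<close>

definition part :: "(nat \<Rightarrow> nat) \<Rightarrow> (tensor \<Rightarrow> tensor) set" where
  "part \<mu> = {elt \<mu> f | f. \<forall>k\<in>{1..n}. (\<Sum>\<alpha>\<in>{\<alpha> \<in> roots n. mid \<alpha> = k}. f \<alpha>) \<le> \<mu> k}"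

lemma finite_roots: "finite (roots n)"
  by (rule finite_subset[of _ "{1..n} \<times> {1..n}"]) (auto simp: roots_def)

lemma mid_fibre:
  assumes "k \<in> {1..n}"
  shows "{q \<in> {1..n} \<times> {1..n}. mid q = k} = insert (k, k) {\<alpha> \<in> roots n. mid \<alpha> = k}"
    "(k, k) \<notin> {\<alpha> \<in> roots n. mid \<alpha> = k}"
  using assms by (auto simp: roots_def mid_diagonal)

text \<open>The slack in the condition for k is the multiplicity of the pair (k, k), so admissible
  exponents on the roots and orbits of middle weight \<mu> determine each other.\<close>

lemma part_eq:
  assumes \<mu>: "\<mu> \<in> weights n d"
  shows "part \<mu> = orbit_elt ` {Q \<in> orbits n d. mid_weight Q = \<mu>}"
proof (intro equalityI subsetI)
  fix x assume "x \<in> orbit_elt ` {Q \<in> orbits n d. mid_weight Q = \<mu>}"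
  then obtain Q where Q: "Q \<in> orbits n d" "mid_weight Q = \<mu>" "x = orbit_elt Q" by auto
  have "(\<Sum>\<alpha>\<in>{\<alpha> \<in> roots n. mid \<alpha> = k}. count Q \<alpha>) \<le> \<mu> k" if k: "k \<in> {1..n}" for k
  proof -
    have \<mu>k: "\<mu> k = (\<Sum>q\<in>{q \<in> {1..n} \<times> {1..n}. mid q = k}. count Q q)"
      using Q k count_image_mset_sum[of "{1..n} \<times> {1..n}" Q mid k] by (auto simp: mid_weight_def orbits_def)
    show ?thesis unfolding \<mu>k mid_fibre(1)[OF k] using finite_roots mid_fibre(2)[OF k] by simp
  qed
  then show "x \<in> part \<mu>" using Q by (auto simp: part_def orbit_elt_def)
next
  fix x assume "x \<in> part \<mu>"
  then obtain f where f: "x = elt \<mu> f"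
    and le: "\<And>k. k \<in> {1..n} \<Longrightarrow> (\<Sum>\<alpha>\<in>{\<alpha> \<in> roots n. mid \<alpha> = k}. f \<alpha>) \<le> \<mu> k"
    by (auto simp: part_def)
  \<comment> \<open>The multiplicities of the orbit to be found: exponents off the diagonal, the
    slack on it.\<close>
  define h where "h q = (if fst q = snd q
      then \<mu> (fst q) - (\<Sum>\<alpha>\<in>{\<alpha> \<in> roots n. mid \<alpha> = fst q}. f \<alpha>) else f q)" for q
  \<comment> \<open>Every pair of letters is listed once, so that \<open>count_total_moves\<close>
    yields a multiset with prescribed multiplicities.\<close>
  let ?l = "rl1 @ rl2 @ map (\<lambda>k. (k, k)) [1..<n + 1]"
  define Q where "Q = total_moves (map (\<lambda>\<alpha>. (\<alpha>, h \<alpha>)) ?l)"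
  have r: "\<alpha> \<in> roots n" if "\<alpha> \<in> set rl1 \<or> \<alpha> \<in> set rl2" for \<alpha> using that all_roots by auto
  have set_l: "set ?l = {1..n} \<times> {1..n}"
  proof -
    have "set ?l = roots n \<union> (\<lambda>k. (k, k)) ` {1..n}" using all_roots by auto
    also have "\<dots> = {1..n} \<times> {1..n}" by (auto simp: roots_def)
    finally show ?thesis .
  qed
  have dl: "distinct ?l" using distinct r by (auto simp: distinct_map inj_on_def roots_def)
  have count: "count Q \<beta> = (if \<beta> \<in> {1..n} \<times> {1..n} then h \<beta> else 0)" for \<beta>
    unfolding Q_def count_total_moves[OF dl] set_l by (rule refl)
  have sub: "set_mset Q \<subseteq> {1..n} \<times> {1..n}"
    using count by (metis count_eq_zero_iff subsetI)
  have cm: "count (image_mset mid Q) k = \<mu> k" if k: "k \<in> {1..n}" for k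
  proof -
    have "count (image_mset mid Q) k = (\<Sum>q\<in>{q \<in> {1..n} \<times> {1..n}. mid q = k}. count Q q)"
      using sub by (intro count_image_mset_sum) auto
    also have "\<dots> = h (k, k) + (\<Sum>\<alpha>\<in>{\<alpha> \<in> roots n. mid \<alpha> = k}. count Q \<alpha>)"
      unfolding mid_fibre(1)[OF k] using finite_roots mid_fibre(2)[OF k] k by (simp add: count)
    also have "(\<Sum>\<alpha>\<in>{\<alpha> \<in> roots n. mid \<alpha> = k}. count Q \<alpha>) = (\<Sum>\<alpha>\<in>{\<alpha> \<in> roots n. mid \<alpha> = k}. f \<alpha>)"
      by (intro sum.cong) (auto simp: count h_def roots_def)
    finally show ?thesis using le[OF k] by (simp add: h_def)
  qed
  have mw: "mid_weight Q = \<mu>"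
    using \<mu> cm by (intro extensionalityI[of _ "{1..n}"]) (auto simp: mid_weight_def weights_def PiE_def)
  have "size Q = size (image_mset mid Q)" by simp
  also have "\<dots> = (\<Sum>k\<in>set_mset (image_mset mid Q). count (image_mset mid Q) k)"
    by (rule size_multiset_overloaded_eq)
  also have "\<dots> = (\<Sum>k\<in>{1..n}. count (image_mset mid Q) k)"
    using sub mid_range by (intro sum.mono_neutral_left) (auto simp: count_eq_zero_iff)
  also have "\<dots> = d" using cm \<mu> by (simp add: weights_def)
  finally have Q: "Q \<in> orbits n d" using sub by (simp add: orbits_def)
  have "count Q \<alpha> = f \<alpha>" if "\<alpha> \<in> set rl1 \<or> \<alpha> \<in> set rl2" for \<alpha>
    using r[OF that] by (auto simp: count h_def roots_def)
  then have "exps rl1 (count Q) = exps rl1 f" "exps rl2 (count Q) = exps rl2 f"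
    by (simp_all add: exps_def)
  then have "x = orbit_elt Q" using f by (simp add: orbit_elt_def elt_def mw)
  then show "x \<in> orbit_elt ` {Q \<in> orbits n d. mid_weight Q = \<mu>}" using Q mw by blast
qed

lemma Union_parts: "(\<Union>\<mu>\<in>weights n d. part \<mu>) = orbit_elt ` orbits n d"
  using mid_weight_weights by (auto simp: part_eq)

lemma parts_basis:
  assumes "\<And>Q. Q \<in> orbits n d \<Longrightarrow> orbit_elt Q \<in> integral_schur_algebra n d"
  shows "disjoint_family_on part (weights n d)"
    and "Z_basis (schur_algebra n d) (\<Union>\<mu>\<in>weights n d. part \<mu>) (integral_schur_algebra n d)"
proof -
  have y: "orbit_elt \<in> orbits n d \<rightarrow> integral_schur_algebra n d" using assms by blast
  note B = unitriangular_Z_basis[where deg = "\<lambda>Q. size (off Q)", OF finite_orbits y rep_words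
      orbit_elt_unitriangular(1) orbit_elt_unitriangular(2) entries_rep_zero]
  show "Z_basis (schur_algebra n d) (\<Union>\<mu>\<in>weights n d. part \<mu>) (integral_schur_algebra n d)"
    unfolding Union_parts by (rule B(2)) assumption+
  \<comment> \<open>The parts are the images of the fibres of \<open>mid_weight\<close>, so
    injectivity makes them disjoint.\<close>
  have "inj_on orbit_elt (orbits n d)" by (rule B(1)) assumption+
  then show "disjoint_family_on part (weights n d)"
    unfolding disjoint_family_on_def by (auto simp: part_eq dest: inj_onD)
qed

end

section \<open>Commutation formulas\<close>

text \<open>The sum of the matrices of all orbits with off-diagonal part E. For m copies of one root
  it is the divided power of the root vector, so products become numbers of middle words.\<close>

definition moves_matrix :: "(nat \<times> nat) multiset \<Rightarrow> nat list \<Rightarrow> nat list \<Rightarrow> rat" where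
  "moves_matrix E u w = of_bool (moves u w = E)"

definition places :: "nat \<Rightarrow> nat \<Rightarrow> nat list \<Rightarrow> nat list \<Rightarrow> nat set" where
  "places a b u w = {k. k < length u \<and> u ! k = a \<and> w ! k = b}"

lemma finite_places [simp]: "finite (places a b u w)"
  by (simp add: places_def)

lemma count_moves: "a \<noteq> b \<Longrightarrow> count (moves u w) (a, b) = card (places a b u w)"
  by (auto simp: moves_def count_image_mset places_def diff_places_def intro!: arg_cong[of _ _ card])

text \<open>No move of E1 ends in a letter where a move of E2 starts, so no place changes twice and
  the moves add up; as the supports are disjoint, the middle word is unique.\<close>

lemma moves_matrix_mult:
  assumes disj: "set_mset E1 \<inter> set_mset E2 = {}"
    and no_cascade: "\<And>a b c e. (a, b) \<in># E1 \<Longrightarrow> (c, e) \<in># E2 \<Longrightarrow> b \<noteq> c"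
    and u: "u \<in> words n d" and w: "w \<in> words n d"
  shows "(\<Sum>v\<in>words n d. moves_matrix E1 u v * moves_matrix E2 v w) = moves_matrix (E1 + E2) u w"
proof (cases "moves u w = E1 + E2")
  case True
  have "leading n d (moves_matrix E) E" for E by (auto simp: leading_def moves_matrix_def)
  from leading_sandwich(2)[OF this this disj u w, where Q = "\<lambda>v. True"] show ?thesis
    using True by (simp add: moves_matrix_def)
next
  case False
  have "moves u v \<noteq> E1 \<or> moves v w \<noteq> E2" if v: "v \<in> words n d" for v
  proof (rule ccontr)
    assume a: "\<not> (moves u v \<noteq> E1 \<or> moves v w \<noteq> E2)"
    have "diff_places u v \<inter> diff_places v w = {}"
    proof (rule ccontr)
      assume "diff_places u v \<inter> diff_places v w \<noteq> {}"
      then obtain k where k: "k \<in> diff_places u v" "k \<in> diff_places v w" by blast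
      then have "(u ! k, v ! k) \<in># E1" "(v ! k, w ! k) \<in># E2"
        using a set_moves[of u v] set_moves[of v w] by auto
      then show False using no_cascade by blast
    qed
    then show False using moves_add(2)[of u v w] a False u v by (simp add: words_def)
  qed
  then show ?thesis using False by (auto simp: moves_matrix_def intro!: sum.neutral)
qed

lemma sum_moves_matrix_mult:
  "(\<Sum>v\<in>words n d. moves_matrix E1 u v * moves_matrix E2 v w) =
    of_nat (card {v \<in> words n d. moves u v = E1 \<and> moves v w = E2})"
  by (simp only: moves_matrix_def of_bool_conj[symmetric] sum_of_bool_card finite_words)

text \<open>A place with letters (i, j) changes in the first step only, and one with (j, i) in the
  second only. Among the places with (i, i), any subset of the size needed to reach m may go to j
  and back; its choice is the binomial coefficient.\<close>

lemma card_up_down: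
  assumes ij: "j \<in> {1..n}" "i \<noteq> j" and u: "u \<in> words n d" and w: "w \<in> words n d"
  shows "card {v \<in> words n d. moves u v = replicate_mset m (i, j) \<and> moves v w = replicate_mset m (j, i)} =
    (if (\<forall>k\<in>diff_places u w. (u ! k, w ! k) \<in> {(i, j), (j, i)}) \<and>
        card (places i j u w) = card (places j i u w) \<and> card (places i j u w) \<le> m
     then card (places i i u w) choose (m - card (places i j u w)) else 0)"
proof -
  let ?V = "{v \<in> words n d. moves u v = replicate_mset m (i, j) \<and> moves v w = replicate_mset m (j, i)}"
  let ?A = "places i j u w" and ?B = "places j i u w" and ?C = "places i i u w"
  let ?X = "(\<forall>k\<in>diff_places u w. (u ! k, w ! k) \<in> {(i, j), (j, i)}) \<and> card ?A = card ?B \<and> card ?A \<le> m"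
  \<comment> \<open>T stands for the set of places that go from i to j and back.\<close>
  define h where "h T = map (\<lambda>k. if k \<in> ?A \<union> T then j else u ! k) [0..<d]" for T
  have l: "length u = d" "length w = d" using u w by (auto simp: words_def)
  have A: "?X \<and> (\<exists>T. T \<subseteq> ?C \<and> card T = m - card ?A \<and> v = h T)" if v: "v \<in> ?V" for v
  proof -
    define T where "T = {k \<in> ?C. v ! k = j}"
    have lv: "length v = d" using v by (auto simp: words_def)
    have up: "u ! k = v ! k \<or> u ! k = i \<and> v ! k = j" if "k < d" for k
      using v that l by (auto simp: moves_replicate_iff diff_places_def)
    have down: "v ! k = w ! k \<or> v ! k = j \<and> w ! k = i" if "k < d" for k
      using v that lv by (auto simp: moves_replicate_iff diff_places_def)
    have D: "diff_places u v = ?A \<union> T" "diff_places v w = ?B \<union> T"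
      using up down ij l lv by (fastforce simp: diff_places_def places_def T_def)+
    have dj: "?A \<inter> T = {}" "?B \<inter> T = {}" and fT: "finite T" using ij by (auto simp: places_def T_def)
    have "card (diff_places u v) = m" "card (diff_places v w) = m"
      using v by (auto simp: moves_replicate_iff)
    then have c: "card ?A + card T = m" "card ?B + card T = m"
      using dj fT by (simp_all add: D card_Un_disjoint)
    have "\<forall>k\<in>diff_places u w. (u ! k, w ! k) \<in> {(i, j), (j, i)}"
      using up down l by (fastforce simp: diff_places_def)
    moreover have "v = h T"
    proof (rule nth_equalityI)
      fix k assume "k < length v"
      then show "v ! k = h T ! k"
        using up[of k] down[of k] ij l lv by (auto simp: h_def places_def T_def)
    qed (simp add: h_def lv)
    moreover have "T \<subseteq> ?C" by (auto simp: T_def)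
    moreover have "card T = m - card ?A" using c by simp
    ultimately show ?thesis using c by auto
  qed
  show ?thesis
  proof (cases ?X)
    case True
    let ?TT = "{T. T \<subseteq> ?C \<and> card T = m - card ?A}"
    have "h T \<in> ?V" if T: "T \<in> ?TT" for T
    proof -
      have fT: "finite T" using T finite_subset[OF _ finite_places] by blast
      have hk: "h T ! k = (if k \<in> ?A \<union> T then j else u ! k)" if "k < d" for k
        using that by (simp add: h_def)
      have TC: "u ! k = i" "w ! k = i" "k < d" if "k \<in> T" for k using T that l by (auto simp: places_def)
      have lh: "length (h T) = d" by (simp add: h_def)
      have uw: "u ! k = w ! k \<or> k \<in> ?A \<or> k \<in> ?B" if "k < d" for k
        using True that l by (auto simp: diff_places_def places_def)
      have D: "diff_places u (h T) = ?A \<union> T"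
      proof (intro equalityI subsetI)
        fix k assume "k \<in> diff_places u (h T)"
        then show "k \<in> ?A \<union> T" using hk[of k] l by (simp add: diff_places_def split: if_splits)
      next
        fix k assume k: "k \<in> ?A \<union> T"
        then have "k < d" "u ! k = i" using TC[of k] l by (auto simp: places_def)
        then show "k \<in> diff_places u (h T)" using hk[of k] k ij l by (simp add: diff_places_def)
      qed
      have D': "diff_places (h T) w = ?B \<union> T"
      proof (intro equalityI subsetI)
        fix k assume "k \<in> diff_places (h T) w"
        then show "k \<in> ?B \<union> T" using uw[of k] by (auto simp: diff_places_def hk lh places_def split: if_splits)
      next
        fix k assume "k \<in> ?B \<union> T"
        then show "k \<in> diff_places (h T) w" using TC ij l by (auto simp: diff_places_def hk lh places_def)
      qed
      have "?A \<inter> ?C = {}" "?B \<inter> ?C = {}" using ij by (auto simp: places_def)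
      then have dj: "?A \<inter> T = {}" "?B \<inter> T = {}" using T by blast+
      have "h T \<in> words n d" using u ij words_nth[OF u] by (auto simp: words_def h_def)
      moreover have "moves u (h T) = replicate_mset m (i, j)"
        unfolding moves_replicate_iff D
      proof (intro conjI ballI)
        show "card (?A \<union> T) = m" using dj fT T True by (simp add: card_Un_disjoint)
        fix k assume k: "k \<in> ?A \<union> T"
        then have "k < d" "u ! k = i" using TC[of k] l by (auto simp: places_def)
        then show "(u ! k, h T ! k) = (i, j)" using hk[of k] k by simp
      qed
      moreover have "moves (h T) w = replicate_mset m (j, i)"
        unfolding moves_replicate_iff D'
      proof (intro conjI ballI)
        show "card (?B \<union> T) = m" using dj fT T True by (simp add: card_Un_disjoint)
        fix k assume k: "k \<in> ?B \<union> T"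
        then have "k < d" "w ! k = i" "k \<in> T \<or> u ! k = j" using TC[of k] l by (auto simp: places_def)
        then show "(h T ! k, w ! k) = (j, i)" using hk[of k] by auto
      qed
      ultimately show ?thesis by simp
    qed
    then have "?V = h ` ?TT" using A by blast
    moreover have "inj_on h ?TT"
    proof (rule inj_on_inverseI)
      fix T assume "T \<in> ?TT"
      then show "{k \<in> ?C. h T ! k = j} = T" using ij l by (auto simp: h_def places_def split: if_splits)
    qed
    ultimately have "card ?V = card ?TT" by (simp add: card_image)
    also have "\<dots> = card ?C choose (m - card ?A)" by (simp add: n_subsets)
    finally show ?thesis unfolding if_P[OF True] .
  next
    case False
    then have "?V = {}" using A by blast
    then show ?thesis unfolding if_not_P[OF False] by (simp only: card.empty)
  qed
qed

lemma count_list_places: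
  assumes u: "u \<in> words n d" and w: "w \<in> words n d" and ij: "i \<noteq> j"
    and D: "\<forall>k\<in>diff_places u w. (u ! k, w ! k) \<in> {(i, j), (j, i)}"
  shows "count_list w i = card (places i i u w) + card (places j i u w)"
proof -
  have l: "length u = d" "length w = d" using u w by (auto simp: words_def)
  have "count_list w i = card {k. k < d \<and> w ! k = i}"
    unfolding count_list_eq_length_filter length_filter_conv_card l by (simp add: eq_commute)
  also have "{k. k < d \<and> w ! k = i} = places i i u w \<union> places j i u w"
    using D l by (auto simp: places_def diff_places_def)
  also have "card \<dots> = card (places i i u w) + card (places j i u w)"
    using ij by (intro card_Un_disjoint) (auto simp: places_def)
  finally show ?thesis .
qed

text \<open>The identity \<open>e\<^sup>(\<^sup>m\<^sup>) f\<^sup>(\<^sup>m\<^sup>) = \<Sum>\<^sub>k f\<^sup>(\<^sup>m\<^sup>-\<^sup>k\<^sup>) e\<^sup>(\<^sup>m\<^sup>-\<^sup>k\<^sup>) binom h k\<close>, where \<open>h\<close> is the commutator of \<open>e\<close> and \<open>f\<close>;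
  in terms of matrix entries it is the Vandermonde convolution.\<close>

lemma up_down_commutation:
  assumes ij: "i \<in> {1..n}" "j \<in> {1..n}" "i \<noteq> j" and u: "u \<in> words n d" and w: "w \<in> words n d"
  shows "(\<Sum>v\<in>words n d. moves_matrix (replicate_mset m (i, j)) u v * moves_matrix (replicate_mset m (j, i)) v w) =
    (\<Sum>k\<le>m. (\<Sum>v\<in>words n d. moves_matrix (replicate_mset (m - k) (j, i)) u v *
        moves_matrix (replicate_mset (m - k) (i, j)) v w) *
      ((of_nat (count_list w i) - of_nat (count_list w j)) gchoose k))"
proof -
  let ?A = "places i j u w" and ?B = "places j i u w"
  let ?D = "\<forall>k\<in>diff_places u w. (u ! k, w ! k) \<in> {(i, j), (j, i)}"
  have D: "(\<forall>k\<in>diff_places u w. (u ! k, w ! k) \<in> {(j, i), (i, j)}) = ?D" by auto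
  show ?thesis
  proof (cases "?D \<and> card ?A = card ?B \<and> card ?A \<le> m")
    case False
    have F: "\<not> (?D \<and> card ?B = card ?A \<and> card ?B \<le> m - k)" for k using False by auto
    show ?thesis
      unfolding sum_moves_matrix_mult card_up_down[OF ij(2,3) u w] card_up_down[OF ij(1) ij(3)[symmetric] u w] D
        if_not_P[OF False] if_not_P[OF F] by simp
  next
    case True
    define p a b where "p = card ?A" and "a = card (places i i u w)" and "b = card (places j j u w)"
    have pB: "card ?B = p" using True by (simp add: p_def)
    \<comment> \<open>In w the letter i also stands in the p places with (j, i), and j in the p
      places with (i, j); these cancel in the difference.\<close>
    have h: "of_nat (count_list w i) - of_nat (count_list w j) = (of_nat a - of_nat b :: rat)"
      using count_list_places[OF u w ij(3)] count_list_places[OF u w ij(3)[symmetric]] True D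
      by (simp add: a_def b_def)
    \<comment> \<open>The summands with k > m - p vanish; the rest is the convolution for (a - b) +
      b = a. As a - b may be negative, it takes generalized binomials.\<close>
    have "(\<Sum>k\<le>m. of_nat (if p \<le> m - k then b choose (m - k - p) else 0) * ((of_nat a - of_nat b) gchoose k)) =
        (\<Sum>k\<le>m - p. ((of_nat a - of_nat b) gchoose k) * (of_nat b gchoose (m - p - k)) :: rat)"
      using True by (intro sum.mono_neutral_cong_right)
        (auto simp: p_def binomial_gbinomial mult.commute diff_commute add.commute)
    also have "\<dots> = of_nat a gchoose (m - p)"
      using gbinomial_Vandermonde[of "of_nat a - of_nat b :: rat" "of_nat b" "m - p"] by (simp add: atMost_atLeast0)
    finally show ?thesis
      unfolding sum_moves_matrix_mult card_up_down[OF ij(2,3) u w] card_up_down[OF ij(1) ij(3)[symmetric] u w] D h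
      using True by (simp add: pB p_def[symmetric] a_def[symmetric] b_def[symmetric] binomial_gbinomial cong: if_cong)
  qed
qed

text \<open>A place with letters (i, l) must pass through j, and every other changed place takes one
  step only, so the middle word is forced and only the numbers of changes have to fit.\<close>

lemma card_cascade:
  assumes ijl: "j \<in> {1..n}" "i \<noteq> j" "j \<noteq> l" "i \<noteq> l" and u: "u \<in> words n d" and w: "w \<in> words n d"
  shows "card {v \<in> words n d. moves u v = replicate_mset m (i, j) \<and> moves v w = replicate_mset m (j, l)} =
    (if (\<forall>k\<in>diff_places u w. (u ! k, w ! k) \<in> {(i, j), (j, l), (i, l)}) \<and>
        card (places i j u w) + card (places i l u w) = m \<and> card (places j l u w) + card (places i l u w) = m
     then 1 else 0)"
proof -
  let ?V = "{v \<in> words n d. moves u v = replicate_mset m (i, j) \<and> moves v w = replicate_mset m (j, l)}"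
  let ?A = "places i j u w" and ?B = "places j l u w" and ?C = "places i l u w"
  let ?X = "(\<forall>k\<in>diff_places u w. (u ! k, w ! k) \<in> {(i, j), (j, l), (i, l)}) \<and>
        card ?A + card ?C = m \<and> card ?B + card ?C = m"
  define x where "x = map (\<lambda>k. if k \<in> ?A \<union> ?C then j else u ! k) [0..<d]"
  have lu: "length u = d" "length w = d" using u w by (auto simp: words_def)
  have dj: "?A \<inter> ?C = {}" "?B \<inter> ?C = {}" using ijl by (auto simp: places_def)
  have A: "?X \<and> v = x" if v: "v \<in> ?V" for v
  proof -
    have lv: "length v = d" using v by (auto simp: words_def)
    have up: "u ! k = v ! k \<or> u ! k = i \<and> v ! k = j" if "k < d" for k
      using v that lu by (auto simp: moves_replicate_iff diff_places_def)
    have down: "v ! k = w ! k \<or> v ! k = j \<and> w ! k = l" if "k < d" for k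
      using v that lv by (auto simp: moves_replicate_iff diff_places_def)
    have D: "diff_places u v = ?A \<union> ?C" "diff_places v w = ?B \<union> ?C"
      using up down ijl lu lv by (fastforce simp: diff_places_def places_def)+
    have "card (diff_places u v) = m" "card (diff_places v w) = m"
      using v by (auto simp: moves_replicate_iff)
    then have c: "card ?A + card ?C = m" "card ?B + card ?C = m"
      using dj by (simp_all add: D card_Un_disjoint)
    have "\<forall>k\<in>diff_places u w. (u ! k, w ! k) \<in> {(i, j), (j, l), (i, l)}"
      using up down lu by (fastforce simp: diff_places_def)
    moreover have "v = x"
    proof (rule nth_equalityI)
      fix k assume "k < length v"
      then show "v ! k = x ! k"
        using up[of k] down[of k] ijl lu lv by (auto simp: x_def places_def)
    qed (simp add: x_def lv)
    ultimately show ?thesis using c by blast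
  qed
  show ?thesis
  proof (cases ?X)
    case True
    have xk: "x ! k = (if k \<in> ?A \<union> ?C then j else u ! k)" if "k < d" for k
      using that by (simp add: x_def)
    have lx: "length x = d" by (simp add: x_def)
    have uw: "u ! k = w ! k \<or> k \<in> ?A \<or> k \<in> ?B \<or> k \<in> ?C" if "k < d" for k
      using True that lu by (auto simp: diff_places_def places_def)
    have D: "diff_places u x = ?A \<union> ?C"
    proof (intro equalityI subsetI)
      fix k assume "k \<in> diff_places u x"
      then show "k \<in> ?A \<union> ?C" using xk[of k] lu by (simp add: diff_places_def split: if_splits)
    next
      fix k assume k: "k \<in> ?A \<union> ?C"
      then have "k < d" "u ! k = i" using lu by (auto simp: places_def)
      then show "k \<in> diff_places u x" using xk[of k] k ijl lu by (simp add: diff_places_def)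
    qed
    have D': "diff_places x w = ?B \<union> ?C"
    proof (intro equalityI subsetI)
      fix k assume "k \<in> diff_places x w"
      then show "k \<in> ?B \<union> ?C" using uw[of k] by (auto simp: diff_places_def xk lx places_def split: if_splits)
    next
      fix k assume "k \<in> ?B \<union> ?C"
      then show "k \<in> diff_places x w" using ijl lu by (auto simp: diff_places_def xk lx places_def)
    qed
    have "x \<in> words n d" using u ijl words_nth[OF u] by (auto simp: words_def x_def)
    moreover have "moves u x = replicate_mset m (i, j)"
      unfolding moves_replicate_iff D using dj True
      by (auto simp: card_Un_disjoint xk places_def lu)
    moreover have "moves x w = replicate_mset m (j, l)"
      unfolding moves_replicate_iff D' using dj True ijl
      by (auto simp: card_Un_disjoint xk places_def lu)
    ultimately have "?V = {x}" using A by blast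
    then show ?thesis unfolding if_P[OF True] by simp
  next
    case False
    then have "?V = {}" using A by blast
    then show ?thesis unfolding if_not_P[OF False] by (simp only: card.empty)
  qed
qed

lemma moves_eq_three:
  assumes "i \<noteq> j" "j \<noteq> l" "i \<noteq> l"
  shows "moves u w = replicate_mset p (j, l) + replicate_mset q (i, l) + replicate_mset r (i, j) \<longleftrightarrow>
    (\<forall>k\<in>diff_places u w. (u ! k, w ! k) \<in> {(i, j), (j, l), (i, l)}) \<and>
     card (places j l u w) = p \<and> card (places i l u w) = q \<and> card (places i j u w) = r" (is "?L \<longleftrightarrow> ?R")
proof
  assume L: ?L
  have "(u ! k, w ! k) \<in> {(i, j), (j, l), (i, l)}" if k: "k \<in> diff_places u w" for k
  proof -
    have "(u ! k, w ! k) \<in># moves u w" using k by (auto simp: set_moves)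
    then show ?thesis unfolding L by (auto split: if_splits)
  qed
  then show ?R using L count_moves[of j l u w] count_moves[of i l u w] count_moves[of i j u w] assms by auto
next
  assume R: ?R
  show ?L
  proof (rule multiset_eqI)
    fix q' :: "nat \<times> nat"
    obtain a b where q': "q' = (a, b)" by (cases q')
    show "count (moves u w) q' = count (replicate_mset p (j, l) + replicate_mset q (i, l) + replicate_mset r (i, j)) q'"
    proof (cases "q' \<in> {(i, j), (j, l), (i, l)}")
      case True
      then show ?thesis
        using R count_moves[of j l u w] count_moves[of i l u w] count_moves[of i j u w] assms by auto
    next
      case False
      then have "q' \<notin># moves u w" using R by (auto simp: set_moves)
      then show ?thesis using False by (auto simp: not_in_iff)
    qed
  qed
qed

text \<open>The identity \<open>x\<^sup>(\<^sup>m\<^sup>) y\<^sup>(\<^sup>m\<^sup>) = \<Sum>\<^sub>k y\<^sup>(\<^sup>m\<^sup>-\<^sup>k\<^sup>) z\<^sup>(\<^sup>k\<^sup>) x\<^sup>(\<^sup>m\<^sup>-\<^sup>k\<^sup>)\<close> for the root vectors \<open>x\<close>, \<open>y\<close>, \<open>z\<close> of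
  \<open>\<epsilon>\<^sub>i - \<epsilon>\<^sub>j\<close>, \<open>\<epsilon>\<^sub>j - \<epsilon>\<^sub>l\<close>, \<open>\<epsilon>\<^sub>i - \<epsilon>\<^sub>l\<close>.\<close>

lemma cascade_commutation:
  assumes ijl: "j \<in> {1..n}" "i \<noteq> j" "j \<noteq> l" "i \<noteq> l" and u: "u \<in> words n d" and w: "w \<in> words n d"
  shows "(\<Sum>v\<in>words n d. moves_matrix (replicate_mset m (i, j)) u v * moves_matrix (replicate_mset m (j, l)) v w) =
    (\<Sum>k\<le>m. moves_matrix (replicate_mset (m - k) (j, l) + replicate_mset k (i, l) + replicate_mset (m - k) (i, j)) u w)"
proof -
  let ?A = "places i j u w" and ?B = "places j l u w" and ?C = "places i l u w"
  let ?D = "\<forall>k\<in>diff_places u w. (u ! k, w ! k) \<in> {(i, j), (j, l), (i, l)}"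
  let ?X = "?D \<and> card ?A + card ?C = m \<and> card ?B + card ?C = m"
  \<comment> \<open>The number of places with (i, l) singles out the only summand that can be
    nonzero.\<close>
  have "(\<Sum>k\<le>m. moves_matrix (replicate_mset (m - k) (j, l) + replicate_mset k (i, l) + replicate_mset (m - k) (i, j)) u w) =
    (\<Sum>k\<le>m. if k = card ?C then of_bool ?X else 0)"
    unfolding moves_matrix_def moves_eq_three[OF ijl(2-4)] by (intro sum.cong refl) auto
  also have "\<dots> = of_bool ?X" by auto
  finally show ?thesis unfolding sum_moves_matrix_mult card_cascade[OF ijl u w] by simp
qed

section \<open>The subring generated by the simple divided powers\<close>

definition generators :: "nat \<Rightarrow> nat \<Rightarrow> (tensor \<Rightarrow> tensor) set" where
  "generators n d =
     {divided_power n d (e_op n d i) m | i m. 1 \<le> i \<and> i \<le> n - 1} \<union>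
     {divided_power n d (f_op n d i) m | i m. 1 \<le> i \<and> i \<le> n - 1}"

definition generated :: "nat \<Rightarrow> nat \<Rightarrow> (tensor \<Rightarrow> tensor) set" where
  "generated n d = generate_ring (schur_algebra n d) (generators n d)"

text \<open>Only entries at words count, so a matrix may be given by any formula that is correct
  there, and membership is shown by computing with numbers instead of maps.\<close>

definition gen_matrices :: "nat \<Rightarrow> nat \<Rightarrow> (nat list \<Rightarrow> nat list \<Rightarrow> rat) set" where
  "gen_matrices n d = {M. \<exists>f\<in>generated n d. \<forall>u\<in>words n d. \<forall>w\<in>words n d. entry f u w = M u w}"

lemma generators_closed: "generators n d \<subseteq> carrier (schur_algebra n d)"
  by (auto simp: generators_def e_op_def f_op_def intro!: divided_power_closed gl_op_closed)

lemma generated_closed: "generated n d \<subseteq> carrier (schur_algebra n d)"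
  unfolding generated_def by (rule ring.generate_ring_incl[OF ring_schur_algebra generators_closed])

lemma gen_matricesI: "f \<in> generated n d \<Longrightarrow> entry f \<in> gen_matrices n d"
  by (auto simp: gen_matrices_def)

lemma gen_matricesE:
  assumes "M \<in> gen_matrices n d"
  obtains f where "f \<in> generated n d" "f \<in> carrier (schur_algebra n d)"
    "\<forall>u\<in>words n d. \<forall>w\<in>words n d. entry f u w = M u w"
proof -
  obtain f where "f \<in> generated n d" "\<forall>u\<in>words n d. \<forall>w\<in>words n d. entry f u w = M u w"
    using assms unfolding gen_matrices_def by blast
  then show thesis using that generated_closed by blast
qed

text \<open>The way back to the algebra: entries at words determine an element of the carrier, so
  the generated element with this matrix is f itself.\<close>

lemma gen_matricesD:
  assumes "entry f \<in> gen_matrices n d" "f \<in> carrier (schur_algebra n d)"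
  shows "f \<in> generated n d"
proof -
  obtain g where "g \<in> generated n d" "g \<in> carrier (schur_algebra n d)"
    "\<forall>u\<in>words n d. \<forall>w\<in>words n d. entry g u w = entry f u w"
    using assms(1) by (rule gen_matricesE)
  then show ?thesis using schur_eqI[of g n d f] assms(2) by simp
qed

lemma gen_matrices_cong:
  "M \<in> gen_matrices n d \<Longrightarrow> (\<And>u w. u \<in> words n d \<Longrightarrow> w \<in> words n d \<Longrightarrow> N u w = M u w) \<Longrightarrow>
    N \<in> gen_matrices n d"
  by (simp add: gen_matrices_def)

lemma gen_matrices_add:
  assumes "M \<in> gen_matrices n d" "N \<in> gen_matrices n d"
  shows "(\<lambda>u w. M u w + N u w) \<in> gen_matrices n d"
  using assms(1)
proof (rule gen_matricesE)
  fix f assume f: "f \<in> generated n d" "f \<in> carrier (schur_algebra n d)"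
    "\<forall>u\<in>words n d. \<forall>w\<in>words n d. entry f u w = M u w"
  obtain g where g: "g \<in> generated n d" "g \<in> carrier (schur_algebra n d)"
    "\<forall>u\<in>words n d. \<forall>w\<in>words n d. entry g u w = N u w"
    using assms(2) by (rule gen_matricesE)
  have "f \<oplus>\<^bsub>schur_algebra n d\<^esub> g \<in> generated n d"
    using f g unfolding generated_def by (intro generate_ring.eng_add)
  then show ?thesis
    by (rule gen_matrices_cong[OF gen_matricesI]) (use f g in \<open>simp add: entry_add\<close>)
qed

lemma gen_matrices_mult:
  assumes "M \<in> gen_matrices n d" "N \<in> gen_matrices n d"
  shows "(\<lambda>u w. \<Sum>v\<in>words n d. M u v * N v w) \<in> gen_matrices n d"
  using assms(1)
proof (rule gen_matricesE)
  fix f assume f: "f \<in> generated n d" "f \<in> carrier (schur_algebra n d)"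
    "\<forall>u\<in>words n d. \<forall>w\<in>words n d. entry f u w = M u w"
  obtain g where g: "g \<in> generated n d" "g \<in> carrier (schur_algebra n d)"
    "\<forall>u\<in>words n d. \<forall>w\<in>words n d. entry g u w = N u w"
    using assms(2) by (rule gen_matricesE)
  have "f \<otimes>\<^bsub>schur_algebra n d\<^esub> g \<in> generated n d"
    using f g unfolding generated_def by (intro generate_ring.eng_mult)
  then show ?thesis
    by (rule gen_matrices_cong[OF gen_matricesI]) (use f g in \<open>simp add: entry_mult\<close>)
qed

lemma gen_matrices_uminus:
  assumes "M \<in> gen_matrices n d"
  shows "(\<lambda>u w. - M u w) \<in> gen_matrices n d"
  using assms
proof (rule gen_matricesE)
  fix f assume f: "f \<in> generated n d" "f \<in> carrier (schur_algebra n d)"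
    "\<forall>u\<in>words n d. \<forall>w\<in>words n d. entry f u w = M u w"
  have "\<ominus>\<^bsub>schur_algebra n d\<^esub> f \<in> generated n d"
    using f unfolding generated_def by (intro generate_ring.a_inv)
  then show ?thesis
    by (rule gen_matrices_cong[OF gen_matricesI]) (use f in \<open>simp add: entry_uminus\<close>)
qed

lemma gen_matrices_one: "(\<lambda>u w. of_bool (u = w)) \<in> gen_matrices n d"
proof -
  have "\<one>\<^bsub>schur_algebra n d\<^esub> \<in> generated n d" unfolding generated_def by (rule generate_ring.one)
  then show ?thesis by (rule gen_matrices_cong[OF gen_matricesI]) (simp add: entry_one)
qed

lemma gen_matrices_zero: "(\<lambda>u w. 0) \<in> gen_matrices n d"
  using gen_matrices_add[OF gen_matrices_one gen_matrices_uminus[OF gen_matrices_one]] by simp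

lemma gen_matrices_sum:
  assumes "finite A" "\<And>a. a \<in> A \<Longrightarrow> M a \<in> gen_matrices n d"
  shows "(\<lambda>u w. \<Sum>a\<in>A. M a u w) \<in> gen_matrices n d"
  using assms by (induction A) (auto intro: gen_matrices_zero gen_matrices_add)

lemma gen_matrices_int_scale:
  assumes "M \<in> gen_matrices n d"
  shows "(\<lambda>u w. of_int c * M u w) \<in> gen_matrices n d"
proof -
  have nat: "(\<lambda>u w. of_nat k * M u w) \<in> gen_matrices n d" for k
    using gen_matrices_sum[of "{..<k}" "\<lambda>_. M" n d] assms by simp
  show ?thesis
  proof (cases c)
    case (nonneg k)
    then show ?thesis using nat by simp
  next
    case (neg k)
    then show ?thesis using gen_matrices_uminus[OF nat[of "Suc k"]] by (simp only: of_int_minus of_int_of_nat_eq minus_mult_left)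
  qed
qed

lemma gen_matrices_diff:
  "M \<in> gen_matrices n d \<Longrightarrow> N \<in> gen_matrices n d \<Longrightarrow> (\<lambda>u w. M u w - N u w) \<in> gen_matrices n d"
  using gen_matrices_add[OF _ gen_matrices_uminus, of M n d N] by simp

section \<open>Divided powers of all root vectors\<close>

lemma gen_matrices_simple:
  assumes "1 \<le> i" "i \<le> n - 1"
  shows "moves_matrix (replicate_mset m (i, i + 1)) \<in> gen_matrices n d"
    and "moves_matrix (replicate_mset m (i + 1, i)) \<in> gen_matrices n d"
proof -
  have i: "i \<in> {1..n}" "i + 1 \<in> {1..n}" using assms by auto
  have "divided_power n d (e_op n d i) m \<in> generated n d" "divided_power n d (f_op n d i) m \<in> generated n d"
    using assms unfolding generated_def by (intro generate_ring.incl; force simp: generators_def)+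
  note G = this[THEN gen_matricesI, THEN gen_matrices_cong]
  show "moves_matrix (replicate_mset m (i, i + 1)) \<in> gen_matrices n d"
    by (rule G(1)) (use i in \<open>simp add: e_op_def entry_divided_power moves_matrix_def\<close>)
  show "moves_matrix (replicate_mset m (i + 1, i)) \<in> gen_matrices n d"
    by (rule G(2)) (use i in \<open>simp add: f_op_def entry_divided_power moves_matrix_def\<close>)
qed

text \<open>In \<open>cascade_commutation\<close> the summand k = m is the wanted divided power;
  each other summand contains only a smaller one, available by induction.\<close>

lemma gen_matrices_commutator:
  assumes ijl: "j \<in> {1..n}" "i \<noteq> j" "j \<noteq> l" "i \<noteq> l"
    and ij: "\<And>m. moves_matrix (replicate_mset m (i, j)) \<in> gen_matrices n d"
    and jl: "\<And>m. moves_matrix (replicate_mset m (j, l)) \<in> gen_matrices n d"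
  shows "moves_matrix (replicate_mset m (i, l)) \<in> gen_matrices n d"
proof (induction m rule: less_induct)
  case (less m)
  let ?E = "\<lambda>k. replicate_mset (m - k) (j, l) + replicate_mset k (i, l) + replicate_mset (m - k) (i, j)"
  have "moves_matrix (?E k) \<in> gen_matrices n d" if "k < m" for k
  proof -
    \<comment> \<open>In the order (j, l), (i, l), (i, j) no move ends where a later one starts, so
      the summand is a product of divided powers.\<close>
    have 1: "moves_matrix (replicate_mset (m - k) (j, l) + replicate_mset k (i, l)) \<in> gen_matrices n d"
      by (rule gen_matrices_cong[OF gen_matrices_mult[OF jl less[OF that]]], subst moves_matrix_mult)
        (use ijl in \<open>auto split: if_splits\<close>)
    show ?thesis
      by (rule gen_matrices_cong[OF gen_matrices_mult[OF 1 ij]], subst moves_matrix_mult)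
        (use ijl in \<open>auto split: if_splits\<close>)
  qed
  then have "(\<lambda>u w. \<Sum>k<m. moves_matrix (?E k) u w) \<in> gen_matrices n d"
    by (intro gen_matrices_sum) auto
  from gen_matrices_diff[OF gen_matrices_mult[OF ij[of m] jl[of m]] this] show ?case
  proof (rule gen_matrices_cong)
    fix u w assume u: "u \<in> words n d" and w: "w \<in> words n d"
    show "moves_matrix (replicate_mset m (i, l)) u w =
      (\<Sum>v\<in>words n d. moves_matrix (replicate_mset m (i, j)) u v * moves_matrix (replicate_mset m (j, l)) v w) -
      (\<Sum>k<m. moves_matrix (?E k) u w)"
      unfolding cascade_commutation[OF ijl u w] lessThan_Suc_atMost[symmetric] by simp
  qed
qed

text \<open>By induction on the height, a root is the sum of a shorter one and a simple one. The
  simple root comes second for positive roots and first for negative ones, so that the two share the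
  middle letter.\<close>

lemma gen_matrices_root:
  assumes "\<alpha> \<in> roots n"
  shows "moves_matrix (replicate_mset m \<alpha>) \<in> gen_matrices n d"
proof -
  have up: "i + Suc k \<le> n \<Longrightarrow> moves_matrix (replicate_mset m (i, i + Suc k)) \<in> gen_matrices n d"
    and down: "i + Suc k \<le> n \<Longrightarrow> moves_matrix (replicate_mset m (i + Suc k, i)) \<in> gen_matrices n d"
    if "1 \<le> i" for i k m
  proof (induction k arbitrary: m)
    case 0
    case 1 then show ?case using that gen_matrices_simple(1)[of i n m d] by simp
    case 2 then show ?case using that gen_matrices_simple(2)[of i n m d] by simp
  next
    case (Suc k)
    {
      case 1
      have a: "moves_matrix (replicate_mset m (i + Suc k, i + Suc k + 1)) \<in> gen_matrices n d" for m
        using 1 that by (intro gen_matrices_simple) auto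
      have b: "moves_matrix (replicate_mset m (i, i + Suc k)) \<in> gen_matrices n d" for m
        using 1 by (intro Suc(1)) simp
      show ?case
        using gen_matrices_commutator[OF _ _ _ _ b a] 1 that by simp
    next
      case 2
      have a: "moves_matrix (replicate_mset m (i + Suc k + 1, i + Suc k)) \<in> gen_matrices n d" for m
        using 2 that by (intro gen_matrices_simple) auto
      have b: "moves_matrix (replicate_mset m (i + Suc k, i)) \<in> gen_matrices n d" for m
        using 2 by (intro Suc(2)) simp
      show ?case
        using gen_matrices_commutator[OF _ _ _ _ a b] 2 that by simp
    }
  qed
  obtain i j where ij: "\<alpha> = (i, j)" "1 \<le> i" "1 \<le> j" "i \<le> n" "j \<le> n" "i \<noteq> j"
    using assms by (cases \<alpha>) (auto simp: roots_def)
  show ?thesis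
  proof (cases "i < j")
    case True
    then obtain k where "j = i + Suc k" using less_imp_Suc_add by fastforce
    then show ?thesis using up[of i k m] ij by simp
  next
    case False
    then obtain k where "i = j + Suc k" using less_imp_Suc_add[of j i] ij by fastforce
    then show ?thesis using down[of j k m] ij by simp
  qed
qed

section \<open>Diagonal matrices and the idempotents\<close>

abbreviation diagonal :: "(nat list \<Rightarrow> rat) \<Rightarrow> nat list \<Rightarrow> nat list \<Rightarrow> rat" where
  "diagonal \<phi> \<equiv> \<lambda>u w. of_bool (u = w) * \<phi> w"

lemma sum_times_diagonal:
  assumes "w \<in> words n d"
  shows "(\<Sum>v\<in>words n d. M u v * diagonal \<phi> v w) = M u w * \<phi> w"
proof -
  have "(\<Sum>v\<in>words n d. M u v * diagonal \<phi> v w) = (\<Sum>v\<in>words n d. if v = w then M u w * \<phi> w else 0)"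
    by (intro sum.cong) auto
  then show ?thesis using assms by (simp add: finite_words)
qed

lemma gen_matrices_times_diagonal:
  assumes "M \<in> gen_matrices n d" "diagonal \<phi> \<in> gen_matrices n d"
  shows "(\<lambda>u w. M u w * \<phi> w) \<in> gen_matrices n d"
  by (rule gen_matrices_cong[OF gen_matrices_mult[OF assms]]) (simp only: sum_times_diagonal)

lemma diagonal_mult:
  assumes "diagonal \<phi> \<in> gen_matrices n d" "diagonal \<psi> \<in> gen_matrices n d"
  shows "diagonal (\<lambda>u. \<phi> u * \<psi> u) \<in> gen_matrices n d"
  using gen_matrices_times_diagonal[OF assms] by (simp add: mult.assoc)

text \<open>In \<open>up_down_commutation\<close> the summand k = m carries zeroth divided powers,
  hence is the diagonal matrix itself; the other summands contain smaller binomials, available by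
  induction.\<close>

lemma diagonal_gbinomial:
  assumes ij: "i \<in> {1..n}" "j \<in> {1..n}" "i \<noteq> j"
  shows "diagonal (\<lambda>w. (of_nat (count_list w i) - of_nat (count_list w j)) gchoose m) \<in> gen_matrices n d"
proof (induction m rule: less_induct)
  case (less m)
  let ?\<phi> = "\<lambda>k w. (of_nat (count_list w i) - of_nat (count_list w j) :: rat) gchoose k"
  let ?X = "\<lambda>k u w. \<Sum>v\<in>words n d. moves_matrix (replicate_mset (m - k) (j, i)) u v *
        moves_matrix (replicate_mset (m - k) (i, j)) v w"
  have r: "moves_matrix (replicate_mset m (i, j)) \<in> gen_matrices n d"
    "moves_matrix (replicate_mset m (j, i)) \<in> gen_matrices n d" for m
    using ij by (auto intro!: gen_matrices_root simp: roots_def)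
  have "(\<lambda>u w. ?X k u w * ?\<phi> k w) \<in> gen_matrices n d" if "k < m" for k
    by (rule gen_matrices_times_diagonal[OF gen_matrices_mult[OF r(2) r(1)] less[OF that]])
  then have "(\<lambda>u w. \<Sum>k<m. ?X k u w * ?\<phi> k w) \<in> gen_matrices n d"
    by (intro gen_matrices_sum) auto
  from gen_matrices_diff[OF gen_matrices_mult[OF r(1)[of m] r(2)[of m]] this] show ?case
  proof (rule gen_matrices_cong)
    fix u w assume u: "u \<in> words n d" and w: "w \<in> words n d"
    have "?X m u w = (\<Sum>v\<in>words n d. moves_matrix {#} u v * diagonal (\<lambda>_. 1) v w)"
      using w by (intro sum.cong) (auto simp: moves_matrix_def moves_eq_empty_iff)
    also have "\<dots> = moves_matrix {#} u w * 1" by (rule sum_times_diagonal[OF w, of _ _ "\<lambda>_. 1"])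
    also have "\<dots> = of_bool (u = w)" using u w by (simp add: moves_matrix_def moves_eq_empty_iff)
    finally show "diagonal (?\<phi> m) u w =
      (\<Sum>v\<in>words n d. moves_matrix (replicate_mset m (i, j)) u v * moves_matrix (replicate_mset m (j, i)) v w) -
      (\<Sum>k<m. ?X k u w * ?\<phi> k w)"
      unfolding up_down_commutation[OF ij u w] lessThan_Suc_atMost[symmetric] by simp
  qed
qed

text \<open>The Vandermonde convolution with the natural number d has integral coefficients. The
  shift makes the upper argument a natural number on words of length d, where binomials can detect
  single values.\<close>

lemma diagonal_shifted_gbinomial:
  assumes ij: "i \<in> {1..n}" "j \<in> {1..n}" "i \<noteq> j"
  shows "diagonal (\<lambda>w. (of_nat (count_list w i) - of_nat (count_list w j) + of_nat d) gchoose m) \<in> gen_matrices n d"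
proof -
  have "(\<lambda>u w. \<Sum>k\<in>{0..m}. of_int (int (d choose (m - k))) *
      diagonal (\<lambda>w. (of_nat (count_list w i) - of_nat (count_list w j)) gchoose k) u w) \<in> gen_matrices n d"
    by (intro gen_matrices_sum gen_matrices_int_scale diagonal_gbinomial ij) auto
  then show ?thesis
    by (rule gen_matrices_cong)
      (simp add: gbinomial_Vandermonde[symmetric] binomial_gbinomial sum_distrib_left mult_ac)
qed

text \<open>If x < y, the first factor vanishes; if x > y, then N - x < N - y and the second one
  does.\<close>

lemma choose_times_choose_complement:
  fixes x y N :: nat
  assumes "x \<le> N" "y \<le> N"
  shows "(x choose y) * ((N - x) choose (N - y)) = of_bool (x = y)"
  using assms by (cases x y rule: linorder_cases) auto

text \<open>The indicator function of a single value of the difference \<open>h\<close> of two multiplicities is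
  \<open>binom (h + d) (c + d) * binom (d - h) (d - c)\<close>, because \<open>-d \<le> h \<le> d\<close>.\<close>

lemma diagonal_difference:
  assumes ij: "i \<in> {1..n}" "j \<in> {1..n}" "i \<noteq> j" and p: "p \<le> d" and q: "q \<le> d"
  shows "diagonal (\<lambda>w. of_bool (count_list w i + q = count_list w j + p)) \<in> gen_matrices n d"
proof -
  \<comment> \<open>The value to detect is c = p - q, so c + d is p + d - q; as p and q are at most
    d, no subtraction is truncated. \<open>choose_times_choose_complement\<close> is used with N =
    2d.\<close>
  have "diagonal (\<lambda>w. ((of_nat (count_list w i) - of_nat (count_list w j) + of_nat d) gchoose (p + d - q)) *
      ((of_nat (count_list w j) - of_nat (count_list w i) + of_nat d) gchoose (2 * d - (p + d - q)))) \<in> gen_matrices n d"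
    using ij by (intro diagonal_mult diagonal_shifted_gbinomial) auto
  then show ?thesis
  proof (rule gen_matrices_cong)
    fix u w assume w: "w \<in> words n d"
    define a b where "a = count_list w i" and "b = count_list w j"
    have le: "a \<le> d" "b \<le> d"
      using count_le_length[of w i] count_le_length[of w j] w by (auto simp: a_def b_def words_def)
    have 1: "of_nat a - of_nat b + of_nat d = (of_nat (a + d - b) :: rat)"
      "of_nat b - of_nat a + of_nat d = (of_nat (2 * d - (a + d - b)) :: rat)"
      using le by (auto simp: of_nat_diff)
    have "(of_nat (a + d - b) gchoose (p + d - q)) * (of_nat (2 * d - (a + d - b)) gchoose (2 * d - (p + d - q))) =
        (of_nat (((a + d - b) choose (p + d - q)) * ((2 * d - (a + d - b)) choose (2 * d - (p + d - q)))) :: rat)"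
      by (simp add: binomial_gbinomial)
    also have "\<dots> = of_bool (a + q = b + p)"
      using le p q by (subst choose_times_choose_complement) auto
    finally show "of_bool (u = w) * of_bool (count_list w i + q = count_list w j + p) =
      of_bool (u = w) * (((of_nat (count_list w i) - of_nat (count_list w j) + of_nat d) gchoose (p + d - q)) *
      ((of_nat (count_list w j) - of_nat (count_list w i) + of_nat d) gchoose (2 * d - (p + d - q))) :: rat)"
      unfolding a_def[symmetric] b_def[symmetric] 1 by simp
  qed
qed

text \<open>Equal consecutive differences mean that the multiplicities in w and in \<mu> differ by
  one constant. As both add up to d, n times this constant is 0.\<close>

lemma weight_determined:
  assumes \<mu>: "\<mu> \<in> weights n d" and w: "w \<in> words n d"
    and eq: "\<And>i. 1 \<le> i \<Longrightarrow> i < n \<Longrightarrow> count_list w i + \<mu> (i + 1) = count_list w (i + 1) + \<mu> i"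
    and i: "i \<in> {1..n}"
  shows "count_list w i = \<mu> i"
proof -
  let ?c = "int (count_list w 1) - int (\<mu> 1)"
  have "1 \<le> k \<Longrightarrow> k \<le> n \<Longrightarrow> int (count_list w k) - int (\<mu> k) = ?c" for k
  proof (induction k)
    case (Suc k)
    then show ?case using eq[of k] by (cases "k = 0") auto
  qed simp
  then have c: "int (count_list w k) = int (\<mu> k) + ?c" if "k \<in> {1..n}" for k
    using that by (smt (verit) atLeastAtMost_iff)
  have "int d = (\<Sum>k=1..n. int (count_list w k))"
    using sum_count_list_words[OF w] by (metis of_nat_sum)
  also have "\<dots> = (\<Sum>k=1..n. int (\<mu> k) + ?c)" by (intro sum.cong c) auto
  also have "\<dots> = int (\<Sum>k=1..n. \<mu> k) + int n * ?c" by (simp add: sum.distrib)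
  also have "int (\<Sum>k=1..n. \<mu> k) = int d" using \<mu> by (simp add: weights_def)
  finally have "?c = 0" using i by auto
  then show ?thesis using c[OF i] by simp
qed

text \<open>By \<open>weight_determined\<close> the differences of consecutive multiplicities cut
  out the weight \<mu>, so the idempotent is a product of indicators from
  \<open>diagonal_difference\<close>.\<close>

lemma idem_generated:
  assumes \<mu>: "\<mu> \<in> weights n d"
  shows "val n d (idem_word n \<mu>) \<in> generated n d"
proof (rule gen_matricesD[OF _ val_idem_word_closed])
  have le: "\<mu> i \<le> d" if "i \<in> {1..n}" for i
    using member_le_sum[of i "{1..n}" \<mu>] that \<mu> by (simp add: weights_def)
  have "diagonal (\<lambda>w. of_bool (\<forall>i\<in>A. count_list w i + \<mu> (i + 1) = count_list w (i + 1) + \<mu> i)) \<in> gen_matrices n d"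
    if "finite A" "A \<subseteq> {1..<n}" for A
    using that
  proof (induction A)
    case empty
    then show ?case using gen_matrices_one by simp
  next
    case (insert i A)
    then have "diagonal (\<lambda>w. of_bool (count_list w i + \<mu> (i + 1) = count_list w (i + 1) + \<mu> i) *
        of_bool (\<forall>i\<in>A. count_list w i + \<mu> (i + 1) = count_list w (i + 1) + \<mu> i)) \<in> gen_matrices n d"
      by (intro diagonal_mult diagonal_difference le) auto
    then show ?case by (simp only: of_bool_conj[symmetric] ball_simps)
  qed
  from this[of "{1..<n}"]
  have "diagonal (\<lambda>w. of_bool (\<forall>i\<in>{1..<n}. count_list w i + \<mu> (i + 1) = count_list w (i + 1) + \<mu> i)) \<in> gen_matrices n d"
    by simp
  then show "entry (val n d (idem_word n \<mu>)) \<in> gen_matrices n d"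
  proof (rule gen_matrices_cong)
    fix u w assume u: "u \<in> words n d" and w: "w \<in> words n d"
    have "(\<forall>i\<in>{1..<n}. count_list w i + \<mu> (i + 1) = count_list w (i + 1) + \<mu> i) \<longleftrightarrow>
        (\<forall>i\<in>{1..n}. count_list w i = \<mu> i)"
    proof (intro iffI ballI)
      fix i assume "\<forall>i\<in>{1..<n}. count_list w i + \<mu> (i + 1) = count_list w (i + 1) + \<mu> i" "i \<in> {1..n}"
      then show "count_list w i = \<mu> i" by (intro weight_determined[OF \<mu> w]) simp_all
    qed simp
    then show "entry (val n d (idem_word n \<mu>)) u w =
        of_bool (u = w) * of_bool (\<forall>i\<in>{1..<n}. count_list w i + \<mu> (i + 1) = count_list w (i + 1) + \<mu> i)"
      unfolding entry_val_idem_word[OF \<mu> u w] of_bool_conj by (cases "u = w") simp_all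
  qed
qed

lemma power_word_generated:
  assumes "fst ` set L \<subseteq> roots n"
  shows "val n d (power_word L) \<in> generated n d"
  using assms
proof (induction L)
  case Nil
  then show ?case by (simp add: val_def power_word_def schur_prod_def generated_def generate_ring.one)
next
  case (Cons x L)
  obtain \<alpha> m where x: "x = (\<alpha>, m)" by (cases x)
  have \<alpha>: "\<alpha> \<in> roots n" using Cons.prems by (simp add: x)
  have "entry (factor_val n d (Div_Pow \<alpha> m)) \<in> gen_matrices n d"
    by (rule gen_matrices_cong[OF gen_matrices_root[OF \<alpha>, of m]])
      (simp add: entry_root_power[OF \<alpha>] moves_matrix_def del: factor_val.simps)
  then have "factor_val n d (Div_Pow \<alpha> m) \<in> generated n d"
    by (rule gen_matricesD[OF _ root_power_closed[OF \<alpha>]])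
  moreover have "val n d (power_word L) \<in> generated n d" using Cons by simp
  ultimately show ?case
    unfolding generated_def
    by (auto simp: x val_def power_word_def schur_prod_def simp del: factor_val.simps intro: generate_ring.eng_mult)
qed

section \<open>Comparison with the integral form\<close>

lemma integral_one: "\<one>\<^bsub>schur_algebra n d\<^esub> \<in> integral_schur_algebra n d"
  using ring.ring_simprules(6)[OF ring_schur_algebra]
  by (auto simp: integral_schur_algebra_iff entry_one)

lemma generated_integral: "generated n d \<subseteq> integral_schur_algebra n d"
proof
  fix f assume "f \<in> generated n d"
  then show "f \<in> integral_schur_algebra n d"
    unfolding generated_def
  proof (induction rule: generate_ring.induct)
    case (incl h)
    have "divided_power n d (gl_op n d (matrix_unit a b)) m \<in> integral_schur_algebra n d"
      if "a \<in> {1..n}" "b \<in> {1..n}" "a \<noteq> b" for a b m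
      using that by (auto simp: integral_schur_algebra_iff entry_divided_power divided_power_closed gl_op_closed)
    then show ?case using incl by (auto simp: generators_def e_op_def f_op_def)
  next
    case (a_inv h)
    then show ?case by (intro integral_closed(4))
  qed (simp_all add: integral_one integral_closed)
qed

text \<open>The generated ring is closed under integral combinations, so it contains all that the
  basis spans; the other inclusion is \<open>generated_integral\<close>.\<close>

lemma Z_basis_generated:
  assumes B: "Z_basis (schur_algebra n d) B (integral_schur_algebra n d)" "B \<subseteq> generated n d"
  shows "integral_schur_algebra n d = generated n d"
proof
  show "generated n d \<subseteq> integral_schur_algebra n d" by (rule generated_integral)
  show "integral_schur_algebra n d \<subseteq> generated n d"
  proof
    fix x assume "x \<in> integral_schur_algebra n d"
    moreover have "\<forall>x\<in>integral_schur_algebra n d. \<exists>F c. finite F \<and> F \<subseteq> B \<and>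
        x = (\<Oplus>\<^bsub>schur_algebra n d\<^esub>b\<in>F. [(c b :: int)] \<cdot>\<^bsub>schur_algebra n d\<^esub> b)"
      using B(1) unfolding Z_basis_def by (elim conjE)
    ultimately obtain F and c :: "(tensor \<Rightarrow> tensor) \<Rightarrow> int" where F: "finite F" "F \<subseteq> B"
      and x: "x = (\<Oplus>\<^bsub>schur_algebra n d\<^esub>b\<in>F. [c b] \<cdot>\<^bsub>schur_algebra n d\<^esub> b)"
      by (elim bspec[elim_format] exE conjE)
    have Fc: "(\<lambda>b. b) \<in> F \<rightarrow> carrier (schur_algebra n d)" using F B(2) generated_closed by blast
    have "(\<lambda>u w. \<Sum>b\<in>F. of_int (c b) * entry b u w) \<in> gen_matrices n d"
      using F B(2) by (intro gen_matrices_sum gen_matrices_int_scale gen_matricesI) auto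
    then have "entry x \<in> gen_matrices n d"
      by (rule gen_matrices_cong) (simp add: x entry_lincomb[OF F(1) Fc])
    then show "x \<in> generated n d"
      by (rule gen_matricesD) (unfold x, rule lincomb_closed[OF Fc])
  qed
qed

context root_split
begin

lemma orbit_elt_generated:
  assumes "Q \<in> orbits n d"
  shows "orbit_elt Q \<in> generated n d"
proof -
  have "set (map (factor_val n d) (power_word (exps rl1 f))) \<subseteq> carrier (schur_algebra n d)"
    "set (map (factor_val n d) (power_word (exps rl2 f))) \<subseteq> carrier (schur_algebra n d)"
    "set (map (factor_val n d) (idem_word n \<mu>)) \<subseteq> carrier (schur_algebra n d)" for f \<mu>
    using roots_facts(2,4)[of f]
    by (auto simp: power_word_def idem_word_def H_binom_closed root_power_closed simp del: factor_val.simps(1))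
  then have "orbit_elt Q = val n d (power_word (exps rl1 (count Q))) \<otimes>\<^bsub>schur_algebra n d\<^esub>
      (val n d (idem_word n (mid_weight Q)) \<otimes>\<^bsub>schur_algebra n d\<^esub> val n d (power_word (exps rl2 (count Q))))"
    unfolding orbit_elt_def elt_def val_def map_append by (simp add: schur_prod_append)
  then show ?thesis
    using power_word_generated[OF roots_facts(2)[of "count Q"]] power_word_generated[OF roots_facts(4)[of "count Q"]]
      idem_generated[OF mid_weight_weights[OF assms]]
    unfolding generated_def by (simp add: generate_ring.eng_mult)
qed

lemma parts_integral_basis:
  "disjoint_family_on part (weights n d)"
  "Z_basis (schur_algebra n d) (\<Union>\<mu>\<in>weights n d. part \<mu>) (integral_schur_algebra n d)"
  "integral_schur_algebra n d = generated n d"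
proof -
  have "orbit_elt Q \<in> integral_schur_algebra n d" if "Q \<in> orbits n d" for Q
    using orbit_elt_generated[OF that] generated_integral by blast
  note P = parts_basis[OF this]
  show "disjoint_family_on part (weights n d)" by (rule P(1)) assumption
  show Z: "Z_basis (schur_algebra n d) (\<Union>\<mu>\<in>weights n d. part \<mu>) (integral_schur_algebra n d)"
    by (rule P(2)) assumption
  show "integral_schur_algebra n d = generated n d"
    by (rule Z_basis_generated[OF Z]) (use orbit_elt_generated in \<open>auto simp: Union_parts\<close>)
qed

end

section \<open>Translation to the two families of the theorem\<close>

lemma content_power_word_exps:
  assumes "distinct rl"
  shows "Defs.content ix (power_word (exps rl f)) k = (\<Sum>\<alpha>\<in>{\<alpha> \<in> set rl. ix (fst \<alpha>) (snd \<alpha>) = k}. f \<alpha>)"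
proof -
  have "Defs.content ix (power_word (exps rl f)) k = (\<Sum>\<alpha>\<leftarrow>rl. if ix (fst \<alpha>) (snd \<alpha>) = k then f \<alpha> else 0)"
    by (induction rl) (auto simp: Defs.content_def power_word_def exps_def)
  also have "\<dots> = (\<Sum>\<alpha>\<in>set rl. if ix (fst \<alpha>) (snd \<alpha>) = k then f \<alpha> else 0)"
    using assms by (rule sum.distinct_set_conv_list[symmetric])
  finally show ?thesis by (simp add: sum.inter_filter)
qed

lemma (in root_split) part_content:
  assumes "\<And>\<alpha>. \<alpha> \<in> roots n \<Longrightarrow> mid \<alpha> = ix (fst \<alpha>) (snd \<alpha>)"
  shows "part \<mu> = {elt \<mu> f | f.
    \<forall>k\<in>{1..n}. Defs.content ix (power_word (exps rl1 f) @ power_word (exps rl2 f)) k \<le> \<mu> k}"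
proof -
  have "Defs.content ix (power_word (exps rl1 f) @ power_word (exps rl2 f)) k =
      (\<Sum>\<alpha>\<in>{\<alpha> \<in> roots n. mid \<alpha> = k}. f \<alpha>)" for f k
  proof -
    have e: "power_word (exps rl1 f) @ power_word (exps rl2 f) = power_word (exps (rl1 @ rl2) f)"
      by (simp add: power_word_def exps_def)
    show ?thesis
      unfolding e content_power_word_exps[OF distinct] all_roots using assms by (auto intro!: sum.cong)
  qed
  then show ?thesis by (simp add: part_def)
qed

lemma e_word_eq: "(\<And>\<alpha>. \<alpha> \<in> set rs \<Longrightarrow> A \<alpha> = f \<alpha>) \<Longrightarrow> e_word rs A = power_word (exps rs f)"
  by (auto simp: e_word_def power_word_def exps_def)

lemma f_word_eq:
  "(\<And>\<alpha>. \<alpha> \<in> set ss \<Longrightarrow> C \<alpha> = f (prod.swap \<alpha>)) \<Longrightarrow>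
    f_word ss C = power_word (exps (map prod.swap ss) f)"
  by (auto simp: f_word_def power_word_def exps_def)

text \<open>C is read on the negative roots through the swap. With
  \<open>function_of_exponents\<close> this passes between a pair of extensional exponent families
  and one function on all roots.\<close>

lemma exponents_exist:
  fixes f :: "nat \<times> nat \<Rightarrow> nat"
  obtains A C where "A \<in> root_exponents n" "C \<in> root_exponents n"
    "\<And>\<alpha>. \<alpha> \<in> pos_roots n \<Longrightarrow> A \<alpha> = f \<alpha>" "\<And>\<alpha>. \<alpha> \<in> pos_roots n \<Longrightarrow> C \<alpha> = f (prod.swap \<alpha>)"
  by (rule that[of "restrict f (pos_roots n)" "restrict (f \<circ> prod.swap) (pos_roots n)"])
    (auto simp: root_exponents_def)

lemma function_of_exponents:
  fixes A C :: "nat \<times> nat \<Rightarrow> nat"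
  obtains f where "\<And>\<alpha>. \<alpha> \<in> pos_roots n \<Longrightarrow> A \<alpha> = f \<alpha>" "\<And>\<alpha>. \<alpha> \<in> pos_roots n \<Longrightarrow> C \<alpha> = f (prod.swap \<alpha>)"
  by (rule that[of "\<lambda>\<alpha>. if fst \<alpha> < snd \<alpha> then A \<alpha> else C (prod.swap \<alpha>)"])
    (auto simp: pos_roots_def)

lemma roots_eq: "roots n = pos_roots n \<union> prod.swap ` pos_roots n"
  by (auto simp: roots_def pos_roots_def image_iff)

lemma root_split_orders:
  assumes "root_order n rs" "root_order n ss"
  shows "root_split n rs (map prod.swap ss)" "root_split n (map prod.swap ss) rs"
proof -
  have "pos_roots n \<inter> prod.swap ` pos_roots n = {}" by (auto simp: pos_roots_def)
  then show "root_split n rs (map prod.swap ss)" "root_split n (map prod.swap ss) rs"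
    using assms by (auto simp: root_split_def root_order_def roots_eq distinct_map)
qed

text \<open>With the positive roots on the left, \<open>mid\<close> sends (a, b) to b if a < b and
  to a if a > b, so the middle letter is the maximum.\<close>

lemma Y_plus_part_eq:
  assumes rs: "root_order n rs" and ss: "root_order n ss"
  shows "Y_plus_part n d rs ss \<mu> = root_split.part n d rs (map prod.swap ss) \<mu>"
proof -
  interpret root_split n d rs "map prod.swap ss" by (rule root_split_orders(1)[OF rs ss])
  have set: "set rs = pos_roots n" "set ss = pos_roots n" using rs ss by (simp_all add: root_order_def)
  have part: "part \<mu> = {elt \<mu> f | f. \<forall>k\<in>{1..n}.
      Defs.content max (power_word (exps rs f) @ power_word (exps (map prod.swap ss) f)) k \<le> \<mu> k}"
    by (rule part_content) (auto simp: mid_def set pos_roots_def roots_def)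
  show ?thesis
  proof (intro equalityI subsetI)
    fix x assume "x \<in> Y_plus_part n d rs ss \<mu>"
    then obtain A C where x: "x = val n d (e_word rs A @ idem_word n \<mu> @ f_word ss C)"
      and c: "\<forall>k\<in>{1..n}. Defs.content max (e_word rs A @ f_word ss C) k \<le> \<mu> k"
      unfolding Y_plus_part_def by blast
    obtain f where f: "\<And>\<alpha>. \<alpha> \<in> pos_roots n \<Longrightarrow> A \<alpha> = f \<alpha>"
        "\<And>\<alpha>. \<alpha> \<in> pos_roots n \<Longrightarrow> C \<alpha> = f (prod.swap \<alpha>)"
      using function_of_exponents[of n A C] by metis
    have w: "e_word rs A = power_word (exps rs f)" "f_word ss C = power_word (exps (map prod.swap ss) f)"
      using f by (auto intro!: e_word_eq f_word_eq simp: set)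
    show "x \<in> part \<mu>" using c unfolding x w elt_def[symmetric] part by blast
  next
    fix x assume "x \<in> part \<mu>"
    then obtain f where x: "x = elt \<mu> f"
      and c: "\<forall>k\<in>{1..n}. Defs.content max (power_word (exps rs f) @ power_word (exps (map prod.swap ss) f)) k \<le> \<mu> k"
      unfolding part by blast
    obtain A C where AC: "A \<in> root_exponents n" "C \<in> root_exponents n"
        "\<And>\<alpha>. \<alpha> \<in> pos_roots n \<Longrightarrow> A \<alpha> = f \<alpha>" "\<And>\<alpha>. \<alpha> \<in> pos_roots n \<Longrightarrow> C \<alpha> = f (prod.swap \<alpha>)"
      using exponents_exist[of n f] by metis
    have w: "power_word (exps rs f) = e_word rs A" "power_word (exps (map prod.swap ss) f) = f_word ss C"
      using AC by (auto intro!: e_word_eq[symmetric] f_word_eq[symmetric] simp: set)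
    show "x \<in> Y_plus_part n d rs ss \<mu>"
      using c AC(1,2) unfolding x elt_def w Y_plus_part_def by blast
  qed
qed

text \<open>With the negative roots on the left, \<open>mid\<close> sends (a, b) to b if a > b and
  to a if a < b, so the middle letter is the minimum.\<close>

lemma Y_minus_part_eq:
  assumes rs: "root_order n rs" and ss: "root_order n ss"
  shows "Y_minus_part min n d rs ss \<mu> = root_split.part n d (map prod.swap ss) rs \<mu>"
proof -
  interpret root_split n d "map prod.swap ss" rs by (rule root_split_orders(2)[OF rs ss])
  have set: "set rs = pos_roots n" "set ss = pos_roots n" using rs ss by (simp_all add: root_order_def)
  have part: "part \<mu> = {elt \<mu> f | f. \<forall>k\<in>{1..n}.
      Defs.content min (power_word (exps (map prod.swap ss) f) @ power_word (exps rs f)) k \<le> \<mu> k}"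
    by (rule part_content) (auto simp: mid_def set pos_roots_def roots_def)
  show ?thesis
  proof (intro equalityI subsetI)
    fix x assume "x \<in> Y_minus_part min n d rs ss \<mu>"
    then obtain A C where x: "x = val n d (f_word ss A @ idem_word n \<mu> @ e_word rs C)"
      and c: "\<forall>k\<in>{1..n}. Defs.content min (f_word ss A @ e_word rs C) k \<le> \<mu> k"
      unfolding Y_minus_part_def by blast
    obtain f where f: "\<And>\<alpha>. \<alpha> \<in> pos_roots n \<Longrightarrow> C \<alpha> = f \<alpha>"
        "\<And>\<alpha>. \<alpha> \<in> pos_roots n \<Longrightarrow> A \<alpha> = f (prod.swap \<alpha>)"
      using function_of_exponents[of n C A] by metis
    have w: "e_word rs C = power_word (exps rs f)" "f_word ss A = power_word (exps (map prod.swap ss) f)"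
      using f by (auto intro!: e_word_eq f_word_eq simp: set)
    show "x \<in> part \<mu>" using c unfolding x w elt_def[symmetric] part by blast
  next
    fix x assume "x \<in> part \<mu>"
    then obtain f where x: "x = elt \<mu> f"
      and c: "\<forall>k\<in>{1..n}. Defs.content min (power_word (exps (map prod.swap ss) f) @ power_word (exps rs f)) k \<le> \<mu> k"
      unfolding part by blast
    obtain C A where AC: "C \<in> root_exponents n" "A \<in> root_exponents n"
        "\<And>\<alpha>. \<alpha> \<in> pos_roots n \<Longrightarrow> C \<alpha> = f \<alpha>" "\<And>\<alpha>. \<alpha> \<in> pos_roots n \<Longrightarrow> A \<alpha> = f (prod.swap \<alpha>)"
      using exponents_exist[of n f] by metis
    have w: "power_word (exps rs f) = e_word rs C" "power_word (exps (map prod.swap ss) f) = f_word ss A"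
      using AC by (auto intro!: e_word_eq[symmetric] f_word_eq[symmetric] simp: set)
    show "x \<in> Y_minus_part min n d rs ss \<mu>"
      using c AC(1,2) unfolding x elt_def w Y_minus_part_def by blast
  qed
qed

theorem theorem1p3:
  fixes n d :: nat and rs ss :: "(nat \<times> nat) list"
  assumes "n \<ge> 1" and "root_order n rs" and "root_order n ss"
  shows "integral_schur_algebra n d =
           generate_ring (schur_algebra n d)
             ({divided_power n d (e_op n d i) m | i m. 1 \<le> i \<and> i \<le> n - 1} \<union>
              {divided_power n d (f_op n d i) m | i m. 1 \<le> i \<and> i \<le> n - 1}) \<and>
         (disjoint_family_on (Y_plus_part n d rs ss) (weights n d) \<and>
          Z_basis (schur_algebra n d) (\<Union>\<mu>\<in>weights n d. Y_plus_part n d rs ss \<mu>)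
            (integral_schur_algebra n d)) \<and>
         (disjoint_family_on (Y_minus_part min n d rs ss) (weights n d) \<and>
          Z_basis (schur_algebra n d) (\<Union>\<mu>\<in>weights n d. Y_minus_part min n d rs ss \<mu>)
            (integral_schur_algebra n d))"
proof -
  have p: "Y_plus_part n d rs ss = root_split.part n d rs (map prod.swap ss)"
    using Y_plus_part_eq[OF assms(2,3)] by blast
  have m: "Y_minus_part min n d rs ss = root_split.part n d (map prod.swap ss) rs"
    using Y_minus_part_eq[OF assms(2,3)] by blast
  note R = root_split_orders[OF assms(2,3)]
  show ?thesis
    unfolding p m generators_def[symmetric] generated_def[symmetric]
    using root_split.parts_integral_basis[OF R(1)] root_split.parts_integral_basis[OF R(2)] by blast
qed

end
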